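(* For any virtual link $K$, $da^{(u)}(K)\geq \omega(K)$ and $da^{(u)}(K)=b_1(K)$.
   Context: Virtual links are represented by planar link diagrams with two types of crossings, classical crossings and virtual crossings, up to the virtual Reidemeister moves (the classical moves together with the moves allowing an arc with only virtual crossings to be rerouted arbitrarily with new virtual crossings). Bridge index $b_1$. An over-bridge of a virtual link diagram is a maximal length unbroken arc of the diagram which includes at least one classical overcrossing. Arcs are broken at classical undercrossings; an arc can pass through a virtual crossing and remain unbroken, so an over-bridge is an arc of the diagram containing only classical overcrossings, and potentially some virtual crossings as well. The bridge index $b_1(K)$ is the minimum number of over-bridges across all possible diagrams of the virtual link $K$. Wirtinger index. The strands of a virtual link diagram $D$ are its arcs broken at classical undercrossings; a strand may include virtual crossings. $D$ is $k$-partially colored, where $k$ is the number of starting colors, if there is a specified subset $A$ of the strands of $D$ and a function $f\colon A\to\{1,2,\ldots,k\}$; the tuple $(A,f)$ is a $k$-partial coloring. Two strands are adjacent at a classical crossing if they are the under-strands of that crossing. Given $k$-partial colorings $(A_1,f_1)$ and $(A_2,f_2)$ of $D$, $(A_2,f_2)$ is the result of a coloring move on $(A_1,f_1)$ if: (1) $A_1\subset A_2$ and $A_2\setminus A_1=\{s_j\}$ for some strand $s_j$ in $D$; (2) $f_2|_{A_1}=f_1$; (3) $s_j$ is adjacent to $s_i$ at some classical crossing $c$ of $D$, and $s_i\in A_1$; (4) the over-strand $s_k$ at $c$ is an element of $A_1$; (5) $f_1(s_i)=f_2(s_j)$. A diagram is fully colored if every strand has received a color. The Wirtinger number $\omega(D)$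 is the minimum value of $k$ such that, starting from $k$ initially colored seed strands (one for each of the $k$ colors), $D$ can be fully colored by a sequence of coloring moves. The Wirtinger index $\omega(K)$ of a virtual link $K$ is the minimal value of $\omega(D)$ over all virtual link diagrams $D$ for $K$. Unrestricted danceability. An unrestricted $n$-dance configuration for an oriented virtual link diagram is a choice of $n$ initial points on the diagram such that: (1) one dancer starts at each of the $n$ initial points, for a total of $n$ dancers; (2) each dancer travels in the direction of the chosen orientation of the diagram and stops dancing when they reach the next initial point, so that the total path traveled by all dancers traverses the entire diagram with no overlap; (3) the speed at which each dancer travels can vary and can be chosen so that the simultaneous tracing of the diagram by all $n$ dancers follows the over-first rule at every classical crossing: a dancer must pass through the crossing on the over-strand before a dancer can cross on the under-strand, and a dancer who reaches a crossing on an under-strand that has not yet been passed on the over-strand must wait until another dancer passes on the over-strand; (4) at every virtual crossing, a dancer can freely pass through the crossing without any time restriction or consideration of the other dancers' paths. For an oriented virtual link diagram $D$, the unrestricted number $da^{(u)}(D)$ is the minimum $n$ such that there exists an unrestricted $n$-dance configuration of $D$. For a virtual link $K$, the unrestricted danceability index $da^{(u)}(K)$ is the minimum unrestricted number over all diagrams representing $K$, with any choice of orientation.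
   Formalization: In the bridge index, a component of a diagram with no classical overcrossing is counted as one bridge; with the literal count of over-bridges the unknot would have bridge index 0 but danceability index 1, so the stated equality would fail. *)

theory Defs
  imports "HOL-Analysis.Analysis"
begin

section \<open>Virtual link diagrams\<close>

text \<open>
  A planar diagram with classical and virtual crossings is encoded by listing, for every component,
  the cyclic sequence of its passages through crossings of \<^emph>\<open>both\<close> kinds.  The empty list is a
  crossing-free circle.  Each crossing is passed twice, and each passage records
  \<^item> the name of the crossing;
  \<^item> its level: \<open>Over\<close> or \<open>Under\<close> at a classical crossing, \<open>Virtual\<close> at a virtual one;
  \<^item> a flag \<open>lead\<close>, true iff (direction of this passage, direction of the other passage) is a
    positively oriented basis of the plane.  At a classical crossing the flag of the \<open>Over\<close> passage
    is thus the sign of the crossing.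

  Together with the crossing data this determines the 4-valent plane map underlying the diagram;
  conversely, a sequence comes from a diagram in the plane iff that map has genus 0 (\<open>planar\<close> below).
  Listing a component requires a direction along it, so a code is an \<^emph>\<open>oriented\<close> diagram; an
  unoriented diagram is a code up to \<open>reverse_first\<close>.
\<close>

datatype level = Over | Under | Virtual

datatype passage = Passage (crossing: nat) (level: level) (lead: bool)

fun opposite :: "level \<Rightarrow> level" where
  "opposite Over = Under"
| "opposite Under = Over"
| "opposite Virtual = Virtual"

definition mate :: "passage \<Rightarrow> passage" where
  "mate x = Passage (crossing x) (opposite (level x)) (\<not> lead x)"

type_synonym code = "passage list list"

definition passages :: "code \<Rightarrow> passage set" where
  "passages D = set (concat D)"

text \<open>Passages of a valid code are pairwise distinct, so a passage also identifies its position.\<close>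

definition valid_code :: "code \<Rightarrow> bool" where
  "valid_code D \<longleftrightarrow> distinct (concat D) \<and>
     (\<forall>x\<in>passages D. mate x \<in> passages D \<and>
        (\<forall>y\<in>passages D. crossing y = crossing x \<longrightarrow> y = x \<or> y = mate x))"

definition classes :: "'a set \<Rightarrow> ('a \<Rightarrow> 'a \<Rightarrow> bool) \<Rightarrow> 'a set set" where
  "classes A r = A // {(a, b). a \<in> A \<and> b \<in> A \<and> equivclp r a b}"


subsection \<open>Planarity\<close>

text \<open>
  Half-edges are pairs \<open>(x, out)\<close>: the one leaving (\<open>out\<close>) or entering (\<open>\<not> out\<close>) the crossing along
  the passage \<open>x\<close>.  \<open>rotate_half x\<close> is the counterclockwise successor at the crossing: if \<open>x\<close> leads
  and \<open>y = mate x\<close>, the counterclockwise order is \<open>x\<close>-out, \<open>y\<close>-out, \<open>x\<close>-in, \<open>y\<close>-in.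
\<close>

type_synonym half_edge = "passage \<times> bool"

definition half_edges :: "code \<Rightarrow> half_edge set" where
  "half_edges D = passages D \<times> UNIV"

definition rotate_half :: "half_edge \<Rightarrow> half_edge" where
  "rotate_half h = (case h of (x, out) \<Rightarrow> (mate x, if lead x then out else \<not> out))"

definition follows :: "code \<Rightarrow> passage \<Rightarrow> passage \<Rightarrow> bool" where
  "follows D x y \<longleftrightarrow>
     (\<exists>w\<in>set D. \<exists>j<length w. x = w ! j \<and> y = w ! (Suc j mod length w))"

definition same_edge :: "code \<Rightarrow> half_edge \<Rightarrow> half_edge \<Rightarrow> bool" where
  "same_edge D h h' \<longleftrightarrow> (\<exists>x y. follows D x y \<and>
     (h = (x, True) \<and> h' = (y, False) \<or> h = (y, False) \<and> h' = (x, True)))"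

definition face_step :: "code \<Rightarrow> half_edge \<Rightarrow> half_edge \<Rightarrow> bool" where
  "face_step D h h' \<longleftrightarrow> (\<exists>g. same_edge D h g \<and> h' = rotate_half g)"

definition num_vertices :: "code \<Rightarrow> nat" where
  "num_vertices D = card (crossing ` passages D)"

definition num_edges :: "code \<Rightarrow> nat" where
  "num_edges D = length (concat D)"

definition num_faces :: "code \<Rightarrow> nat" where
  "num_faces D = card (classes (half_edges D) (face_step D))"

definition num_pieces :: "code \<Rightarrow> nat" where
  "num_pieces D = card (classes (half_edges D) (\<lambda>h h'. same_edge D h h' \<or> h' = rotate_half h))"

text \<open>
  Euler's formula, summed over the connected pieces of the underlying graph; each piece contributes
  at most 2, so equality says that every piece has genus 0.  Crossing-free circles play no role.
\<close>

definition planar :: "code \<Rightarrow> bool" where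
  "planar D \<longleftrightarrow>
     int (num_vertices D) - int (num_edges D) + int (num_faces D) = 2 * int (num_pieces D)"

definition diagram :: "code \<Rightarrow> bool" where
  "diagram D \<longleftrightarrow> valid_code D \<and> planar D"


subsection \<open>Virtual Reidemeister moves\<close>

text \<open>
  A template is a code in which \<open>n\<close> places are marked by holes \<open>Inr 0, \<dots>, Inr (n - 1)\<close>; a local move
  replaces the short arcs sitting in the holes.
\<close>

type_synonym template = "(passage + nat) list list"

definition holes :: "template \<Rightarrow> nat list" where
  "holes T = concat (map (\<lambda>z. case z of Inl x \<Rightarrow> [] | Inr k \<Rightarrow> [k]) (concat T))"

definition has_holes :: "nat \<Rightarrow> template \<Rightarrow> bool" where
  "has_holes n T \<longleftrightarrow> distinct (holes T) \<and> set (holes T) = {..<n}"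

definition fill :: "passage list list \<Rightarrow> template \<Rightarrow> code" where
  "fill ss T = map (\<lambda>w. concat (map (\<lambda>z. case z of Inl x \<Rightarrow> [x] | Inr k \<Rightarrow> ss ! k) w)) T"

definition erase :: "nat set \<Rightarrow> template \<Rightarrow> template" where
  "erase C T = map (filter (\<lambda>z. case z of Inl x \<Rightarrow> crossing x \<notin> C | Inr k \<Rightarrow> True)) T"

definition in_order :: "bool \<Rightarrow> 'a \<Rightarrow> 'a \<Rightarrow> 'a list" where
  "in_order b x y = (if b then [x, y] else [y, x])"

definition rename :: "(nat \<Rightarrow> nat) \<Rightarrow> passage \<Rightarrow> passage" where
  "rename \<pi> x = Passage (\<pi> (crossing x)) (level x) (lead x)"

text \<open>
  Reversing a component toggles the orientation of the basis at exactly those crossings where it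
  meets another component.
\<close>

definition reverse_first :: "code \<Rightarrow> code" where
  "reverse_first D = (case D of [] \<Rightarrow> [] | w # R \<Rightarrow>
     map (map (\<lambda>x. if (x \<in> set w) \<noteq> (mate x \<in> set w)
                   then Passage (crossing x) (level x) (\<not> lead x) else x)) (rev w # R))"

text \<open>
  The rules \<open>components\<close>, \<open>basepoint\<close> and \<open>names\<close> identify codes of the same oriented diagram, and
  \<open>orientation\<close> forgets the orientation.

  \<open>R2\<close>: one arc is pushed over another, which is parallel or antiparallel to it.

  \<open>R3\<close>: the three arcs are pairwise in front of each other (first over second over third) and pass
  the three crossings in an order given by \<open>a\<close>, \<open>b\<close>, \<open>c\<close>.  The condition with \<open>e\<close> says that orders
  and crossing orientations are those of the sides of a triangle in the plane (\<open>e\<close> tells the two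
  mirror images apart), i.e. that the arcs bound a triangular face.

  \<open>detour\<close>: an arc \<open>s\<close> with only virtual crossings is replaced by any other arc \<open>s'\<close> with only virtual
  crossings and the same ends; the rest of the diagram is unchanged.

  Whether a new arc can be drawn in the plane with the stated crossings is not part of these rules:
  it is guaranteed by only relating diagrams, i.e. planar codes (see \<open>diagram_move\<close>).
\<close>

inductive code_move :: "code \<Rightarrow> code \<Rightarrow> bool" where
  components: "mset D = mset D' \<Longrightarrow> code_move D D'"
| basepoint: "code_move ((u @ v) # R) ((v @ u) # R)"
| names: "inj_on \<pi> (crossing ` passages D) \<Longrightarrow> code_move D (map (map (rename \<pi>)) D)"
| orientation: "code_move D (reverse_first D)"
| R1: "has_holes 1 T \<Longrightarrow> level x \<noteq> Virtual \<Longrightarrow> code_move (fill [[]] T) (fill [[x, mate x]] T)"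
| R2: "has_holes 2 T \<Longrightarrow> level x = Over \<Longrightarrow> level y = Over \<Longrightarrow> lead x \<noteq> lead y \<Longrightarrow>
       code_move (fill [[], []] T) (fill [[x, y], in_order b (mate x) (mate y)] T)"
| R3: "has_holes 3 T \<Longrightarrow> level x = Over \<Longrightarrow> level y = Over \<Longrightarrow> level z = Over \<Longrightarrow>
       s = in_order a x y \<Longrightarrow> t = in_order b (mate x) z \<Longrightarrow> u = in_order c (mate y) (mate z) \<Longrightarrow>
       (lead x \<longleftrightarrow> (a = b)) = e \<Longrightarrow> (lead y \<longleftrightarrow> (a = c)) = e \<Longrightarrow> (lead z \<longleftrightarrow> (b = c)) = e \<Longrightarrow>
       code_move (fill [s, t, u] T) (fill [rev s, rev t, rev u] T)"
| detour: "has_holes 1 T \<Longrightarrow> has_holes 1 T' \<Longrightarrow>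
       (\<forall>x\<in>set s. level x = Virtual) \<Longrightarrow> (\<forall>x\<in>set s'. level x = Virtual) \<Longrightarrow>
       erase (crossing ` set s) T = erase (crossing ` set s') T' \<Longrightarrow>
       code_move (fill [s] T) (fill [s'] T')"

definition diagram_move :: "code \<Rightarrow> code \<Rightarrow> bool" where
  "diagram_move D D' \<longleftrightarrow> diagram D \<and> diagram D' \<and> code_move D D'"

text \<open>
  A virtual link is the set of all its diagrams, each with all choices of orientation.
\<close>

definition virtual_link :: "code set \<Rightarrow> bool" where
  "virtual_link K \<longleftrightarrow> K \<in> classes {D. diagram D} diagram_move"


section \<open>Strands and the bridge index\<close>

text \<open>
  Edge \<open>(i, j)\<close> of a code runs along component \<open>i\<close> from passage \<open>j\<close> to the (cyclically) next one.
  A crossing-free circle has the single edge \<open>(i, 0)\<close>.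
\<close>

type_synonym edge = "nat \<times> nat"

definition edges :: "code \<Rightarrow> edge set" where
  "edges D = {(i, j). i < length D \<and> j < max 1 (length (D ! i))}"

definition leaves :: "code \<Rightarrow> passage \<Rightarrow> edge \<Rightarrow> bool" where
  "leaves D x e \<longleftrightarrow> (case e of (i, j) \<Rightarrow>
     i < length D \<and> j < length (D ! i) \<and> D ! i ! j = x)"

definition enters :: "code \<Rightarrow> passage \<Rightarrow> edge \<Rightarrow> bool" where
  "enters D x e \<longleftrightarrow> (case e of (i, j) \<Rightarrow>
     i < length D \<and> j < length (D ! i) \<and> D ! i ! (Suc j mod length (D ! i)) = x)"

text \<open>Strands continue through overcrossings and virtual crossings and break at undercrossings.\<close>

definition strands :: "code \<Rightarrow> edge set set" where
  "strands D = classes (edges D)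
     (\<lambda>e e'. \<exists>x. level x \<noteq> Under \<and> enters D x e \<and> leaves D x e')"

definition over_bridges :: "code \<Rightarrow> edge set set" where
  "over_bridges D = {s \<in> strands D. \<exists>x. \<exists>e\<in>s. level x = Over \<and> leaves D x e}"

text \<open>
  Usual convention for bridge numbers: a component without any overcrossing (such as a crossing-free
  circle) contains no over-bridge and is counted as one bridge.  Otherwise the bridge index of the
  unknot would be 0.
\<close>

definition bridge_number :: "code \<Rightarrow> nat" where
  "bridge_number D =
     card (over_bridges D) + card {i. i < length D \<and> (\<forall>x\<in>set (D ! i). level x \<noteq> Over)}"

lemma bridge_number_eq_card_over_bridges:
  assumes "\<And>w. w \<in> set D \<Longrightarrow> \<exists>x\<in>set w. level x = Over"
  shows "bridge_number D = card (over_bridges D)"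
proof -
  have "{i. i < length D \<and> (\<forall>x\<in>set (D ! i). level x \<noteq> Over)} = {}"
    using assms[OF nth_mem] by blast
  then show ?thesis by (simp only: bridge_number_def card.empty)
qed

definition bridge_index :: "code set \<Rightarrow> nat" where
  "bridge_index K = (INF D\<in>K. bridge_number D)"


section \<open>The Wirtinger index\<close>

definition over_strand :: "code \<Rightarrow> passage \<Rightarrow> edge set \<Rightarrow> bool" where
  "over_strand D x s \<longleftrightarrow> s \<in> strands D \<and> level x = Over \<and> (\<exists>e\<in>s. leaves D x e)"

text \<open>Adjacency at the crossing whose under-passage is \<open>x\<close>.\<close>

definition adjacent :: "code \<Rightarrow> passage \<Rightarrow> edge set \<Rightarrow> edge set \<Rightarrow> bool" where
  "adjacent D x s s' \<longleftrightarrow> s \<in> strands D \<and> s' \<in> strands D \<and> level x = Under \<and>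
     (\<exists>e\<in>s. \<exists>e'\<in>s'. enters D x e \<and> leaves D x e' \<or> leaves D x e \<and> enters D x e')"

text \<open>A partial coloring \<open>(A, f)\<close> is a partial function \<open>f\<close> with domain \<open>A\<close>.\<close>

type_synonym coloring = "edge set \<Rightarrow> nat option"

definition partial_coloring :: "code \<Rightarrow> nat \<Rightarrow> coloring \<Rightarrow> bool" where
  "partial_coloring D k f \<longleftrightarrow> dom f \<subseteq> strands D \<and> ran f \<subseteq> {1..k}"

definition coloring_move :: "code \<Rightarrow> nat \<Rightarrow> coloring \<Rightarrow> coloring \<Rightarrow> bool" where
  "coloring_move D k f\<^sub>1 f\<^sub>2 \<longleftrightarrow> partial_coloring D k f\<^sub>1 \<and> partial_coloring D k f\<^sub>2 \<and>
     (\<exists>s\<^sub>j s\<^sub>i s\<^sub>k x. dom f\<^sub>1 \<subset> dom f\<^sub>2 \<and> dom f\<^sub>2 - dom f\<^sub>1 = {s\<^sub>j} \<and>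
        f\<^sub>2 |` dom f\<^sub>1 = f\<^sub>1 \<and>
        adjacent D x s\<^sub>j s\<^sub>i \<and> s\<^sub>i \<in> dom f\<^sub>1 \<and>
        over_strand D (mate x) s\<^sub>k \<and> s\<^sub>k \<in> dom f\<^sub>1 \<and>
        f\<^sub>1 s\<^sub>i = f\<^sub>2 s\<^sub>j)"

definition seeds :: "code \<Rightarrow> nat \<Rightarrow> coloring \<Rightarrow> bool" where
  "seeds D k f \<longleftrightarrow> partial_coloring D k f \<and> bij_betw f (dom f) (Some ` {1..k})"

definition fully_colorable :: "code \<Rightarrow> nat \<Rightarrow> bool" where
  "fully_colorable D k \<longleftrightarrow>
     (\<exists>f\<^sub>0 f. seeds D k f\<^sub>0 \<and> (coloring_move D k)\<^sup>*\<^sup>* f\<^sub>0 f \<and> dom f = strands D)"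

definition wirtinger_number :: "code \<Rightarrow> nat" where
  "wirtinger_number D = (LEAST k. fully_colorable D k)"

definition wirtinger_index :: "code set \<Rightarrow> nat" where
  "wirtinger_index K = (INF D\<in>K. wirtinger_number D)"


section \<open>Unrestricted danceability\<close>

text \<open>
  Component \<open>i\<close> is parametrized, in its direction, by the circle of length \<open>circumference D i\<close>, with
  the \<open>j\<close>-th passage at coordinate \<open>j\<close>.  A point of the diagram is \<open>(i, x)\<close>, where
  \<open>0 \<le> x < circumference D i\<close>; initial points are not crossings.
\<close>

type_synonym point = "nat \<times> real"

definition circumference :: "code \<Rightarrow> nat \<Rightarrow> real" where
  "circumference D i = max 1 (real (length (D ! i)))"

definition noncrossing_points :: "code \<Rightarrow> point set" where
  "noncrossing_points D = {(i, x). i < length D \<and> 0 \<le> x \<and> x < circumference D i \<and>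
     (\<forall>j<length (D ! i). x \<noteq> real j)}"

text \<open>
  The dancer starting at \<open>(i, x)\<close> moves along the real line covering component \<open>i\<close>, from \<open>x\<close> to the
  first lift greater than \<open>x\<close> of an initial point on this component.
\<close>

definition destination :: "code \<Rightarrow> point set \<Rightarrow> point \<Rightarrow> real" where
  "destination D P a = Min {y. snd a < y \<and>
     (\<exists>x'. (fst a, x') \<in> P \<and> (y = x' \<or> y = x' + circumference D (fst a)))}"

text \<open>The dancer starting at \<open>a\<close> meets the passage \<open>z\<close> at coordinate \<open>p\<close> of the covering line.\<close>

definition meets :: "code \<Rightarrow> point set \<Rightarrow> point \<Rightarrow> passage \<Rightarrow> real \<Rightarrow> bool" where
  "meets D P a z p \<longleftrightarrow> snd a < p \<and> p < destination D P a \<and>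
     (\<exists>j<length (D ! fst a). D ! fst a ! j = z \<and>
        (p = real j \<or> p = real j + circumference D (fst a)))"

text \<open>\<open>\<gamma> a t\<close> is the coordinate at time \<open>t \<in> [0, 1]\<close> of the dancer starting at \<open>a\<close>.\<close>

definition motion :: "code \<Rightarrow> point set \<Rightarrow> (point \<Rightarrow> real \<Rightarrow> real) \<Rightarrow> bool" where
  "motion D P \<gamma> \<longleftrightarrow> (\<forall>a\<in>P. continuous_on {0..1} (\<gamma> a) \<and> mono_on {0..1} (\<gamma> a) \<and>
     \<gamma> a 0 = snd a \<and> \<gamma> a 1 = destination D P a)"

text \<open>
  A dancer who has to wait at an undercrossing waits just before it: whenever the under-strand has
  been danced up to the crossing, the over-strand has already been danced beyond it.  (With
  \<open>q < \<gamma> b t\<close> two dancers could pass simultaneously, contrary to the over-first rule.)  Virtual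
  crossings impose no condition.
\<close>

definition over_first :: "code \<Rightarrow> point set \<Rightarrow> (point \<Rightarrow> real \<Rightarrow> real) \<Rightarrow> bool" where
  "over_first D P \<gamma> \<longleftrightarrow>
     (\<forall>a\<in>P. \<forall>b\<in>P. \<forall>z p q. level z = Over \<and> meets D P a z p \<and> meets D P b (mate z) q \<longrightarrow>
        (\<forall>t\<in>{0..1}. q \<le> \<gamma> b t \<longrightarrow> p < \<gamma> a t))"

text \<open>
  The dancers trace the entire diagram iff there is an initial point on every component; their paths
  then overlap only in initial points.
\<close>

definition dance_configuration :: "code \<Rightarrow> nat \<Rightarrow> point set \<Rightarrow> bool" where
  "dance_configuration D n P \<longleftrightarrow>
     finite P \<and> card P = n \<and> P \<subseteq> noncrossing_points D \<and>
     (\<forall>i<length D. \<exists>x. (i, x) \<in> P) \<and>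
     (\<exists>\<gamma>. motion D P \<gamma> \<and> over_first D P \<gamma>)"

definition dance_number :: "code \<Rightarrow> nat" where
  "dance_number D = (LEAST n. \<exists>P. dance_configuration D n P)"

definition dance_index :: "code set \<Rightarrow> nat" where
  "dance_index K = (INF D\<in>K. dance_number D)"

end

theory Submission
  imports Defs
begin

text \<open>
  Rank each passage by the time at which it is danced: an over-passage precedes its mate, and the
  edges along which the rank does not increase are at most as many as the dancers.  The strands of
  these edges are seeds from which the diagram can be colored in order of rank.

  If moreover, along increasing rank, no passage of another kind directly precedes an over-passage,
  then every over-bridge contains an edge without increase, so there are at most as many bridges as
  dancers.  This situation can be reached: suppose that an arc passes under (or virtually through) a
  second arc at \<open>p\<close> and then directly over a third arc at \<open>q\<close>.  Pull the second and the third arc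
  across each other along the first one, by a second and a third Reidemeister move (or a detour), so
  that \<open>q\<close> comes before \<open>p\<close>.  The new over-passages lie next to the over-passage at \<open>p\<close>, hence before
  \<open>q\<close> in rank, so treating the first such \<open>q\<close> each time terminates.  All this happens in a disc around the
  segment from \<open>p\<close> to \<open>q\<close>, so no rerouting through the rest of the plane is needed.

  Conversely, let one dancer start at every over-bridge and at every component without
  overcrossing, and let all dancers finish their over-passages before any of them passes under.
\<close>

section \<open>Orbits and cyclic words\<close>

text \<open>The two inequalities between danceability and bridge index differ in kind. A set of
  bridges yields a dance on the same diagram, but a dance of \<open>D\<close> does not bound the
  bridges of \<open>D\<close>: one dancer may pass under and then over several times if the timing
  permits, so a single path can carry many bridges. The diagram itself must change, and each change
  has to lead to a diagram again. Planarity is given only as Euler's formula, so an exchange is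
  certified by counting faces and pieces. The part outside the disc is counted once, on a skeleton
  that does not see the crossings inside; the inside is settled by a finite table. Two new crossings
  bring four edges and two faces, and the pieces stay. Ranks are real numbers so that a new passage
  can be ranked as close to an old neighbour as desired, which is why no comparison with a third
  passage is disturbed and no descent is created.\<close>

lemma equivclp_eq_iff: "equivclp r x = equivclp r y \<longleftrightarrow> equivclp r x y"
proof
  assume "equivclp r x = equivclp r y"
  then show "equivclp r x y" by (simp add: fun_eq_iff)
next
  assume "equivclp r x y"
  then show "equivclp r x = equivclp r y"
    by (intro ext) (blast intro: equivclp_trans equivclp_sym)
qed

lemma card_classes_invariant:
  assumes "\<And>x y. x \<in> A \<Longrightarrow> y \<in> A \<Longrightarrow> equivclp r x y \<longleftrightarrow> I x = I y"
  shows "card (classes A r) = card (I ` A)"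
proof -
  have eq: "{(a, b). a \<in> A \<and> b \<in> A \<and> equivclp r a b} `` {x} = {y \<in> A. I y = I x}" if "x \<in> A" for x
    using assms that by auto
  have "classes A r = (\<lambda>v. {y \<in> A. I y = v}) ` I ` A"
    unfolding classes_def quotient_def using eq by auto
  moreover have "inj_on (\<lambda>v. {y \<in> A. I y = v}) (I ` A)"
    by (rule inj_onI) auto
  ultimately show ?thesis
    by (simp add: card_image)
qed

lemma card_classes: "card (classes A r) = card (equivclp r ` A)"
  by (rule card_classes_invariant) (rule equivclp_eq_iff[symmetric])

lemma equivclp_map:
  assumes "\<And>x y. r x y \<Longrightarrow> equivclp r' (f x) (f y)" and "equivclp r x y"
  shows "equivclp r' (f x) (f y)"
  using assms(2)
proof (induction rule: equivclp_induct)
  case base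
  then show ?case by simp
next
  case (step y z)
  then show ?case
    using assms(1) by (meson equivclp_sym equivclp_trans)
qed

text \<open>
  \<open>G\<close> retracts \<open>A'\<close> onto the disjoint union of \<open>A\<close> and \<open>N\<close>, and \<open>E\<close> chooses representatives.
\<close>

lemma card_classes_retract:
  fixes G :: "'a \<Rightarrow> 'b + 'c" and E :: "'b + 'c \<Rightarrow> 'a"
  assumes fin: "finite A" "finite N"
    and G: "\<And>h. h \<in> A' \<Longrightarrow> G h \<in> A <+> N"
    and E: "\<And>v. v \<in> A <+> N \<Longrightarrow> E v \<in> A' \<and> G (E v) = v"
    and r': "\<And>h h'. r' h h' \<Longrightarrow>
      G h = G h' \<or> (\<exists>s s'. G h = Inl s \<and> G h' = Inl s' \<and> r s s')"
    and r: "\<And>s s'. r s s' \<Longrightarrow> equivclp r' (E (Inl s)) (E (Inl s'))"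
    and EG: "\<And>h. h \<in> A' \<Longrightarrow> equivclp r' (E (G h)) h"
  shows "card (classes A' r') = card (classes A r) + card N"
proof -
  \<comment> \<open>A complete invariant of \<open>r'\<close> on \<open>A'\<close>: the
    \<open>r\<close>-orbit of the retract, or the label in \<open>N\<close> itself.\<close>
  define I where "I = map_sum (equivclp r) id \<circ> G"
  have step: "I h = I h'" if "equivclp r' h h'" for h h'
    using that
  proof (induction rule: equivclp_induct)
    case (step y z)
    then have "r' y z \<or> r' z y" by blast
    then have "I y = I z"
      using r' unfolding I_def by (fastforce simp: equivclp_eq_iff dest: equivclp_sym)
    with step show ?case by simp
  qed simp
  have "card (classes A' r') = card (I ` A')"
  proof (rule card_classes_invariant)
    fix h h' assume h: "h \<in> A'" "h' \<in> A'"
    show "equivclp r' h h' \<longleftrightarrow> I h = I h'"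
    proof
      assume eq: "I h = I h'"
      have "equivclp r' (E (G h)) (E (G h'))"
      proof (cases "G h")
        case (Inl s)
        with eq obtain s' where s': "G h' = Inl s'" "equivclp r s s'"
          unfolding I_def by (cases "G h'") (auto simp: equivclp_eq_iff)
        show ?thesis
          using equivclp_map[of r r' "\<lambda>s. E (Inl s)", OF r s'(2)] Inl s'(1) by simp
      next
        case (Inr n)
        with eq have "G h' = G h"
          unfolding I_def by (cases "G h'") auto
        then show ?thesis by simp
      qed
      then show "equivclp r' h h'"
        using EG[OF h(1)] EG[OF h(2)] by (meson equivclp_sym equivclp_trans)
    qed (rule step)
  qed
  also have "I ` A' = (equivclp r ` A) <+> N"
  proof -
    have "G ` A' = A <+> N"
      using G E by (force intro: rev_image_eqI)
    then have "I ` A' = map_sum (equivclp r) id ` (A <+> N)"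
      unfolding I_def by (metis image_comp)
    also have "\<dots> = (equivclp r ` A) <+> N"
      by (auto simp: Plus_def image_Un image_image)
    finally show ?thesis .
  qed
  also have "card \<dots> = card (classes A r) + card N"
    using fin by (simp add: card_Plus card_classes)
  finally show ?thesis .
qed

section \<open>Successors in linear and cyclic words\<close>

definition lin_next :: "'a list \<Rightarrow> 'a \<Rightarrow> 'a \<Rightarrow> bool" where
  "lin_next w x y \<longleftrightarrow> (\<exists>u v. w = u @ x # y # v)"

text \<open>Index-free form of the relation in \<open>follows\<close>. Splitting off the wrap-around
  leaves \<open>lin_next\<close>, which passes through append and concatenation without arithmetic
  modulo the length.\<close>

definition cyc_next :: "'a list \<Rightarrow> 'a \<Rightarrow> 'a \<Rightarrow> bool" where
  "cyc_next w x y \<longleftrightarrow> lin_next w x y \<or> w \<noteq> [] \<and> x = last w \<and> y = hd w"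

definition next_in :: "'a list list \<Rightarrow> 'a \<Rightarrow> 'a \<Rightarrow> bool" where
  "next_in D x y \<longleftrightarrow> (\<exists>w\<in>set D. cyc_next w x y)"

lemma lin_next_nth: "lin_next w x y \<longleftrightarrow> (\<exists>j. Suc j < length w \<and> x = w ! j \<and> y = w ! Suc j)"
proof
  assume "lin_next w x y"
  then obtain u v where "w = u @ x # y # v" unfolding lin_next_def by blast
  then show "\<exists>j. Suc j < length w \<and> x = w ! j \<and> y = w ! Suc j"
    by (intro exI[of _ "length u"]) (simp add: nth_append)
next
  assume "\<exists>j. Suc j < length w \<and> x = w ! j \<and> y = w ! Suc j"
  then obtain j where "Suc j < length w" "x = w ! j" "y = w ! Suc j" by blast
  then have "w = take j w @ x # y # drop (Suc (Suc j)) w"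
    by (simp add: Cons_nth_drop_Suc)
  then show "lin_next w x y" unfolding lin_next_def by blast
qed

lemma cyc_next_nth:
  "cyc_next w x y \<longleftrightarrow> (\<exists>j<length w. x = w ! j \<and> y = w ! (Suc j mod length w))"
proof
  assume "cyc_next w x y"
  then show "\<exists>j<length w. x = w ! j \<and> y = w ! (Suc j mod length w)"
    unfolding cyc_next_def lin_next_nth
  proof (elim disjE exE conjE)
    fix j assume "Suc j < length w" "x = w ! j" "y = w ! Suc j"
    then show ?thesis by (intro exI[of _ j]) simp
  next
    assume "w \<noteq> []" "x = last w" "y = hd w"
    then show ?thesis
      by (intro exI[of _ "length w - 1"]) (simp add: last_conv_nth hd_conv_nth)
  qed
next
  assume "\<exists>j<length w. x = w ! j \<and> y = w ! (Suc j mod length w)"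
  then obtain j where j: "j < length w" "x = w ! j" "y = w ! (Suc j mod length w)" by blast
  show "cyc_next w x y"
  proof (cases "Suc j = length w")
    case True
    with j have "w \<noteq> [] \<and> x = last w \<and> y = hd w"
      by (metis Suc_less_eq diff_Suc_1 hd_conv_nth last_conv_nth length_0_conv less_nat_zero_code mod_self)
    then show ?thesis unfolding cyc_next_def by blast
  next
    case False
    with j have "lin_next w x y" unfolding lin_next_nth by (intro exI[of _ j]) simp
    then show ?thesis unfolding cyc_next_def by blast
  qed
qed

lemma follows_eq: "follows D = next_in D"
  by (intro ext) (auto simp: follows_def next_in_def cyc_next_nth)

lemma lin_next_Nil [simp]: "\<not> lin_next [] x y"
  by (simp add: lin_next_def)

lemma lin_next_Cons [simp]:
  "lin_next (a # w) x y \<longleftrightarrow> w \<noteq> [] \<and> x = a \<and> y = hd w \<or> lin_next w x y"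
  by (cases w) (auto simp: lin_next_def Cons_eq_append_conv)

lemma lin_next_append:
  "lin_next (u @ v) x y \<longleftrightarrow>
     lin_next u x y \<or> lin_next v x y \<or> u \<noteq> [] \<and> v \<noteq> [] \<and> x = last u \<and> y = hd v"
  by (induction u) auto

text \<open>A successor pair lies in one block or straddles the border of two blocks. As no block is
  empty, such blocks come from adjacent letters.\<close>

lemma lin_next_concat_map:
  assumes "\<And>z. z \<in> set w \<Longrightarrow> f z \<noteq> []"
  shows "lin_next (concat (map f w)) x y \<longleftrightarrow>
    (\<exists>z\<in>set w. lin_next (f z) x y) \<or> (\<exists>z z'. lin_next w z z' \<and> x = last (f z) \<and> y = hd (f z'))"
  using assms
proof (induction w)
  case (Cons a w)
  have "w \<noteq> [] \<Longrightarrow> concat (map f w) \<noteq> [] \<and> hd (concat (map f w)) = hd (f (hd w))"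
    using Cons.prems by (cases w) auto
  moreover have "(\<exists>z z'. lin_next (a # w) z z' \<and> x = last (f z) \<and> y = hd (f z')) \<longleftrightarrow>
    w \<noteq> [] \<and> x = last (f a) \<and> y = hd (f (hd w)) \<or>
    (\<exists>z z'. lin_next w z z' \<and> x = last (f z) \<and> y = hd (f z'))"
    by (simp only: lin_next_Cons) blast
  moreover have "lin_next (concat (map f w)) x y \<longleftrightarrow>
    (\<exists>z\<in>set w. lin_next (f z) x y) \<or> (\<exists>z z'. lin_next w z z' \<and> x = last (f z) \<and> y = hd (f z'))"
    using Cons by simp
  ultimately show ?case
    using Cons.prems[of a] by (cases "w = []") (auto simp: lin_next_append)
qed simp

lemma cyc_next_concat_map:
  assumes "\<And>z. z \<in> set w \<Longrightarrow> f z \<noteq> []"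
  shows "cyc_next (concat (map f w)) x y \<longleftrightarrow>
    (\<exists>z\<in>set w. lin_next (f z) x y) \<or> (\<exists>z z'. cyc_next w z z' \<and> x = last (f z) \<and> y = hd (f z'))"
proof (cases "w = []")
  case False
  then have "concat (map f w) \<noteq> [] \<and> hd (concat (map f w)) = hd (f (hd w))"
    using assms by (cases w) auto
  moreover have "last (concat (map f w)) = last (f (last w))"
    using False assms by (cases w rule: rev_cases) auto
  ultimately show ?thesis
    using lin_next_concat_map[of w f x y, OF assms] False unfolding cyc_next_def by auto
qed (simp add: cyc_next_def)

lemma cyc_next_rotate: "cyc_next (u @ v) = cyc_next (v @ u)"
  by (intro ext, cases "u = []"; cases "v = []") (auto simp: cyc_next_def lin_next_append)

lemma cyc_next_in_set: "cyc_next w x y \<Longrightarrow> x \<in> set w \<and> y \<in> set w"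
  unfolding cyc_next_def lin_next_def by auto

lemma opposite_opposite [simp]: "opposite (opposite l) = l"
  by (cases l) auto

lemma opposite_eq_iff [simp]:
  "opposite l = Virtual \<longleftrightarrow> l = Virtual" "opposite l = Over \<longleftrightarrow> l = Under"
  "opposite l = Under \<longleftrightarrow> l = Over"
  by (cases l; simp)+

lemma mate_simps [simp]:
  "mate (mate x) = x" "crossing (mate x) = crossing x" "level (mate x) = opposite (level x)"
  "lead (mate x) \<longleftrightarrow> \<not> lead x"
  by (cases x; simp add: mate_def)+

lemma mate_neq [simp]: "mate x \<noteq> x" "x \<noteq> mate x"
  by (metis mate_simps(4))+

lemma mate_eq_iff: "mate x = y \<longleftrightarrow> x = mate y"
  by auto

lemma rotate_half_Pair [simp]:
  "rotate_half (x, out) = (mate x, if lead x then out else \<not> out)"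
  by (simp add: rotate_half_def)

section \<open>Connectivity of the underlying graph\<close>

definition connects :: "code \<Rightarrow> half_edge \<Rightarrow> half_edge \<Rightarrow> bool" where
  "connects D h h' \<longleftrightarrow> same_edge D h h' \<or> h' = rotate_half h"

lemma num_pieces_connects: "num_pieces D = card (classes (half_edges D) (connects D))"
  by (simp add: num_pieces_def connects_def[abs_def])

lemma connects_rotate: "equivclp (connects D) h = equivclp (connects D) (rotate_half h)"
  unfolding equivclp_eq_iff by (rule r_into_equivclp) (simp add: connects_def)

text \<open>\<open>rotate_half\<close> permutes the four half-edges of a crossing cyclically, so all
  of them lie in one piece, which \<open>(x, True)\<close> may represent.\<close>

lemma connects_passage:
  "equivclp (connects D) (x, out) = equivclp (connects D) (x, True)"
  "equivclp (connects D) (mate x, out) = equivclp (connects D) (x, True)"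
proof -
  let ?c = "equivclp (connects D)"
  have lead: "?c (y, b) = ?c (mate y, b)" if "lead y" for y b
    using that connects_rotate[of D "(y, b)"] by simp
  have not_lead: "?c (y, b) = ?c (mate y, \<not> b)" if "\<not> lead y" for y b
    using that connects_rotate[of D "(y, b)"] by simp
  have "?c (x, True) = ?c (x, False)"
  proof (cases "lead x")
    case True
    have "?c (x, True) = ?c (mate x, True)" by (rule lead[OF True])
    also have "\<dots> = ?c (x, False)" using not_lead[of "mate x" True] True by simp
    finally show ?thesis .
  next
    case False
    have "?c (x, True) = ?c (mate x, False)" using not_lead[OF False, of True] by simp
    also have "\<dots> = ?c (x, False)" using lead[of "mate x" False] False by simp
    finally show ?thesis .
  qed
  then show 1: "?c (x, out) = ?c (x, True)" for out
    by (cases out) simp_all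
  show "?c (mate x, out) = ?c (x, True)"
  proof (cases "lead x")
    case True
    show ?thesis unfolding lead[OF True, of out, symmetric] by (rule 1)
  next
    case False
    have "?c (mate x, out) = ?c (x, \<not> out)" using not_lead[OF False, of "\<not> out"] by simp
    also have "\<dots> = ?c (x, True)" by (rule 1)
    finally show ?thesis .
  qed
qed

lemma connects_follows:
  assumes "follows D x y"
  shows "equivclp (connects D) (x, True) = equivclp (connects D) (y, True)"
proof -
  have "connects D (x, True) (y, False)"
    using assms unfolding connects_def same_edge_def by blast
  then have "equivclp (connects D) (x, True) = equivclp (connects D) (y, False)"
    unfolding equivclp_eq_iff by (rule r_into_equivclp)
  then show ?thesis by (simp only: connects_passage(1)[of D y False])
qed

section \<open>Surgery on planar diagrams\<close>

lemma distinct_concat_map: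
  assumes "distinct w" and "\<And>z. z \<in> set w \<Longrightarrow> distinct (f z)"
    and "\<And>z z' x. z \<in> set w \<Longrightarrow> z' \<in> set w \<Longrightarrow> x \<in> set (f z) \<Longrightarrow> x \<in> set (f z') \<Longrightarrow> z = z'"
  shows "distinct (concat (map f w))"
  using assms
proof (induction w)
  case (Cons z w)
  then have "distinct (concat (map f w))" by simp
  moreover have "set (f z) \<inter> set (f z') = {}" if "z' \<in> set w" for z'
    using Cons.prems(1) Cons.prems(3)[of z z'] that by auto
  ultimately show ?case using Cons.prems(2) by auto
qed simp

definition alphabet :: "'z list list \<Rightarrow> 'z set" where
  "alphabet T = set (concat T)"

text \<open>Generalises \<open>fill\<close> to substitution for every letter. Since substitutions
  compose, one skeleton can be read as a template of several moves, with different holes.\<close>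

definition expand :: "('z \<Rightarrow> 'a list) \<Rightarrow> 'z list list \<Rightarrow> 'a list list" where
  "expand \<phi> T = map (\<lambda>w. concat (map \<phi> w)) T"

definition hole_word :: "passage list list \<Rightarrow> passage + nat \<Rightarrow> passage list" where
  "hole_word ss z = (case z of Inl x \<Rightarrow> [x] | Inr k \<Rightarrow> ss ! k)"

lemma hole_word_simps [simp]: "hole_word ss (Inl x) = [x]" "hole_word ss (Inr k) = ss ! k"
  by (simp_all add: hole_word_def)

lemma fill_eq_expand: "fill ss T = expand (hole_word ss) T"
  by (simp add: fill_def expand_def hole_word_def[abs_def])

lemma next_in_expand:
  assumes "\<And>z. z \<in> alphabet T \<Longrightarrow> \<phi> z \<noteq> []"
  shows "next_in (expand \<phi> T) x y \<longleftrightarrow> (\<exists>z\<in>alphabet T. lin_next (\<phi> z) x y) \<or>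
    (\<exists>z z'. next_in T z z' \<and> x = last (\<phi> z) \<and> y = hd (\<phi> z'))"
proof -
  have "cyc_next (concat (map \<phi> w)) x y \<longleftrightarrow>
    (\<exists>z\<in>set w. lin_next (\<phi> z) x y) \<or> (\<exists>z z'. cyc_next w z z' \<and> x = last (\<phi> z) \<and> y = hd (\<phi> z'))"
    if "w \<in> set T" for w
    using that assms unfolding alphabet_def by (intro cyc_next_concat_map) auto
  then show ?thesis
    unfolding next_in_def expand_def alphabet_def by (auto; blast)
qed

lemma concat_expand: "concat (expand \<phi> T) = concat (map \<phi> (concat T))"
  by (induction T) (auto simp: expand_def)

lemma passages_expand: "passages (expand \<phi> T) = (\<Union>z\<in>alphabet T. set (\<phi> z))"
  unfolding passages_def concat_expand alphabet_def by simp

lemma less_3_iff: "(k :: nat) < 3 \<longleftrightarrow> k = 0 \<or> k = 1 \<or> k = 2"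
  by auto

lemma next_in_in_set: "next_in T z z' \<Longrightarrow> z \<in> alphabet T \<and> z' \<in> alphabet T"
  unfolding next_in_def alphabet_def by (auto dest: cyc_next_in_set)

type_synonym letter = "passage + nat"

locale surgery =
  fixes T :: "letter list list" and X :: "passage set" and p q :: passage
  assumes letters: "alphabet T = Inl ` X \<union> {Inr 0, Inr 1, Inr 2}"
    and mate_X: "x \<in> X \<Longrightarrow> mate x \<in> X"
begin

text \<open>
  The skeleton of a code \<open>expand \<phi> T\<close> has the half-edges \<open>(z, out)\<close> for the letters \<open>z\<close> of \<open>T\<close>, where
  the half-edges of a hole are the ends of its arc.  \<open>turn\<close> gives the end following counterclockwise
  on the boundary of the disc containing the three holes; \<open>p\<close> and \<open>q\<close> are the passages of hole 0, in
  this order, through its crossings with the arcs 1 and 2.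
\<close>

fun turn :: "letter \<times> bool \<Rightarrow> letter \<times> bool" where
  "turn (Inl x, out) = (Inl (mate x), if lead x then out else \<not> out)"
| "turn (Inr k, out) =
     (if k = 0 then if out then (Inr 2, lead q) else (Inr 1, \<not> lead p)
      else if k = 1 then if out = lead p then (Inr 0, False) else (Inr 2, \<not> lead q)
      else if out = lead q then (Inr 1, lead p) else (Inr 0, True))"

definition sk_edge :: "letter \<times> bool \<Rightarrow> letter \<times> bool \<Rightarrow> bool" where
  "sk_edge s t \<longleftrightarrow> (\<exists>z z'. next_in T z z' \<and>
     (s = (z, True) \<and> t = (z', False) \<or> s = (z', False) \<and> t = (z, True)))"

definition sk_face :: "letter \<times> bool \<Rightarrow> letter \<times> bool \<Rightarrow> bool" where
  "sk_face s s' \<longleftrightarrow> (\<exists>t. sk_edge s t \<and> s' = turn t)"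

text \<open>All ends of the three holes are related to each other because the crossings inside the
  disc connect the three arcs.\<close>

definition sk_conn :: "letter \<times> bool \<Rightarrow> letter \<times> bool \<Rightarrow> bool" where
  "sk_conn s s' \<longleftrightarrow> sk_edge s s' \<or> (\<exists>x out. s = (Inl x, out) \<and> s' = turn s) \<or>
     (\<exists>k<3. \<exists>l<3. \<exists>out out'. s = (Inr k, out) \<and> s' = (Inr l, out'))"

abbreviation sk_half_edges :: "(letter \<times> bool) set" where
  "sk_half_edges \<equiv> alphabet T \<times> UNIV"

end

text \<open>Separates what varies inside the disc from the fixed outside: only the words of the
  holes change, and since \<open>L\<close> is closed under \<open>mate\<close> and disjoint from
  \<open>X\<close>, no outside passage has its mate inside.\<close>

locale filling = surgery +
  fixes \<phi> :: "letter \<Rightarrow> passage list" and L :: "passage set"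
  assumes \<phi>_Inl: "\<phi> (Inl x) = [x]"
    and \<phi>_Inr: "k < 3 \<Longrightarrow> \<phi> (Inr k) \<noteq> []"
    and local: "L = set (\<phi> (Inr 0)) \<union> set (\<phi> (Inr 1)) \<union> set (\<phi> (Inr 2))"
    and mate_L: "x \<in> L \<Longrightarrow> mate x \<in> L"
    and disjnt: "X \<inter> L = {}"
begin

abbreviation "D \<equiv> expand \<phi> T"

fun outer :: "letter \<times> bool \<Rightarrow> half_edge" where
  "outer (z, out) = (if out then last (\<phi> z) else hd (\<phi> z), out)"

lemma nonempty: "z \<in> alphabet T \<Longrightarrow> \<phi> z \<noteq> []"
  using \<phi>_Inr[of 0] \<phi>_Inr[of 1] \<phi>_Inr[of 2] by (auto simp: letters \<phi>_Inl)

lemma passages_D: "passages D = X \<union> L"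
  unfolding passages_expand letters by (auto simp: \<phi>_Inl local)

lemma follows_D: "follows D x y \<longleftrightarrow>
    (\<exists>k<3. lin_next (\<phi> (Inr k)) x y) \<or> (\<exists>z z'. next_in T z z' \<and> x = last (\<phi> z) \<and> y = hd (\<phi> z'))"
proof -
  have "(\<exists>z\<in>alphabet T. lin_next (\<phi> z) x y) \<longleftrightarrow> (\<exists>k<3. lin_next (\<phi> (Inr k)) x y)"
    unfolding letters by (auto simp: \<phi>_Inl less_3_iff)
  moreover have "next_in D x y \<longleftrightarrow> (\<exists>z\<in>alphabet T. lin_next (\<phi> z) x y) \<or>
    (\<exists>z z'. next_in T z z' \<and> x = last (\<phi> z) \<and> y = hd (\<phi> z'))"
    by (rule next_in_expand) (rule nonempty)
  ultimately show ?thesis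
    unfolding follows_eq by simp
qed

lemma same_edge_D: "same_edge D h h' \<longleftrightarrow>
    (\<exists>k<3. \<exists>x y. lin_next (\<phi> (Inr k)) x y \<and>
      (h = (x, True) \<and> h' = (y, False) \<or> h = (y, False) \<and> h' = (x, True))) \<or>
    (\<exists>s t. sk_edge s t \<and> h = outer s \<and> h' = outer t)"
  (is "_ \<longleftrightarrow> ?inner \<or> ?outer")
proof
  assume "same_edge D h h'"
  then show "?inner \<or> ?outer"
    unfolding same_edge_def follows_D sk_edge_def by (auto; fastforce)
next
  assume "?inner \<or> ?outer"
  then show "same_edge D h h'"
  proof
    assume ?inner
    then show ?thesis unfolding same_edge_def follows_D by blast
  next
    assume ?outer
    then show ?thesis unfolding same_edge_def follows_D sk_edge_def by fastforce
  qed
qed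

lemma outer_in: "s \<in> sk_half_edges \<Longrightarrow> outer s \<in> half_edges D"
  unfolding half_edges_def passages_expand
  using nonempty[of "fst s"] by (cases s) (auto intro!: bexI[of _ "fst s"])

lemma outer_local: "k < 3 \<Longrightarrow> outer (Inr k, out) \<in> L \<times> UNIV"
  using \<phi>_Inr[of k] unfolding less_3_iff by (auto simp: local)

lemma sk_edge_in: "sk_edge s t \<Longrightarrow> s \<in> sk_half_edges \<and> t \<in> sk_half_edges"
  unfolding sk_edge_def using next_in_in_set by fastforce

lemma sk_half_edges_cases:
  assumes "s \<in> sk_half_edges"
  obtains x out where "x \<in> X" "s = (Inl x, out)" | k out where "k < 3" "s = (Inr k, out)"
  using assms unfolding letters by (cases s) auto

lemma finite_sk: "finite sk_half_edges"
  by (simp add: alphabet_def)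

text \<open>Reduces the count of faces to a local table \<open>G\<close>, which sends a half-edge in
  the disc to an end of an arc on the same face or to the label of an inner face. A face step along
  an inner edge must not change \<open>G\<close> (\<open>G_inner\<close>); a step along an outer
  edge becomes a step of the skeleton (\<open>G_outer\<close>, \<open>G_turn\<close>).\<close>

lemma num_faces_expand:
  fixes G :: "half_edge \<Rightarrow> letter \<times> bool + nat" and rep :: "nat \<Rightarrow> half_edge"
  defines "E \<equiv> case_sum outer rep"
  assumes G_X: "\<And>x out. x \<in> X \<Longrightarrow> G (x, out) = Inl (Inl x, out)"
    and G_outer: "\<And>k out. k < 3 \<Longrightarrow> G (outer (Inr k, out)) = Inl (Inr k, out)"
    and G_turn: "\<And>k out. k < 3 \<Longrightarrow> G (rotate_half (outer (Inr k, out))) = Inl (turn (Inr k, out))"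
    and G_inner: "\<And>k x y. k < 3 \<Longrightarrow> lin_next (\<phi> (Inr k)) x y \<Longrightarrow>
      G (x, True) = G (rotate_half (y, False)) \<and> G (y, False) = G (rotate_half (x, True))"
    and G_range: "\<And>h. h \<in> L \<times> UNIV \<Longrightarrow> case G h of Inl s \<Rightarrow> fst s \<in> {Inr 0, Inr 1, Inr 2} | Inr n \<Rightarrow> n \<in> N"
    and rep: "\<And>n. n \<in> N \<Longrightarrow> rep n \<in> L \<times> UNIV \<and> G (rep n) = Inr n"
    and EG: "\<And>h. h \<in> L \<times> UNIV \<Longrightarrow> equivclp (face_step D) (E (G h)) h"
    and N: "finite N"
  shows "num_faces D = card (classes sk_half_edges sk_face) + card N"
  unfolding num_faces_def
proof (rule card_classes_retract[where G = G and E = E, OF finite_sk N])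
  fix h assume h: "h \<in> half_edges D"
  obtain x out where x: "h = (x, out)" "x \<in> X \<or> x \<in> L"
    using h unfolding half_edges_def passages_D by blast
  show "G h \<in> sk_half_edges <+> N"
    using x G_X[of x out] G_range[of h] by (auto simp: letters split: sum.splits)
  show "equivclp (face_step D) (E (G h)) h"
    using x G_X[of x out] EG[of h] by (auto simp: E_def \<phi>_Inl)
next
  fix v assume v: "v \<in> sk_half_edges <+> N"
  then show "E v \<in> half_edges D \<and> G (E v) = v"
  proof (elim PlusE)
    fix s assume s: "s \<in> sk_half_edges" "v = Inl s"
    then have "G (outer s) = Inl s"
      using G_outer by (elim sk_half_edges_cases) (auto simp: \<phi>_Inl G_X)
    then show ?thesis using s outer_in by (simp add: E_def)
  next
    fix n assume "n \<in> N" "v = Inr n"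
    then show ?thesis using rep[of n] by (auto simp: E_def half_edges_def passages_D)
  qed
next
  \<comment> \<open>A walk along a face that arrives at the end \<open>t\<close> continues, possibly
    after some edges inside the disc, from the end \<open>turn t\<close>.\<close>
  have turn: "G (rotate_half (outer t)) = Inl (turn t)"
      "equivclp (face_step D) (rotate_half (outer t)) (outer (turn t))"
    if "t \<in> sk_half_edges" for t
  proof -
    show *: "G (rotate_half (outer t)) = Inl (turn t)"
      using that
    proof (cases rule: sk_half_edges_cases)
      case (1 x out)
      then show ?thesis using mate_X G_X by (auto simp: \<phi>_Inl)
    qed (simp add: G_turn del: outer.simps rotate_half_Pair turn.simps)
    show "equivclp (face_step D) (rotate_half (outer t)) (outer (turn t))"
      using that
    proof (cases rule: sk_half_edges_cases)
      case (1 x out)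
      then show ?thesis by (simp add: \<phi>_Inl)
    next
      case (2 k out)
      have "rotate_half (outer t) \<in> L \<times> UNIV"
        using outer_local[of k out] 2 mate_L by auto
      from EG[OF this] show ?thesis
        unfolding * E_def by (simp add: equivclp_sym)
    qed
  qed
  show "G h = G h' \<or> (\<exists>s s'. G h = Inl s \<and> G h' = Inl s' \<and> sk_face s s')"
    if step: "face_step D h h'" for h h'
  proof -
    obtain g where g: "same_edge D h g" "h' = rotate_half g"
      using step unfolding face_step_def by blast
    from g(1) show ?thesis
      unfolding same_edge_D
    proof (elim disjE exE conjE)
      fix s t assume st: "sk_edge s t" "h = outer s" "g = outer t"
      then have "s \<in> sk_half_edges" "t \<in> sk_half_edges" using sk_edge_in by auto
      moreover from this have "G (outer s) = Inl s"
        using G_outer by (elim sk_half_edges_cases) (auto simp: \<phi>_Inl G_X)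
      ultimately show ?thesis
        using st g(2) turn(1) unfolding sk_face_def by auto
    qed (use g(2) G_inner in auto)
  qed
  show "equivclp (face_step D) (E (Inl s)) (E (Inl s'))" if step: "sk_face s s'" for s s'
  proof -
    obtain t where t: "sk_edge s t" "s' = turn t"
      using step unfolding sk_face_def by blast
    then have "face_step D (outer s) (rotate_half (outer t))"
      unfolding face_step_def same_edge_D by blast
    then show ?thesis
      using turn(2)[of t] sk_edge_in[OF t(1)] t(2) unfolding E_def
      by (auto intro: equivclp_trans r_into_equivclp)
  qed
qed

lemma face_step_inner:
  assumes "k < 3" "lin_next (\<phi> (Inr k)) x y"
  shows "equivclp (face_step D) (x, True) = equivclp (face_step D) (rotate_half (y, False))"
    "equivclp (face_step D) (y, False) = equivclp (face_step D) (rotate_half (x, True))"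
proof -
  have "same_edge D (x, True) (y, False)" "same_edge D (y, False) (x, True)"
    using assms unfolding same_edge_D by blast+
  then have "face_step D (x, True) (rotate_half (y, False))"
    "face_step D (y, False) (rotate_half (x, True))"
    unfolding face_step_def by blast+
  then show "equivclp (face_step D) (x, True) = equivclp (face_step D) (rotate_half (y, False))"
    "equivclp (face_step D) (y, False) = equivclp (face_step D) (rotate_half (x, True))"
    unfolding equivclp_eq_iff by (simp_all only: r_into_equivclp)
qed

abbreviation "conn \<equiv> connects D"

text \<open>Here the retraction collapses each arc to its hole. The disc adds no piece of its own,
  since its crossings are connected with each other and with the ends of the arcs; hence the empty
  set of extra classes below.\<close>

lemma num_pieces_expand:
  assumes dist: "distinct (\<phi> (Inr 0) @ \<phi> (Inr 1) @ \<phi> (Inr 2))"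
    and connected: "\<And>x y. x \<in> L \<Longrightarrow> y \<in> L \<Longrightarrow> equivclp conn (x, True) (y, True)"
  shows "num_pieces D = card (classes sk_half_edges sk_conn)"
proof -
  define hole :: "passage \<Rightarrow> nat" where
    "hole x = (if x \<in> set (\<phi> (Inr 0)) then 0 else if x \<in> set (\<phi> (Inr 1)) then 1 else 2)" for x
  have hole: "hole x = k" if "k < 3" "x \<in> set (\<phi> (Inr k))" for x k
    using that dist unfolding hole_def by (auto simp: less_3_iff)
  define G :: "half_edge \<Rightarrow> letter \<times> bool + unit" where
    "G h = (case h of (x, out) \<Rightarrow> Inl (if x \<in> L then Inr (hole x) else Inl x, out))" for h
  define E where "E = case_sum outer (undefined :: unit \<Rightarrow> half_edge)"
  have G_L: "G (x, out) = Inl (Inr (hole x), out)" if "x \<in> L" for x out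
    using that by (simp add: G_def)
  have G_X: "G (x, out) = Inl (Inl x, out)" if "x \<in> X" for x out
    using that disjnt by (auto simp: G_def)
  have hole_less: "hole x < 3" for x by (simp add: hole_def)
  have local_conn: "equivclp conn h h'" if hh: "h \<in> L \<times> UNIV" "h' \<in> L \<times> UNIV" for h h'
  proof -
    obtain x out y out' where *: "h = (x, out)" "h' = (y, out')" "x \<in> L" "y \<in> L"
      using hh by blast
    show ?thesis
      unfolding * using connected[OF *(3,4)]
      by (metis connects_passage(1) equivclp_eq_iff)
  qed
  have G_outer: "G (outer s) = Inl s" if "s \<in> sk_half_edges" for s
    using that
  proof (cases rule: sk_half_edges_cases)
    case (1 x out)
    then show ?thesis by (simp add: \<phi>_Inl G_X)
  next
    case (2 k out)
    then have "outer s \<in> L \<times> UNIV" "fst (outer s) \<in> set (\<phi> (Inr k))" "snd (outer s) = out"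
      using outer_local[of k out] \<phi>_Inr[of k] by auto
    then show ?thesis
      using G_L hole[of k "fst (outer s)"] 2 by (cases "outer s") auto
  qed
  have "num_pieces D = card (classes sk_half_edges sk_conn) + card ({} :: unit set)"
    unfolding num_pieces_connects
  proof (rule card_classes_retract[where G = G and E = E, OF finite_sk finite.emptyI])
    fix h assume "h \<in> half_edges D"
    then consider x out where "h = (x, out)" "x \<in> X" | x out where "h = (x, out)" "x \<in> L"
      unfolding half_edges_def passages_D by blast
    then have "G h \<in> sk_half_edges <+> {} \<and> equivclp conn (E (G h)) h"
    proof cases
      case 1
      then show ?thesis by (auto simp: G_X letters E_def \<phi>_Inl)
    next
      case 2
      have "Inr (hole x) \<in> alphabet T"
        using hole_less[of x] unfolding letters by auto
      then show ?thesis
        using 2 local_conn[OF outer_local[OF hole_less]] by (auto simp: G_L E_def simp del: outer.simps)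
    qed
    then show "G h \<in> sk_half_edges <+> {}" "equivclp conn (E (G h)) h" by blast+
  next
    fix v assume "v \<in> sk_half_edges <+> ({} :: unit set)"
    then obtain s where "v = Inl s" "s \<in> sk_half_edges" by blast
    then show "E v \<in> half_edges D \<and> G (E v) = v"
      using outer_in G_outer by (simp add: E_def del: outer.simps)
  next
    fix h h' assume "conn h h'"
    then show "G h = G h' \<or> (\<exists>s s'. G h = Inl s \<and> G h' = Inl s' \<and> sk_conn s s')"
      unfolding connects_def
    proof
      assume "same_edge D h h'"
      then show ?thesis
        unfolding same_edge_D
      proof (elim disjE exE conjE)
        fix s t assume "sk_edge s t" "h = outer s" "h' = outer t"
        then show ?thesis
          using G_outer sk_edge_in unfolding sk_conn_def by metis
      next
        fix k x y assume k: "k < 3" "lin_next (\<phi> (Inr k)) x y" and h: "h = (x, True)" "h' = (y, False)"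
        then have "x \<in> L" "y \<in> L"
          using local unfolding lin_next_def by (auto simp: less_3_iff)
        then show ?thesis using hole_less unfolding h by (auto simp: G_L sk_conn_def)
      next
        fix k x y assume k: "k < 3" "lin_next (\<phi> (Inr k)) x y" and h: "h = (y, False)" "h' = (x, True)"
        then have "x \<in> L" "y \<in> L"
          using local unfolding lin_next_def by (auto simp: less_3_iff)
        then show ?thesis using hole_less unfolding h by (auto simp: G_L sk_conn_def)
      qed
    next
      assume rot: "h' = rotate_half h"
      obtain x out where h: "h = (x, out)" by (cases h)
      show ?thesis
      proof (cases "x \<in> L")
        case True
        then show ?thesis
          using mate_L hole_less unfolding rot h by (auto simp: G_L sk_conn_def)
      next
        case False
        then have "mate x \<notin> L" using mate_L[of "mate x"] by auto
        with False show ?thesis unfolding rot h by (auto simp: G_def sk_conn_def)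
      qed
    qed
  next
    fix s s' assume "sk_conn s s'"
    then show "equivclp conn (E (Inl s)) (E (Inl s'))"
      unfolding sk_conn_def
    proof (elim disjE exE conjE)
      assume "sk_edge s s'"
      then have "conn (outer s) (outer s')" unfolding connects_def same_edge_D by blast
      then show ?thesis unfolding E_def by (auto intro: r_into_equivclp)
    next
      fix x out assume "s = (Inl x, out)" "s' = turn s"
      then have "conn (outer s) (outer s')" by (simp add: connects_def \<phi>_Inl)
      then show ?thesis unfolding E_def by (auto intro: r_into_equivclp)
    next
      fix k l out out' assume *: "k < 3" "l < 3" "s = (Inr k, out)" "s' = (Inr l, out')"
      then show ?thesis
        using local_conn[OF outer_local outer_local] by (simp add: E_def del: outer.simps)
    qed
  qed
  then show ?thesis by simp
qed

end

section \<open>The exchange of two crossings inside a disc\<close>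

text \<open>An arc transverse to arc 0 meets its crossings from below to above or in the opposite
  order. It runs upwards iff the passage of arc 0 through it leads, so \<open>b\<close> will be
  \<open>lead p\<close> or \<open>lead q\<close>.\<close>

definition ord3 :: "bool \<Rightarrow> 'a \<Rightarrow> 'a \<Rightarrow> 'a \<Rightarrow> 'a list" where
  "ord3 b x y z = (if b then [x, y, z] else [z, y, x])"

lemma ord3_simps [simp]:
  "ord3 b x y z \<noteq> []" "set (ord3 b x y z) = {x, y, z}"
  "ord3 True x y z = [x, y, z]" "ord3 False x y z = [z, y, x]"
  "length (ord3 b x y z) = 3"
  by (auto simp: ord3_def)

lemma less_3E:
  assumes "(k :: nat) < 3"
  obtains "k = 0" | "k = 1" | "k = 2"
  using assms by linarith

text \<open>The flags of \<open>B\<close> and \<open>C\<close> are forced by the plane: if arcs 1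
  and 2 both run upwards, arc 1 crosses arc 2 from left to right at \<open>B\<close> below arc 0 and
  comes back at \<open>C\<close> above it. Reversing one of the two arcs toggles both flags.\<close>

locale exchange = surgery +
  fixes B C :: passage
  assumes distinct_T: "distinct (concat T)"
    and crossings: "distinct [crossing p, crossing q, crossing B, crossing C]"
    and X_crossing: "x \<in> X \<Longrightarrow> crossing x \<notin> {crossing p, crossing q, crossing B, crossing C}"
    and X_valid: "x \<in> X \<Longrightarrow> y \<in> X \<Longrightarrow> crossing y = crossing x \<Longrightarrow> y = x \<or> y = mate x"
    and lead_B: "lead B \<longleftrightarrow> lead p = lead q"
    and lead_C: "lead C \<longleftrightarrow> lead p \<noteq> lead q"
begin

text \<open>
  Arc 0 is drawn from left to right.  Before the exchange it crosses arc 1 at \<open>p\<close> and then arc 2 at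
  \<open>q\<close>; afterwards in the opposite order, arcs 1 and 2 meeting at \<open>B\<close> below and at \<open>C\<close> above arc 0.
  In the intermediate code, \<open>B\<close> and \<open>C\<close> both lie above arc 0.
\<close>

definition "before = [[p, q], [mate p], [mate q]]"
definition "midway =
  [[p, q], ord3 (lead p) (mate p) B C, ord3 (lead q) (mate q) (mate B) (mate C)]"
definition "after =
  [[q, p], ord3 (lead p) B (mate p) C, ord3 (lead q) (mate B) (mate q) (mate C)]"

lemma arcs:
  "before ! 0 = [p, q]" "before ! 1 = [mate p]" "before ! 2 = [mate q]"
  "midway ! 0 = [p, q]" "midway ! 1 = ord3 (lead p) (mate p) B C"
  "midway ! 2 = ord3 (lead q) (mate q) (mate B) (mate C)"
  "after ! 0 = [q, p]" "after ! 1 = ord3 (lead p) B (mate p) C"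
  "after ! 2 = ord3 (lead q) (mate B) (mate q) (mate C)"
  by (simp_all add: before_def midway_def after_def)

text \<open>The simplifier turns the index \<open>1\<close> into \<open>Suc 0\<close>, so both forms
  are kept for rewriting.\<close>

lemmas arcs' = arcs arcs[unfolded One_nat_def]

definition "old = {p, q, mate p, mate q}"
definition "new = {B, C, mate B, mate C}"

lemma neqs: "p \<noteq> q" "p \<noteq> B" "p \<noteq> C" "q \<noteq> B" "q \<noteq> C" "B \<noteq> C"
  "p \<noteq> mate q" "p \<noteq> mate B" "p \<noteq> mate C" "q \<noteq> mate B" "q \<noteq> mate C" "B \<noteq> mate C"
  "mate p \<noteq> q" "mate p \<noteq> B" "mate p \<noteq> C" "mate q \<noteq> B" "mate q \<noteq> C" "mate B \<noteq> C"
  "mate p \<noteq> mate q" "mate p \<noteq> mate B" "mate p \<noteq> mate C" "mate q \<noteq> mate B" "mate q \<noteq> mate C"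
  "mate B \<noteq> mate C"
proof -
  have neq: "x \<noteq> y" if "crossing x \<noteq> crossing y" for x y using that by blast
  show "p \<noteq> q" "p \<noteq> B" "p \<noteq> C" "q \<noteq> B" "q \<noteq> C" "B \<noteq> C"
    "p \<noteq> mate q" "p \<noteq> mate B" "p \<noteq> mate C" "q \<noteq> mate B" "q \<noteq> mate C" "B \<noteq> mate C"
    "mate p \<noteq> q" "mate p \<noteq> B" "mate p \<noteq> C" "mate q \<noteq> B" "mate q \<noteq> C" "mate B \<noteq> C"
    "mate p \<noteq> mate q" "mate p \<noteq> mate B" "mate p \<noteq> mate C" "mate q \<noteq> mate B" "mate q \<noteq> mate C"
    "mate B \<noteq> mate C"
    using crossings by (intro neq; simp)+
qed

lemmas all_neqs = neqs neqs[symmetric] mate_neq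

lemma X_local: "X \<inter> (old \<union> new) = {}"
  using X_crossing unfolding old_def new_def by force

lemma filling_before: "filling T X (hole_word before) old"
  using surgery_axioms X_local
  by (auto simp: filling_def filling_axioms_def before_def old_def less_3_iff)

lemma filling_midway: "filling T X (hole_word midway) (old \<union> new)"
  using surgery_axioms X_local
  by (auto simp: filling_def filling_axioms_def midway_def old_def new_def less_3_iff)

lemma filling_after: "filling T X (hole_word after) (old \<union> new)"
  using surgery_axioms X_local
  by (auto simp: filling_def filling_axioms_def after_def old_def new_def less_3_iff)

lemma local_cases:
  assumes "x \<in> old \<union> new"
  obtains "x = p" | "x = q" | "x = mate p" | "x = mate q" | "x = B" | "x = C" | "x = mate B" | "x = mate C"
  using assms unfolding old_def new_def by blast

text \<open>
  Planarity is invariant because the faces outside the disc depend on the skeleton only.  The tables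
  below send a half-edge at a local crossing to an end of an arc on the boundary of the same face, or
  to the number of the triangle or bigon inside the disc to which it belongs.
\<close>

definition retract :: "(passage \<times> (bool \<Rightarrow> (letter \<times> bool) + nat)) list \<Rightarrow>
    half_edge \<Rightarrow> (letter \<times> bool) + nat" where
  "retract t h = (case map_of t (fst h) of Some f \<Rightarrow> f (snd h) | None \<Rightarrow> Inl (Inl (fst h), snd h))"

lemma retract_X:
  assumes "fst ` set t \<subseteq> old \<union> new" "x \<in> X"
  shows "retract t (x, out) = Inl (Inl x, out)"
proof -
  have "map_of t x = None"
    using assms X_local by (force simp: map_of_eq_None_iff)
  then show ?thesis by (simp add: retract_def)
qed

section \<open>Faces before, during and after the exchange\<close>

text \<open>The segment from \<open>p\<close> to \<open>q\<close> is the only edge inside the disc,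
  and the faces on both its sides reach the boundary. Hence every local half-edge retracts to an
  end.\<close>

lemma num_faces_before:
  "num_faces (expand (hole_word before) T) = card (classes sk_half_edges sk_face)"
proof -
  interpret filling T X p q "hole_word before" "old" by (rule filling_before)
  define t :: "(passage \<times> (bool \<Rightarrow> (letter \<times> bool) + nat)) list" where "t = [(p, \<lambda>out. if out then Inl (Inr 2, \<not> lead q) else Inl (Inr 0, False)),
    (q, \<lambda>out. if out then Inl (Inr 0, True) else Inl (Inr 1, lead p)),
    (mate p, \<lambda>out. if out = lead p then Inl (Inr 1, lead p) else Inl (Inr 1, \<not> lead p)),
    (mate q, \<lambda>out. if out = lead q then Inl (Inr 2, lead q) else Inl (Inr 2, \<not> lead q))]"
  define rep :: "nat \<Rightarrow> half_edge" where "rep n = undefined" for n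
  have t: "retract t (p, out) = (if out then Inl (Inr 2, \<not> lead q) else Inl (Inr 0, False))"
    "retract t (q, out) = (if out then Inl (Inr 0, True) else Inl (Inr 1, lead p))"
    "retract t (mate p, out) = (if out = lead p then Inl (Inr 1, lead p) else Inl (Inr 1, \<not> lead p))"
    "retract t (mate q, out) = (if out = lead q then Inl (Inr 2, lead q) else Inl (Inr 2, \<not> lead q))"
    for out by (simp_all add: t_def retract_def all_neqs)
  have e0: "lin_next (hole_word before (Inr 0)) p q" by (simp add: arcs)
  have eqs: "equivclp (face_step D) (p, True) = equivclp (face_step D) (mate q, \<not> lead q)"
    "equivclp (face_step D) (q, False) = equivclp (face_step D) (mate p, lead p)"
    using face_step_inner[OF _ e0] lead_B lead_C
    by (cases "lead p"; cases "lead q"; simp)+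
  have "num_faces D = card (classes sk_half_edges sk_face) + card ({} :: nat set)"
  proof (rule num_faces_expand[where G = "retract t" and rep = rep])
    show "retract t (x, out) = Inl (Inl x, out)" if "x \<in> X" for x out
      using that by (intro retract_X) (auto simp: t_def old_def)
  next
    fix k :: nat and out assume "k < 3"
    then show "retract t (outer (Inr k, out)) = Inl (Inr k, out)"
      "retract t (rotate_half (outer (Inr k, out))) = Inl (turn (Inr k, out))"
      by (cases out; cases "lead p"; cases "lead q"; elim less_3E; simp add: t arcs' lead_B lead_C)+
  next
    fix k :: nat and x y assume "k < 3" "lin_next (hole_word before (Inr k)) x y"
    then show "retract t (x, True) = retract t (rotate_half (y, False)) \<and>
      retract t (y, False) = retract t (rotate_half (x, True))"
      by (cases "lead p"; cases "lead q"; elim less_3E; simp add: arcs'; elim disjE conjE; simp add: t lead_B lead_C)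
  next
    fix h :: half_edge assume h: "h \<in> old \<times> UNIV"
    obtain x out where x: "h = (x, out)" "x \<in> old" using h by blast
    show "case retract t h of Inl s \<Rightarrow> fst s \<in> {Inr 0, Inr 1, Inr 2} | Inr n \<Rightarrow> n \<in> {}"
      using x(2) unfolding x(1) old_def by (elim UnE insertE emptyE; cases out; simp add: t)
    have "equivclp (face_step D) (case_sum outer rep (retract t h)) = equivclp (face_step D) h"
      using x(2) eqs unfolding x(1) old_def
      by (elim UnE insertE emptyE; cases out; cases "lead p"; cases "lead q"; simp add: t rep_def arcs')
    then show "equivclp (face_step D) (case_sum outer rep (retract t h)) h"
      by (rule iffD1[OF equivclp_eq_iff])
  next
    fix n :: nat assume "n \<in> {}"
    then show "rep n \<in> old \<times> UNIV \<and> retract t (rep n) = Inr n"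
      unfolding old_def by (auto simp: t rep_def)
  qed auto
  then show ?thesis by simp
qed

text \<open>Inner face 0 is the triangle of the three arcs with corners at the crossings of
  \<open>p\<close>, \<open>q\<close> and \<open>B\<close>; inner face 1 is the bigon of arcs 1 and 2
  between \<open>B\<close> and \<open>C\<close>.\<close>

lemma num_faces_midway:
  "num_faces (expand (hole_word midway) T) = card (classes sk_half_edges sk_face) + 2"
proof -
  interpret filling T X p q "hole_word midway" "old \<union> new" by (rule filling_midway)
  define t :: "(passage \<times> (bool \<Rightarrow> (letter \<times> bool) + nat)) list" where "t = [(p, \<lambda>out. if out then Inl (Inr 2, \<not> lead q) else Inl (Inr 0, False)),
    (q, \<lambda>out. if out then Inl (Inr 0, True) else Inr 0),
    (mate p, \<lambda>out. if out = lead p then Inr 0 else Inl (Inr 1, \<not> lead p)),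
    (mate q, \<lambda>out. if out = lead q then Inl (Inr 2, lead q) else Inl (Inr 2, \<not> lead q)),
    (B, \<lambda>out. if out = lead p then Inl (Inr 2, lead q) else Inl (Inr 0, False)),
    (C, \<lambda>out. if out = lead p then Inl (Inr 1, lead p) else Inr 1),
    (mate B, \<lambda>out. if out = lead q then Inr 1 else Inr 0),
    (mate C, \<lambda>out. if out = lead q then Inl (Inr 2, lead q) else Inl (Inr 0, False))]"
  define rep :: "nat \<Rightarrow> half_edge" where "rep n = (if n = 0 then (q, False) else (C, \<not> lead p))" for n
  have t: "retract t (p, out) = (if out then Inl (Inr 2, \<not> lead q) else Inl (Inr 0, False))"
    "retract t (q, out) = (if out then Inl (Inr 0, True) else Inr 0)"
    "retract t (mate p, out) = (if out = lead p then Inr 0 else Inl (Inr 1, \<not> lead p))"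
    "retract t (mate q, out) = (if out = lead q then Inl (Inr 2, lead q) else Inl (Inr 2, \<not> lead q))"
    "retract t (B, out) = (if out = lead p then Inl (Inr 2, lead q) else Inl (Inr 0, False))"
    "retract t (C, out) = (if out = lead p then Inl (Inr 1, lead p) else Inr 1)"
    "retract t (mate B, out) = (if out = lead q then Inr 1 else Inr 0)"
    "retract t (mate C, out) = (if out = lead q then Inl (Inr 2, lead q) else Inl (Inr 0, False))"
    for out by (simp_all add: t_def retract_def all_neqs)
  have e0: "lin_next (hole_word midway (Inr 0)) p q" by (simp add: arcs)
  have e1: "lin_next (hole_word midway (Inr 1)) (if lead p then (mate p) else B) (if lead p then B else (mate p))"
    by (simp add: arcs' ord3_def)
  have e2: "lin_next (hole_word midway (Inr 1)) (if lead p then B else C) (if lead p then C else B)"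
    by (simp add: arcs' ord3_def)
  have e3: "lin_next (hole_word midway (Inr 2)) (if lead q then (mate q) else (mate B)) (if lead q then (mate B) else (mate q))"
    by (simp add: arcs' ord3_def)
  have e4: "lin_next (hole_word midway (Inr 2)) (if lead q then (mate B) else (mate C)) (if lead q then (mate C) else (mate B))"
    by (simp add: arcs' ord3_def)
  have eqs: "equivclp (face_step D) (p, True) = equivclp (face_step D) (mate q, \<not> lead q)"
    "equivclp (face_step D) (q, False) = equivclp (face_step D) (mate p, lead p)"
    "equivclp (face_step D) (mate p, lead p) = equivclp (face_step D) (mate B, \<not> lead q)"
    "equivclp (face_step D) (B, \<not> lead p) = equivclp (face_step D) (p, False)"
    "equivclp (face_step D) (C, \<not> lead p) = equivclp (face_step D) (mate B, lead q)"
    "equivclp (face_step D) (B, lead p) = equivclp (face_step D) (mate C, lead q)"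
    "equivclp (face_step D) (mate q, lead q) = equivclp (face_step D) (B, lead p)"
    "equivclp (face_step D) (mate C, \<not> lead q) = equivclp (face_step D) (B, \<not> lead p)"
    using face_step_inner[OF _ e0] face_step_inner[OF _ e1] face_step_inner[OF _ e2] face_step_inner[OF _ e3] face_step_inner[OF _ e4] lead_B lead_C
    by (cases "lead p"; cases "lead q"; simp)+
  have "num_faces D = card (classes sk_half_edges sk_face) + card ({0, 1} :: nat set)"
  proof (rule num_faces_expand[where G = "retract t" and rep = rep])
    show "retract t (x, out) = Inl (Inl x, out)" if "x \<in> X" for x out
      using that by (intro retract_X) (auto simp: t_def old_def new_def)
  next
    fix k :: nat and out assume "k < 3"
    then show "retract t (outer (Inr k, out)) = Inl (Inr k, out)"
      "retract t (rotate_half (outer (Inr k, out))) = Inl (turn (Inr k, out))"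
      by (cases out; cases "lead p"; cases "lead q"; elim less_3E; simp add: t arcs' lead_B lead_C)+
  next
    fix k :: nat and x y assume "k < 3" "lin_next (hole_word midway (Inr k)) x y"
    then show "retract t (x, True) = retract t (rotate_half (y, False)) \<and>
      retract t (y, False) = retract t (rotate_half (x, True))"
      by (cases "lead p"; cases "lead q"; elim less_3E; simp add: arcs'; elim disjE conjE; simp add: t lead_B lead_C)
  next
    fix h :: half_edge assume h: "h \<in> (old \<union> new) \<times> UNIV"
    obtain x out where x: "h = (x, out)" "x \<in> old \<union> new" using h by blast
    show "case retract t h of Inl s \<Rightarrow> fst s \<in> {Inr 0, Inr 1, Inr 2} | Inr n \<Rightarrow> n \<in> {0, 1}"
      using x(2) unfolding x(1) by (elim local_cases; cases out; simp add: t)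
    have "equivclp (face_step D) (case_sum outer rep (retract t h)) = equivclp (face_step D) h"
      using x(2) eqs unfolding x(1)
      by (elim local_cases; cases out; cases "lead p"; cases "lead q"; simp add: t rep_def arcs')
    then show "equivclp (face_step D) (case_sum outer rep (retract t h)) h"
      by (rule iffD1[OF equivclp_eq_iff])
  next
    fix n :: nat assume "n \<in> {0, 1}"
    then show "rep n \<in> (old \<union> new) \<times> UNIV \<and> retract t (rep n) = Inr n"
      unfolding old_def new_def by (auto simp: t rep_def)
  qed auto
  then show ?thesis by simp
qed

text \<open>The inner faces are now the two triangles on the edge from \<open>q\<close> to
  \<open>p\<close>: face 0 below it with third corner \<open>B\<close>, face 1 above it with third
  corner \<open>C\<close>.\<close>

lemma num_faces_after:
  "num_faces (expand (hole_word after) T) = card (classes sk_half_edges sk_face) + 2"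
proof -
  interpret filling T X p q "hole_word after" "old \<union> new" by (rule filling_after)
  define t :: "(passage \<times> (bool \<Rightarrow> (letter \<times> bool) + nat)) list" where "t = [(p, \<lambda>out. if out then Inl (Inr 0, True) else Inr 1),
    (q, \<lambda>out. if out then Inr 0 else Inl (Inr 0, False)),
    (mate p, \<lambda>out. if out = lead p then Inl (Inr 2, lead q) else Inr 0),
    (mate q, \<lambda>out. if out = lead q then Inr 1 else Inl (Inr 1, \<not> lead p)),
    (B, \<lambda>out. if out = lead p then Inl (Inr 0, True) else Inl (Inr 1, \<not> lead p)),
    (C, \<lambda>out. if out = lead p then Inl (Inr 1, lead p) else Inr 1),
    (mate B, \<lambda>out. if out = lead q then Inr 0 else Inl (Inr 2, \<not> lead q)),
    (mate C, \<lambda>out. if out = lead q then Inl (Inr 2, lead q) else Inl (Inr 0, False))]"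
  define rep :: "nat \<Rightarrow> half_edge" where "rep n = (if n = 0 then (q, True) else (p, False))" for n
  have t: "retract t (p, out) = (if out then Inl (Inr 0, True) else Inr 1)"
    "retract t (q, out) = (if out then Inr 0 else Inl (Inr 0, False))"
    "retract t (mate p, out) = (if out = lead p then Inl (Inr 2, lead q) else Inr 0)"
    "retract t (mate q, out) = (if out = lead q then Inr 1 else Inl (Inr 1, \<not> lead p))"
    "retract t (B, out) = (if out = lead p then Inl (Inr 0, True) else Inl (Inr 1, \<not> lead p))"
    "retract t (C, out) = (if out = lead p then Inl (Inr 1, lead p) else Inr 1)"
    "retract t (mate B, out) = (if out = lead q then Inr 0 else Inl (Inr 2, \<not> lead q))"
    "retract t (mate C, out) = (if out = lead q then Inl (Inr 2, lead q) else Inl (Inr 0, False))"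
    for out by (simp_all add: t_def retract_def all_neqs)
  have e0: "lin_next (hole_word after (Inr 0)) q p" by (simp add: arcs)
  have e1: "lin_next (hole_word after (Inr 1)) (if lead p then B else (mate p)) (if lead p then (mate p) else B)"
    by (simp add: arcs' ord3_def)
  have e2: "lin_next (hole_word after (Inr 1)) (if lead p then (mate p) else C) (if lead p then C else (mate p))"
    by (simp add: arcs' ord3_def)
  have e3: "lin_next (hole_word after (Inr 2)) (if lead q then (mate B) else (mate q)) (if lead q then (mate q) else (mate B))"
    by (simp add: arcs' ord3_def)
  have e4: "lin_next (hole_word after (Inr 2)) (if lead q then (mate q) else (mate C)) (if lead q then (mate C) else (mate q))"
    by (simp add: arcs' ord3_def)
  have eqs: "equivclp (face_step D) (q, True) = equivclp (face_step D) (mate p, \<not> lead p)"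
    "equivclp (face_step D) (p, False) = equivclp (face_step D) (mate q, lead q)"
    "equivclp (face_step D) (B, lead p) = equivclp (face_step D) (p, True)"
    "equivclp (face_step D) (mate p, \<not> lead p) = equivclp (face_step D) (mate B, lead q)"
    "equivclp (face_step D) (mate q, \<not> lead q) = equivclp (face_step D) (B, \<not> lead p)"
    "equivclp (face_step D) (mate q, lead q) = equivclp (face_step D) (C, \<not> lead p)"
    "equivclp (face_step D) (mate C, \<not> lead q) = equivclp (face_step D) (q, False)"
    "equivclp (face_step D) (mate p, lead p) = equivclp (face_step D) (mate C, lead q)"
    using face_step_inner[OF _ e0] face_step_inner[OF _ e1] face_step_inner[OF _ e2] face_step_inner[OF _ e3] face_step_inner[OF _ e4] lead_B lead_C
    by (cases "lead p"; cases "lead q"; simp)+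
  have "num_faces D = card (classes sk_half_edges sk_face) + card ({0, 1} :: nat set)"
  proof (rule num_faces_expand[where G = "retract t" and rep = rep])
    show "retract t (x, out) = Inl (Inl x, out)" if "x \<in> X" for x out
      using that by (intro retract_X) (auto simp: t_def old_def new_def)
  next
    fix k :: nat and out assume "k < 3"
    then show "retract t (outer (Inr k, out)) = Inl (Inr k, out)"
      "retract t (rotate_half (outer (Inr k, out))) = Inl (turn (Inr k, out))"
      by (cases out; cases "lead p"; cases "lead q"; elim less_3E; simp add: t arcs' lead_B lead_C)+
  next
    fix k :: nat and x y assume "k < 3" "lin_next (hole_word after (Inr k)) x y"
    then show "retract t (x, True) = retract t (rotate_half (y, False)) \<and>
      retract t (y, False) = retract t (rotate_half (x, True))"
      by (cases "lead p"; cases "lead q"; elim less_3E; simp add: arcs'; elim disjE conjE; simp add: t lead_B lead_C)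
  next
    fix h :: half_edge assume h: "h \<in> (old \<union> new) \<times> UNIV"
    obtain x out where x: "h = (x, out)" "x \<in> old \<union> new" using h by blast
    show "case retract t h of Inl s \<Rightarrow> fst s \<in> {Inr 0, Inr 1, Inr 2} | Inr n \<Rightarrow> n \<in> {0, 1}"
      using x(2) unfolding x(1) by (elim local_cases; cases out; simp add: t)
    have "equivclp (face_step D) (case_sum outer rep (retract t h)) = equivclp (face_step D) h"
      using x(2) eqs unfolding x(1)
      by (elim local_cases; cases out; cases "lead p"; cases "lead q"; simp add: t rep_def arcs')
    then show "equivclp (face_step D) (case_sum outer rep (retract t h)) h"
      by (rule iffD1[OF equivclp_eq_iff])
  next
    fix n :: nat assume "n \<in> {0, 1}"
    then show "rep n \<in> (old \<union> new) \<times> UNIV \<and> retract t (rep n) = Inr n"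
      unfolding old_def new_def by (auto simp: t rep_def)
  qed auto
  then show ?thesis by simp
qed

section \<open>Pieces, validity and planarity\<close>

lemma num_pieces:
  "num_pieces (expand (hole_word before) T) = card (classes sk_half_edges sk_conn)"
  "num_pieces (expand (hole_word midway) T) = card (classes sk_half_edges sk_conn)"
  "num_pieces (expand (hole_word after) T) = card (classes sk_half_edges sk_conn)"
proof -
  show "num_pieces (expand (hole_word before) T) = card (classes sk_half_edges sk_conn)"
  proof -
    interpret filling T X p q "hole_word before" old by (rule filling_before)
    let ?c = "equivclp conn"
    have "?c (x, True) = ?c (p, True)" if "x \<in> old" for x
    proof -
      have "?c (p, True) = ?c (q, True)"
        by (rule connects_follows, simp only: follows_D, rule disjI1, rule exI[of _ 0]) (simp add: arcs')
      then show ?thesis using that unfolding old_def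
        by (elim insertE emptyE; simp add: connects_passage(2))
    qed
    then show ?thesis
      by (intro num_pieces_expand equivclp_eq_iff[THEN iffD1]) (auto simp: arcs' all_neqs)
  qed
  show "num_pieces (expand (hole_word midway) T) = card (classes sk_half_edges sk_conn)"
  proof -
    interpret filling T X p q "hole_word midway" "old \<union> new" by (rule filling_midway)
    let ?c = "equivclp conn"
    have "?c (x, True) = ?c (p, True)" if "x \<in> old \<union> new" for x
    proof -
      have "?c (p, True) = ?c (q, True)"
        by (rule connects_follows, simp only: follows_D, rule disjI1, rule exI[of _ 0]) (simp add: arcs')
      moreover have "?c (if lead p then mate p else B, True) = ?c (if lead p then B else mate p, True)"
        "?c (if lead p then B else C, True) = ?c (if lead p then C else B, True)"
        by (rule connects_follows, simp only: follows_D, rule disjI1, rule exI[of _ 1], simp add: arcs' ord3_def)+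
      ultimately show ?thesis using that unfolding old_def new_def
        by (elim UnE insertE emptyE; cases "lead p"; simp add: connects_passage(2))
    qed
    then show ?thesis
      by (intro num_pieces_expand equivclp_eq_iff[THEN iffD1]) (auto simp: arcs' all_neqs ord3_def)
  qed
  show "num_pieces (expand (hole_word after) T) = card (classes sk_half_edges sk_conn)"
  proof -
    interpret filling T X p q "hole_word after" "old \<union> new" by (rule filling_after)
    let ?c = "equivclp conn"
    have "?c (x, True) = ?c (p, True)" if "x \<in> old \<union> new" for x
    proof -
      have "?c (q, True) = ?c (p, True)"
        by (rule connects_follows, simp only: follows_D, rule disjI1, rule exI[of _ 0]) (simp add: arcs')
      moreover have "?c (if lead p then B else mate p, True) = ?c (if lead p then mate p else B, True)"
        "?c (if lead p then mate p else C, True) = ?c (if lead p then C else mate p, True)"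
        by (rule connects_follows, simp only: follows_D, rule disjI1, rule exI[of _ 1], simp add: arcs' ord3_def)+
      ultimately show ?thesis using that unfolding old_def new_def
        by (elim UnE insertE emptyE; cases "lead p"; simp add: connects_passage(2))
    qed
    then show ?thesis
      by (intro num_pieces_expand equivclp_eq_iff[THEN iffD1]) (auto simp: arcs' all_neqs ord3_def)
  qed
qed

lemma passages_before: "passages (expand (hole_word before) T) = X \<union> old"
  by (rule filling.passages_D[OF filling_before])

lemma passages_midway: "passages (expand (hole_word midway) T) = X \<union> (old \<union> new)"
  by (rule filling.passages_D[OF filling_midway])

lemma passages_after: "passages (expand (hole_word after) T) = X \<union> (old \<union> new)"
  by (rule filling.passages_D[OF filling_after])

lemma distinct_expand:
  assumes "filling T X \<phi> L" "distinct (\<phi> (Inr 0) @ \<phi> (Inr 1) @ \<phi> (Inr 2))"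
  shows "distinct (concat (expand \<phi> T))"
proof -
  interpret filling T X p q \<phi> L by (rule assms(1))
  have L: "set (\<phi> (Inr k)) \<subseteq> L" "distinct (\<phi> (Inr k))" if "k < 3" for k
    using that assms(2) by (elim less_3E; auto simp: local)+
  have disj: "set (\<phi> (Inr k)) \<inter> set (\<phi> (Inr l)) = {}" if "k < 3" "l < 3" "k \<noteq> l" for k l
    using that assms(2) by (elim less_3E) auto
  have dist: "distinct (\<phi> z)" if "z \<in> alphabet T" for z
    using that L(2) unfolding letters by (auto simp: \<phi>_Inl less_3_iff)
  have "z = z'" if "z \<in> alphabet T" "z' \<in> alphabet T" "x \<in> set (\<phi> z)" "x \<in> set (\<phi> z')" for z z' x
  proof -
    have "(\<exists>x\<in>X. z = Inl x) \<or> (\<exists>k<3. z = Inr k)" if "z \<in> alphabet T" for z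
      using that unfolding letters by (auto simp: less_3_iff)
    from this[OF that(1)] this[OF that(2)] show ?thesis
    proof (elim disjE bexE exE conjE)
      fix k l assume "k < 3" "z = Inr k" "l < 3" "z' = Inr l"
      then show ?thesis using that(3,4) disj[of k l] by auto
    qed (use that(3,4) L(1) disjnt in \<open>auto simp: \<phi>_Inl\<close>)
  qed
  then show ?thesis
    unfolding concat_expand using dist
    by (intro distinct_concat_map[OF distinct_T]) (auto simp: alphabet_def)
qed

lemma distinct_codes:
  "distinct (concat (expand (hole_word before) T))"
  "distinct (concat (expand (hole_word midway) T))"
  "distinct (concat (expand (hole_word after) T))"
  by (rule distinct_expand[OF filling_before] distinct_expand[OF filling_midway]
    distinct_expand[OF filling_after]; simp add: arcs' all_neqs ord3_def)+

lemma valid_codes: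
  "valid_code (expand (hole_word before) T)"
  "valid_code (expand (hole_word midway) T)"
  "valid_code (expand (hole_word after) T)"
proof -
  have "y = x \<or> y = mate x"
    if "x \<in> X \<union> (old \<union> new)" "y \<in> X \<union> (old \<union> new)" "crossing y = crossing x" for x y
    using that X_valid[of x y] X_crossing[of x] X_crossing[of y] crossings
    by (elim UnE local_cases[of x, OF UnI1] local_cases[of x, OF UnI2]
      local_cases[of y, OF UnI1] local_cases[of y, OF UnI2]) auto
  moreover have "mate x \<in> X \<union> (old \<union> new)" if "x \<in> X \<union> (old \<union> new)" for x
    using that mate_X unfolding old_def new_def by auto
  moreover have "mate x \<in> X \<union> old" if "x \<in> X \<union> old" for x
    using that mate_X unfolding old_def by auto
  ultimately show
    "valid_code (expand (hole_word before) T)"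
    "valid_code (expand (hole_word midway) T)"
    "valid_code (expand (hole_word after) T)"
    unfolding valid_code_def passages_before passages_midway passages_after
    using distinct_codes by auto
qed

text \<open>The new crossings contribute 2 vertices, 4 edges and 2 faces, so the Euler sum keeps its
  value, and so does the number of pieces.\<close>

lemma planar_codes:
  assumes "planar (expand (hole_word before) T)"
  shows "planar (expand (hole_word midway) T)" "planar (expand (hole_word after) T)"
proof -
  have fin: "finite X"
    using finite_imageD[of Inl X] letters
    by (metis List.finite_set alphabet_def finite_Un inj_Inl)
  have edges: "num_edges (expand \<phi> T) = card (passages (expand \<phi> T))"
    if "distinct (concat (expand \<phi> T))" for \<phi> :: "letter \<Rightarrow> passage list"
    using that unfolding num_edges_def passages_def by (simp only: distinct_card)
  have "card old = 4" "card (old \<union> new) = 8" "finite (old \<union> new)" "finite old"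
    unfolding old_def new_def by (simp_all add: all_neqs)
  moreover have "X \<inter> old = {}" "X \<inter> (old \<union> new) = {}" using X_local by auto
  ultimately have E: "card (X \<union> old) = card X + 4" "card (X \<union> (old \<union> new)) = card X + 8"
    using fin by (simp_all add: card_Un_disjoint)
  have "crossing ` (X \<union> old) = crossing ` X \<union> {crossing p, crossing q}"
    "crossing ` (X \<union> (old \<union> new)) = crossing ` X \<union> {crossing p, crossing q, crossing B, crossing C}"
    unfolding old_def new_def by auto
  moreover have "crossing ` X \<inter> {crossing p, crossing q, crossing B, crossing C} = {}"
    using X_crossing by blast
  moreover from this have "crossing ` X \<inter> {crossing p, crossing q} = {}" by auto
  ultimately have V: "card (crossing ` (X \<union> old)) = card (crossing ` X) + 2"
    "card (crossing ` (X \<union> (old \<union> new))) = card (crossing ` X) + 4"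
    using fin crossings by (simp_all only: card_Un_disjoint finite_imageI finite.intros) simp_all
  show "planar (expand (hole_word midway) T)" "planar (expand (hole_word after) T)"
    using assms unfolding planar_def num_vertices_def passages_before passages_midway passages_after
      edges[OF distinct_codes(1)] edges[OF distinct_codes(2)] edges[OF distinct_codes(3)]
      num_faces_before num_faces_midway num_faces_after num_pieces E V
    by simp_all
qed

end

section \<open>Realising the exchange by moves\<close>

lemma concat_map_concat: "concat (map f (concat (map g w))) = concat (map (\<lambda>z. concat (map f (g z))) w)"
  by (induction w) auto

lemma expand_expand: "expand \<phi> (expand \<psi> T) = expand (\<lambda>z. concat (map \<phi> (\<psi> z))) T"
  by (simp add: expand_def o_def concat_map_concat)

lemma expand_cong: "(\<And>z. z \<in> alphabet T \<Longrightarrow> \<phi> z = \<psi> z) \<Longrightarrow> expand \<phi> T = expand \<psi> T"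
  unfolding expand_def alphabet_def by (intro map_cong refl arg_cong[where f = concat]) auto

lemma fill_expand: "fill ss (expand \<psi> T) = expand (\<lambda>z. concat (map (hole_word ss) (\<psi> z))) T"
  by (simp add: fill_eq_expand expand_expand)

definition survives :: "nat set \<Rightarrow> letter \<Rightarrow> bool" where
  "survives C z = (case z of Inl x \<Rightarrow> crossing x \<notin> C | Inr k \<Rightarrow> True)"

lemma survives_simps [simp]: "survives C (Inl x) \<longleftrightarrow> crossing x \<notin> C" "survives C (Inr k)"
  by (simp_all add: survives_def)

lemma erase_expand: "erase C (expand \<psi> T) = expand (\<lambda>z. filter (survives C) (\<psi> z)) T"
  by (simp add: erase_def expand_def survives_def[abs_def] filter_concat o_def)

definition holes_of :: "letter list \<Rightarrow> nat list" where
  "holes_of w = concat (map (\<lambda>z. case z of Inl x \<Rightarrow> [] | Inr k \<Rightarrow> [k]) w)"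

lemma holes_of_simps [simp]:
  "holes_of [] = []" "holes_of (Inl x # w) = holes_of w" "holes_of (Inr k # w) = k # holes_of w"
  by (simp_all add: holes_of_def)

lemma holes_expand: "holes (expand \<psi> T) = concat (map (\<lambda>z. holes_of (\<psi> z)) (concat T))"
  by (simp add: holes_def concat_expand concat_map_concat holes_of_def)

context exchange
begin

lemma alphabet_cases:
  assumes "z \<in> alphabet T"
  obtains x where "x \<in> X" "z = Inl x" | "z = Inr 0" | "z = Inr 1" | "z = Inr 2"
  using assms unfolding letters by blast

lemma has_holes_expand:
  assumes Inl: "\<And>x. \<psi> (Inl x) = [Inl x]"
    and dist: "distinct (holes_of (\<psi> (Inr 0)) @ holes_of (\<psi> (Inr 1)) @ holes_of (\<psi> (Inr 2)))"
    and set: "set (holes_of (\<psi> (Inr 0)) @ holes_of (\<psi> (Inr 1)) @ holes_of (\<psi> (Inr 2))) = {..<n}"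
  shows "has_holes n (expand \<psi> T)"
proof -
  let ?f = "\<lambda>z. holes_of (\<psi> z)"
  have "distinct (concat (map ?f (concat T)))"
  proof (rule distinct_concat_map[OF distinct_T])
    fix z assume "z \<in> set (concat T)"
    then have "z \<in> alphabet T" by (simp add: alphabet_def)
    then show "distinct (?f z)" using dist by (cases rule: alphabet_cases) (auto simp: Inl)
  next
    fix z z' x assume "z \<in> set (concat T)" "z' \<in> set (concat T)" and x: "x \<in> set (?f z)" "x \<in> set (?f z')"
    then have "z \<in> alphabet T" "z' \<in> alphabet T" by (simp_all add: alphabet_def)
    then show "z = z'" using x dist by (elim alphabet_cases) (auto simp: Inl)
  qed
  moreover have "set (concat (map ?f (concat T))) = {..<n}"
  proof -
    have "set (concat (map ?f (concat T))) = (\<Union>z\<in>alphabet T. set (?f z))"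
      by (simp add: alphabet_def)
    also have "\<dots> = {..<n}"
      unfolding letters set[symmetric] by (auto simp: Inl)
    finally show ?thesis .
  qed
  ultimately show ?thesis
    using distinct_T unfolding has_holes_def holes_expand by (simp only: alphabet_def order_refl)
qed

text \<open>Turns the skeleton into the template of a move: the words for the three arcs keep the
  passages that stay fixed and contain the holes of the move, which are numbered afresh.\<close>

definition subst :: "letter list \<Rightarrow> letter list \<Rightarrow> letter list \<Rightarrow> letter \<Rightarrow> letter list" where
  "subst u v w z = (case z of Inl x \<Rightarrow> [Inl x] | Inr k \<Rightarrow> [u, v, w] ! k)"

lemma subst_simps [simp]:
  "subst u v w (Inl x) = [Inl x]" "subst u v w (Inr 0) = u" "subst u v w (Inr (Suc 0)) = v"
  "subst u v w (Inr 2) = w"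
  by (simp_all add: subst_def)

lemma fill_subst:
  assumes "concat (map (hole_word ss) u) = tt ! 0" "concat (map (hole_word ss) v) = tt ! 1"
    "concat (map (hole_word ss) w) = tt ! 2"
  shows "expand (hole_word tt) T = fill ss (expand (subst u v w) T)"
  unfolding fill_expand
proof (rule expand_cong)
  fix z assume "z \<in> alphabet T"
  then show "hole_word tt z = concat (map (hole_word ss) (subst u v w z))"
    using assms by (cases rule: alphabet_cases) auto
qed

text \<open>The levels put arc 1 above arc 0 and arc 0 above arc 2. So arc 1 may be pushed over arc
  2 above arc 0, and then the triangle at \<open>p\<close>, \<open>q\<close>, \<open>B\<close> is
  flipped.\<close>

lemma R2_R3_moves:
  assumes "level p = Under" "level q = Over" "level B = Over" "level C = Over"
  shows "code_move (expand (hole_word before) T) (expand (hole_word midway) T)"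
    "code_move (expand (hole_word midway) T) (expand (hole_word after) T)"
proof -
  \<comment> \<open>\<open>x\<close> and \<open>y\<close> are the two new crossings in their order
    along arc 1; arcs 1 and 2 are parallel iff \<open>b\<close>.\<close>
  define x where "x = (if lead p then B else C)"
  define y where "y = (if lead p then C else B)"
  define b where "b \<longleftrightarrow> lead p = lead q"
  let ?T = "expand (subst [Inl p, Inl q]
    (if lead p then [Inl (mate p), Inr 0] else [Inr 0, Inl (mate p)])
    (if lead q then [Inl (mate q), Inr 1] else [Inr 1, Inl (mate q)])) T"
  have "code_move (fill [[], []] ?T) (fill [[x, y], in_order b (mate x) (mate y)] ?T)"
    using assms lead_B lead_C
    by (intro code_move.R2 has_holes_expand) (auto simp: x_def y_def)
  moreover have "expand (hole_word before) T = fill [[], []] ?T"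
    "expand (hole_word midway) T = fill [[x, y], in_order b (mate x) (mate y)] ?T"
    by (rule fill_subst; simp add: arcs' ord3_def x_def y_def b_def in_order_def)+
  ultimately show "code_move (expand (hole_word before) T) (expand (hole_word midway) T)"
    by simp
  \<comment> \<open>\<open>R3\<close> lists the arcs from top to bottom, so arc 1 gets hole 0, arc 0
    hole 1 and arc 2 hole 2. The crossing of \<open>C\<close> stays in the template. The rule is
    instantiated with \<open>mate p\<close>, \<open>B\<close>, \<open>q\<close> for its three
    over-passages, which is why \<open>mate (mate p)\<close> appears in \<open>t\<close>.\<close>
  let ?T = "expand (subst [Inr 1]
    (if lead p then [Inr 0, Inl C] else [Inl C, Inr 0])
    (if lead q then [Inr 2, Inl (mate C)] else [Inl (mate C), Inr 2])) T"
  define s where "s = in_order (lead p) (mate p) B"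
  define t where "t = in_order True (mate (mate p)) q"
  define u where "u = in_order (\<not> lead q) (mate B) (mate q)"
  have "code_move (fill [s, t, u] ?T) (fill [rev s, rev t, rev u] ?T)"
    by (rule code_move.R3[where e = False, OF has_holes_expand _ _ _ s_def t_def u_def])
      (use assms lead_B in auto)
  moreover have "expand (hole_word midway) T = fill [s, t, u] ?T"
    "expand (hole_word after) T = fill [rev s, rev t, rev u] ?T"
    by (rule fill_subst; simp add: arcs' ord3_def s_def t_def u_def in_order_def)+
  ultimately show "code_move (expand (hole_word midway) T) (expand (hole_word after) T)"
    by simp
qed

text \<open>If arc 1 crosses arc 0 virtually, it can be rerouted past \<open>q\<close> in one step.
  Erasing the crossings of the moved arc removes \<open>p\<close> from arc 0 and
  \<open>mate B\<close>, \<open>mate C\<close> from arc 2, so both templates leave \<open>q\<close>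
  on arc 0 and \<open>mate q\<close> on arc 2.\<close>

lemma detour_move:
  assumes "level p = Virtual" "level B = Virtual" "level C = Virtual"
  shows "code_move (expand (hole_word before) T) (expand (hole_word after) T)"
proof -
  let ?s = "[mate p]" and ?s' = "ord3 (lead p) B (mate p) C"
  let ?T = "expand (subst [Inl p, Inl q] [Inr 0] [Inl (mate q)]) T"
  let ?T' = "expand (subst [Inl q, Inl p] [Inr 0] (map Inl (ord3 (lead q) (mate B) (mate q) (mate C)))) T"
  have "erase (crossing ` set ?s) ?T = erase (crossing ` set ?s') ?T'"
    unfolding erase_expand
  proof (rule expand_cong)
    fix z assume "z \<in> alphabet T"
    then show "filter (survives (crossing ` set ?s)) (subst [Inl p, Inl q] [Inr 0] [Inl (mate q)] z) =
      filter (survives (crossing ` set ?s')) (subst [Inl q, Inl p] [Inr 0]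
        (map Inl (ord3 (lead q) (mate B) (mate q) (mate C))) z)"
      using crossings X_crossing by (cases rule: alphabet_cases) (auto simp: ord3_def)
  qed
  then have "code_move (fill [?s] ?T) (fill [?s'] ?T')"
    using assms by (intro code_move.detour has_holes_expand) (auto simp: ord3_def)
  moreover have "expand (hole_word before) T = fill [?s] ?T"
    "expand (hole_word after) T = fill [?s'] ?T'"
    by (rule fill_subst; simp add: arcs' ord3_def)+
  ultimately show ?thesis by simp
qed

lemma exchange_reachable:
  assumes "planar (expand (hole_word before) T)"
    and "level p = Under \<and> level q = Over \<and> level B = Over \<and> level C = Over \<or>
      level p = Virtual \<and> level B = Virtual \<and> level C = Virtual"
  shows "diagram_move\<^sup>*\<^sup>* (expand (hole_word before) T) (expand (hole_word after) T)"
    "diagram (expand (hole_word after) T)"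
proof -
  have diagrams: "diagram (expand (hole_word before) T)" "diagram (expand (hole_word midway) T)"
    "diagram (expand (hole_word after) T)"
    using assms(1) valid_codes planar_codes unfolding diagram_def by auto
  show "diagram (expand (hole_word after) T)" by fact
  show "diagram_move\<^sup>*\<^sup>* (expand (hole_word before) T) (expand (hole_word after) T)"
    using assms(2)
  proof (elim disjE conjE)
    assume "level p = Under" "level q = Over" "level B = Over" "level C = Over"
    note moves = R2_R3_moves[OF this]
    then have "diagram_move (expand (hole_word before) T) (expand (hole_word midway) T)"
      "diagram_move (expand (hole_word midway) T) (expand (hole_word after) T)"
      using diagrams unfolding diagram_move_def by auto
    then show ?thesis by (meson r_into_rtranclp rtranclp.rtrancl_into_rtrancl)
  next
    assume "level p = Virtual" "level B = Virtual" "level C = Virtual"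
    from detour_move[OF this] show ?thesis
      using diagrams unfolding diagram_move_def by auto
  qed
qed

end

section \<open>Placing an exchange in a diagram\<close>

text \<open>Validity and all terms of Euler's formula depend on the passages and their successor
  relation only, not on base points or on the order of the components.\<close>

lemma diagram_cong:
  assumes "next_in D' = next_in D" "mset (concat D') = mset (concat D)" "diagram D"
  shows "diagram D'"
proof -
  have "passages D' = passages D"
    unfolding passages_def using assms(2) by (metis set_mset_mset)
  moreover have "length (concat D') = length (concat D)"
    using assms(2) by (metis size_mset)
  moreover have "distinct (concat D') = distinct (concat D)"
    using assms(2) by (rule mset_eq_imp_distinct_iff)
  ultimately show ?thesis
    using assms(1,3)
    unfolding diagram_def valid_code_def planar_def num_vertices_def num_edges_def num_faces_def
      num_pieces_def half_edges_def face_step_def[abs_def] same_edge_def[abs_def] follows_eq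
    by simp
qed

text \<open>A hole must be a contiguous segment of a list, whereas \<open>p\<close> and
  \<open>q\<close> may be neighbours across the base point. The preserved data are those from which
  ranks, descents and late passages are read off.\<close>

lemma rotate_to_front:
  assumes D: "diagram D" and next_in: "next_in D p q" and "p \<noteq> q"
  obtains w R where "diagram_move\<^sup>*\<^sup>* D ((p # q # w) # R)" "diagram ((p # q # w) # R)"
    "next_in ((p # q # w) # R) = next_in D" "count_list ((p # q # w) # R) [] = count_list D []"
    "mset (concat ((p # q # w) # R)) = mset (concat D)"
proof -
  obtain c where c: "c \<in> set D" "cyc_next c p q"
    using next_in unfolding next_in_def by blast
  have "\<exists>a b w. c = a @ b \<and> b @ a = p # q # w"
    using c(2) unfolding cyc_next_def
  proof (elim disjE conjE)
    assume "lin_next c p q"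
    then obtain u v where "c = u @ p # q # v" unfolding lin_next_def by blast
    then have "c = u @ (p # q # v) \<and> (p # q # v) @ u = p # q # (v @ u)" by simp
    then show ?thesis by blast
  next
    assume *: "c \<noteq> []" "p = last c" "q = hd c"
    then obtain c' where c': "c = c' @ [p]" by (metis append_butlast_last_id)
    have "c' \<noteq> []" using *(3) c' \<open>p \<noteq> q\<close> by auto
    moreover from this have "hd c' = q" using *(3) c' by simp
    ultimately obtain c'' where "c' = q # c''" by (metis list.collapse)
    with c' have "c = (q # c'') @ [p] \<and> [p] @ (q # c'') = p # q # c''" by simp
    then show ?thesis by blast
  qed
  then obtain a b w where abw: "c = a @ b" "b @ a = p # q # w" by blast
  obtain D1 D2 where D12: "D = D1 @ c # D2" using c(1) by (meson split_list)
  let ?R = "D1 @ D2"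
  have next1: "next_in (c # ?R) = next_in D"
    unfolding next_in_def[abs_def] D12 by (intro ext) auto
  have next2: "next_in ((p # q # w) # ?R) = next_in D"
  proof -
    have "cyc_next (p # q # w) = cyc_next c"
      using cyc_next_rotate[of a b] by (simp add: abw)
    then have "next_in ((p # q # w) # ?R) = next_in (c # ?R)"
      by (simp add: next_in_def[abs_def])
    then show ?thesis by (simp only: next1)
  qed
  have mset1: "mset (concat (c # ?R)) = mset (concat D)"
    unfolding D12 by simp
  have mset2: "mset (concat ((p # q # w) # ?R)) = mset (concat D)"
    using arg_cong[OF abw(2), of mset] unfolding mset1[symmetric] abw(1) by (simp add: ac_simps)
  have diagrams: "diagram (c # ?R)" "diagram ((p # q # w) # ?R)"
    using diagram_cong[OF next1 mset1 D] diagram_cong[OF next2 mset2 D] .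
  have "code_move D (c # ?R)"
    by (rule code_move.components) (simp add: D12)
  moreover have "code_move (c # ?R) ((p # q # w) # ?R)"
    using code_move.basepoint[of a b ?R] unfolding abw by simp
  ultimately have "diagram_move D (c # ?R)" "diagram_move (c # ?R) ((p # q # w) # ?R)"
    using D diagrams unfolding diagram_move_def by auto
  then have "diagram_move\<^sup>*\<^sup>* D ((p # q # w) # ?R)"
    by (meson r_into_rtranclp rtranclp.rtrancl_into_rtrancl)
  moreover have "c \<noteq> []" using abw by auto
  then have "count_list ((p # q # w) # ?R) [] = count_list D []"
    unfolding D12 by simp
  ultimately show ?thesis
    using that diagrams(2) next2 mset2 by blast
qed

lemma count_list_expand_Nil:
  assumes "\<And>z. z \<in> alphabet T \<Longrightarrow> \<phi> z \<noteq> []"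
  shows "count_list (expand \<phi> T) [] = count_list T []"
  using assms
proof (induction T)
  case (Cons w T)
  have "concat (map \<phi> w) = [] \<longleftrightarrow> w = []"
    using Cons.prems by (cases w) (auto simp: alphabet_def)
  moreover have "count_list (expand \<phi> T) [] = count_list T []"
    using Cons by (auto simp: alphabet_def)
  ultimately show ?case by (simp add: expand_def)
qed (simp add: expand_def)

lemma exchange_exists:
  assumes D: "diagram D" and pq: "next_in D p q" "crossing p \<noteq> crossing q"
  obtains T X B C where
    "exchange T X p q B C"
    "diagram_move\<^sup>*\<^sup>* D (expand (hole_word (exchange.before p q)) T)"
    "diagram (expand (hole_word (exchange.before p q)) T)"
    "next_in (expand (hole_word (exchange.before p q)) T) = next_in D"
    "passages (expand (hole_word (exchange.before p q)) T) = passages D"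
    "count_list T [] = count_list D []"
    "level B = level (mate p)" "level C = level (mate p)"
proof -
  have "p \<noteq> q" using pq(2) by auto
  from rotate_to_front[OF D pq(1) this] obtain w R where wR:
    "diagram_move\<^sup>*\<^sup>* D ((p # q # w) # R)" "diagram ((p # q # w) # R)"
    "next_in ((p # q # w) # R) = next_in D" "count_list ((p # q # w) # R) [] = count_list D []"
    "mset (concat ((p # q # w) # R)) = mset (concat D)" .
  let ?D = "(p # q # w) # R"
  have passages: "passages ?D = passages D"
    unfolding passages_def using wR(5) by (metis set_mset_mset)
  have valid: "valid_code ?D" using wR(2) by (simp add: diagram_def)
  have mates: "mate p \<in> passages ?D" "mate q \<in> passages ?D"
    using valid unfolding valid_code_def by (auto simp: passages_def)
  have neq: "mate p \<noteq> q" "mate q \<noteq> p" "mate p \<noteq> mate q" "mate p \<noteq> p" "mate q \<noteq> q"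
    using pq(2) mate_neq by (metis mate_simps(2))+
  \<comment> \<open>The passages of arcs 1 and 2 through arc 0 become holes; the pair at the front
    becomes hole 0.\<close>
  define \<tau> :: "passage \<Rightarrow> letter" where
    "\<tau> x = (if x = mate p then Inr 1 else if x = mate q then Inr 2 else Inl x)" for x
  define T where "T = (Inr 0 # map \<tau> w) # map (map \<tau>) R"
  define X where "X = passages D - {p, q, mate p, mate q}"
  have rest: "set (w @ concat R) = passages ?D - {p, q}"
    using valid unfolding valid_code_def passages_def by auto
  have alphabet: "alphabet T = insert (Inr 0) (\<tau> ` set (w @ concat R))"
    unfolding T_def alphabet_def by auto
  have letters: "alphabet T = Inl ` X \<union> {Inr 0, Inr 1, Inr 2}"
  proof -
    have "passages ?D - {p, q} = X \<union> {mate p, mate q}"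
      unfolding X_def passages[symmetric] using mates neq by auto
    then have "\<tau> ` set (w @ concat R) = \<tau> ` X \<union> {Inr 1, Inr 2}"
      unfolding rest using neq by (auto simp: \<tau>_def)
    moreover have "\<tau> ` X = Inl ` X"
      by (rule image_cong) (auto simp: \<tau>_def X_def)
    ultimately show ?thesis unfolding alphabet by auto
  qed
  have "distinct (concat T)"
  proof -
    have "concat T = Inr 0 # map \<tau> (w @ concat R)"
      unfolding T_def by (simp add: map_concat)
    moreover have "inj_on \<tau> (set (w @ concat R))"
      unfolding \<tau>_def by (auto simp: inj_on_def split: if_splits)
    moreover have "Inr 0 \<notin> \<tau> ` set (w @ concat R)"
      by (auto simp: \<tau>_def split: if_splits)
    moreover have "distinct (w @ concat R)"
      using valid unfolding valid_code_def by simp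
    ultimately show ?thesis by (simp only: distinct.simps distinct_map set_map) simp
  qed
  define cs where "cs = crossing ` passages D"
  have "finite cs" unfolding cs_def passages_def by simp
  then obtain b where b: "b \<notin> cs" using ex_new_if_finite infinite_UNIV_nat by blast
  have "finite (insert b cs)" using \<open>finite cs\<close> by simp
  then obtain c where c: "c \<notin> insert b cs" using ex_new_if_finite infinite_UNIV_nat by blast
  \<comment> \<open>The new passages of arc 1 take the level at which arc 1 crosses arc 0: it stays
    on top, or it stays virtual. Their names are fresh, and their flags are those demanded by the
    locale.\<close>
  define B where "B = Passage b (level (mate p)) (lead p = lead q)"
  define C where "C = Passage c (level (mate p)) (lead p \<noteq> lead q)"
  have pq_in: "p \<in> passages D" "q \<in> passages D"
    unfolding passages[symmetric] by (auto simp: passages_def)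
  have ex: "exchange T X p q B C"
  proof
    show "alphabet T = Inl ` X \<union> {Inr 0, Inr 1, Inr 2}" "distinct (concat T)" by fact+
    show "mate x \<in> X" if "x \<in> X" for x
      using that valid unfolding X_def valid_code_def passages by (auto simp: mate_eq_iff)
    show "distinct [crossing p, crossing q, crossing B, crossing C]"
      using pq(2) pq_in b c unfolding B_def C_def cs_def by auto
    show "crossing x \<notin> {crossing p, crossing q, crossing B, crossing C}" if "x \<in> X" for x
    proof -
      have "crossing x \<in> cs" "x \<in> passages D" "x \<notin> {p, q, mate p, mate q}"
        using that unfolding X_def cs_def by auto
      then show ?thesis
        using valid pq_in b c unfolding valid_code_def passages B_def C_def by auto
    qed
    show "y = x \<or> y = mate x" if "x \<in> X" "y \<in> X" "crossing y = crossing x" for x y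
      using that valid unfolding X_def valid_code_def passages by auto
  qed (auto simp: B_def C_def)
  interpret exchange T X p q B C by fact
  have "hole_word before (\<tau> x) = [x]" for x
    by (simp add: \<tau>_def arcs')
  then have "concat (map (hole_word before \<circ> \<tau>) v) = v" for v
    by (induction v) auto
  then have before: "expand (hole_word before) T = ?D"
    by (simp add: T_def expand_def arcs' o_def)
  have "count_list T [] = count_list ?D []"
    unfolding before[symmetric]
    by (rule count_list_expand_Nil[symmetric]) (auto simp: letters arcs')
  then show ?thesis
    using that[OF ex] wR before passages by (simp add: B_def C_def)
qed

section \<open>Ranked diagrams\<close>

text \<open>A rank stands for the time at which a passage is danced.\<close>

definition ranked :: "code \<Rightarrow> (passage \<Rightarrow> real) \<Rightarrow> bool" where
  "ranked D \<rho> \<longleftrightarrow> (\<forall>x\<in>passages D. level x = Over \<longrightarrow> \<rho> x < \<rho> (mate x))"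

definition descents :: "code \<Rightarrow> (passage \<Rightarrow> real) \<Rightarrow> passage set" where
  "descents D \<rho> = {x. \<exists>y. next_in D x y \<and> \<rho> y \<le> \<rho> x}"

text \<open>A crossing-free circle has no passage and hence no descent, but it does need a dancer,
  so the empty words are added.\<close>

definition num_descents :: "code \<Rightarrow> (passage \<Rightarrow> real) \<Rightarrow> nat" where
  "num_descents D \<rho> = card (descents D \<rho>) + count_list D []"

text \<open>The obstruction to finding a descent on an over-bridge: going back along increasing
  rank, one runs into a passage that is not an overcrossing.\<close>

definition late_over :: "code \<Rightarrow> (passage \<Rightarrow> real) \<Rightarrow> passage \<Rightarrow> passage \<Rightarrow> bool" where
  "late_over D \<rho> x y \<longleftrightarrow> next_in D x y \<and> level x \<noteq> Over \<and> level y = Over \<and> \<rho> x < \<rho> y"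

definition overs_from :: "code \<Rightarrow> (passage \<Rightarrow> real) \<Rightarrow> real \<Rightarrow> passage set" where
  "overs_from D \<rho> r = {y \<in> passages D. level y = Over \<and> r \<le> \<rho> y}"

definition others_upto :: "code \<Rightarrow> (passage \<Rightarrow> real) \<Rightarrow> real \<Rightarrow> passage set" where
  "others_upto D \<rho> r = {x \<in> passages D. level x \<noteq> Over \<and> \<rho> x \<le> r}"

text \<open>
  Moving an over-passage before a virtual passage adds two virtual passages next to the mate of the
  latter; the weight of the pairs of mates makes up for them.
\<close>

definition weight :: "passage set \<Rightarrow> nat" where
  "weight W = card W + 2 * card {x \<in> W. mate x \<in> W}"

lemma weight_mono_strict:
  assumes "finite W" "W' \<subset> W"
  shows "weight W' < weight W"
proof -
  have "card W' < card W" using assms by (simp add: psubset_card_mono)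
  moreover have "card {x \<in> W'. mate x \<in> W'} \<le> card {x \<in> W. mate x \<in> W}"
    using assms by (intro card_mono) auto
  ultimately show ?thesis unfolding weight_def by linarith
qed

text \<open>At most one passage is gained on balance. The pair \<open>p\<close>,
  \<open>mate p\<close> is broken and no pair arises, because the mates of \<open>B\<close> and
  \<open>C\<close> are absent. Each pair is counted from both sides, so the second summand drops by
  at least 4.\<close>

lemma weight_exchange:
  assumes fin: "finite W" and p: "p \<in> W" "mate p \<in> W"
    and W': "W' \<subseteq> W - {p} \<union> {B, C}" "mate B \<notin> W'" "mate C \<notin> W'"
  shows "weight W' < weight W"
proof -
  have "card W' \<le> card (W - {p} \<union> {B, C})"
    using fin W'(1) by (intro card_mono) auto
  also have "\<dots> \<le> card (W - {p}) + card {B, C}" by (rule card_Un_le)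
  also have "card {B, C} \<le> 2" by (cases "B = C") auto
  also have "card (W - {p}) = card W - 1" using p by simp
  finally have 1: "card W' \<le> card W + 1"
    using card_gt_0_iff[of W] fin p by auto
  let ?S = "{x \<in> W. mate x \<in> W}"
  have "{x \<in> W'. mate x \<in> W'} \<subseteq> ?S - {p, mate p}"
    using W' by (auto dest: subsetD)
  then have "card {x \<in> W'. mate x \<in> W'} \<le> card (?S - {p, mate p})"
    using fin by (intro card_mono) auto
  also have "\<dots> = card ?S - 2"
    using fin p by (subst card_Diff_subset) auto
  finally have 2: "card {x \<in> W'. mate x \<in> W'} \<le> card ?S - 2" .
  have "card {p, mate p} \<le> card ?S"
    using fin p by (intro card_mono) auto
  then have 3: "2 \<le> card ?S" by simp
  from 1 2 3 show ?thesis unfolding weight_def by linarith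
qed

lemma gap:
  fixes f :: "'a \<Rightarrow> real"
  assumes "finite A"
  obtains e where "e > 0" "\<And>x y. x \<in> A \<Longrightarrow> y \<in> A \<Longrightarrow> f x < f y \<Longrightarrow> f x + 2 * e < f y"
proof -
  \<comment> \<open>All positive differences of values; the 1 makes \<open>Min\<close> meaningful
    when there are none. A third of the minimum leaves room for shifting both values by
    \<open>e\<close>.\<close>
  define S where "S = insert 1 ((\<lambda>(x, y). f y - f x) ` {(x, y) \<in> A \<times> A. f x < f y})"
  have "finite S" unfolding S_def using assms
    by (intro finite.insertI finite_imageI finite_subset[OF _ finite_cartesian_product[OF assms assms]]) auto
  moreover have "\<And>d. d \<in> S \<Longrightarrow> d > 0" unfolding S_def by auto
  moreover have "S \<noteq> {}" unfolding S_def by simp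
  ultimately have pos: "Min S > 0" by simp
  show ?thesis
  proof (rule that[of "Min S / 3"])
    fix x y assume "x \<in> A" "y \<in> A" "f x < f y"
    then have "f y - f x \<in> S" unfolding S_def by force
    then have "Min S \<le> f y - f x" using \<open>finite S\<close> by simp
    then show "f x + 2 * (Min S / 3) < f y" using pos by simp
  qed (use pos in simp)
qed

section \<open>Ranks after an exchange\<close>

context exchange
begin

abbreviation "D0 \<equiv> expand (hole_word before) T"
abbreviation "D1 \<equiv> expand (hole_word after) T"

lemma next_in_before:
  "next_in D0 x y \<longleftrightarrow> x = p \<and> y = q \<or>
    (\<exists>z z'. next_in T z z' \<and> x = last (hole_word before z) \<and> y = hd (hole_word before z'))"
  unfolding filling.follows_D[OF filling_before, unfolded follows_eq]
  by (auto simp: less_3_iff arcs')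

lemma next_in_after:
  "next_in D1 x y \<longleftrightarrow> x = q \<and> y = p \<or>
    lin_next (ord3 (lead p) B (mate p) C) x y \<or>
    lin_next (ord3 (lead q) (mate B) (mate q) (mate C)) x y \<or>
    (\<exists>z z'. next_in T z z' \<and> x = last (hole_word after z) \<and> y = hd (hole_word after z'))"
  unfolding filling.follows_D[OF filling_after, unfolded follows_eq]
  by (auto simp: less_3_iff arcs')

lemma inj_last_before: "inj_on (\<lambda>z. last (hole_word before z)) (alphabet T)"
  using X_local unfolding inj_on_def letters old_def
  by (auto simp: arcs' all_neqs)

lemma exchange_ranks:
  assumes level: "level p \<noteq> Over" "level q = Over" "level B = level (mate p)" "level C = level (mate p)"
    and ranked: "ranked D0 \<rho>" and pq: "\<rho> p < \<rho> q"
    and first: "\<And>x y. late_over D0 \<rho> x y \<Longrightarrow> \<rho> q \<le> \<rho> y"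
  obtains \<rho>' where "ranked D1 \<rho>'" "\<rho>' q = \<rho> q" "card (descents D1 \<rho>') \<le> card (descents D0 \<rho>)"
    "\<And>x y. late_over D1 \<rho>' x y \<Longrightarrow> \<rho> q \<le> \<rho>' y"
    "overs_from D1 \<rho>' (\<rho> q) = overs_from D0 \<rho> (\<rho> q)"
    "weight (others_upto D1 \<rho>' (\<rho> q)) < weight (others_upto D0 \<rho> (\<rho> q))"
proof -
  let ?P = "passages D0"
  have "finite ?P" by (simp add: passages_def)
  then obtain e where e: "e > 0" "\<And>x y. x \<in> ?P \<Longrightarrow> y \<in> ?P \<Longrightarrow> \<rho> x < \<rho> y \<Longrightarrow> \<rho> x + 2 * e < \<rho> y"
    using gap[of ?P \<rho>] by blast
  have in_P: "p \<in> ?P" "q \<in> ?P" "mate p \<in> ?P" "mate q \<in> ?P"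
    unfolding passages_before old_def by auto
  \<comment> \<open>On arc 0, \<open>p\<close> now follows \<open>q\<close>, so it is delayed to
    just after \<open>q\<close>. The new passages are ranked within \<open>e\<close> of
    \<open>mate p\<close> and \<open>mate q\<close>, with signs that make the ranks increase along
    arcs 1 and 2.\<close>
  define \<rho>' where "\<rho>' = \<rho>(p := \<rho> q + e,
    B := \<rho> (mate p) + (if lead p then - e else e), C := \<rho> (mate p) + (if lead p then e else - e),
    mate B := \<rho> (mate q) + (if lead q then - e else e),
    mate C := \<rho> (mate q) + (if lead q then e else - e))"
  have \<rho>'_local: "\<rho>' p = \<rho> q + e" "\<rho>' q = \<rho> q" "\<rho>' (mate p) = \<rho> (mate p)" "\<rho>' (mate q) = \<rho> (mate q)"
    "\<rho>' B = \<rho> (mate p) + (if lead p then - e else e)"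
    "\<rho>' C = \<rho> (mate p) + (if lead p then e else - e)"
    "\<rho>' (mate B) = \<rho> (mate q) + (if lead q then - e else e)"
    "\<rho>' (mate C) = \<rho> (mate q) + (if lead q then e else - e)"
    unfolding \<rho>'_def by (simp_all add: all_neqs)
  have \<rho>'_X: "\<rho>' x = \<rho> x" if "x \<in> X" for x
    using that X_local unfolding \<rho>'_def old_def new_def by auto
  have levels: "level p = Under \<or> level p = Virtual" "level (mate q) = Under"
    "level (mate p) = Over \<longleftrightarrow> level p = Under"
    using level by (cases "level p"; simp)+
  have q_Q: "\<rho> q < \<rho> (mate q)"
    using ranked in_P level unfolding ranked_def by auto
  have P_p: "\<rho> (mate p) < \<rho> p" if "level p = Under"
    using ranked in_P(3) that level unfolding ranked_def by fastforce
  have e_pq: "\<rho> p + 2 * e < \<rho> q" "\<rho> q + 2 * e < \<rho> (mate q)"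
    using e(2) in_P pq q_Q by auto
  have e_P: "\<rho> (mate p) + 2 * e < \<rho> p" if "level p = Under"
    using e(2) in_P P_p[OF that] by auto

  let ?last = "\<lambda>z. last (hole_word before z)" and ?hd = "\<lambda>z. hd (hole_word before z)"
  let ?last' = "\<lambda>z. last (hole_word after z)" and ?hd' = "\<lambda>z. hd (hole_word after z)"
  \<comment> \<open>No arc ends more than \<open>e\<close> later or begins more than
    \<open>e\<close> earlier than before. As distinct ranks differ by more than
    \<open>2 * e\<close>, ascents along outer edges survive.\<close>
  have last': "\<rho>' (?last' z) \<le> \<rho> (?last z) + e" if "z \<in> alphabet T" for z
    using that e(1) by (cases rule: alphabet_cases) (auto simp: arcs' \<rho>'_local \<rho>'_X ord3_def)
  have hd': "\<rho> (?hd z) - e \<le> \<rho>' (?hd' z)" if "z \<in> alphabet T" for z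
    using that e(1) pq by (cases rule: alphabet_cases) (auto simp: arcs' \<rho>'_local \<rho>'_X ord3_def)
  have ends_in_P: "?last z \<in> ?P" "?hd z \<in> ?P" if "z \<in> alphabet T" for z
    using that unfolding passages_before old_def
    by (cases rule: alphabet_cases; simp add: arcs')+
  have ascent: "\<rho>' (?last' z) < \<rho>' (?hd' z')"
    if "z \<in> alphabet T" "z' \<in> alphabet T" "\<rho> (?last z) < \<rho> (?hd z')" for z z'
    using last'[OF that(1)] hd'[OF that(2)] e(2)[OF ends_in_P(1)[OF that(1)] ends_in_P(2)[OF that(2)] that(3)]
    by linarith
  have inner_ascent: "\<rho>' x < \<rho>' y"
    if "lin_next (ord3 (lead p) B (mate p) C) x y \<or> lin_next (ord3 (lead q) (mate B) (mate q) (mate C)) x y" for x y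
    using that e(1) by (auto simp: ord3_def \<rho>'_local split: if_splits)

  show ?thesis
  proof (rule that)
    show "ranked D1 \<rho>'"
      unfolding ranked_def passages_after
    proof (intro ballI impI)
      fix x assume x: "x \<in> X \<union> (old \<union> new)" "level x = Over"
      from x(1) show "\<rho>' x < \<rho>' (mate x)"
      proof
        assume "x \<in> X"
        then show ?thesis
          using ranked x(2) mate_X unfolding ranked_def passages_before by (simp add: \<rho>'_X)
      next
        assume "x \<in> old \<union> new"
        then show ?thesis
          using x(2) level levels q_Q P_p e(1) e_pq e_P
          by (cases rule: local_cases) (auto simp: \<rho>'_local)
      qed
    qed
    show "\<rho>' q = \<rho> q" by (rule \<rho>'_local)
    \<comment> \<open>All edges inside the disc ascend, so the new descents occur at the ends of
      letters in \<open>Z\<close>. These letters already gave descents, and distinct ones at that,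
      by \<open>inj_last_before\<close>.\<close>
    define Z where "Z = {z. \<exists>z'. next_in T z z' \<and> \<rho> (?hd z') \<le> \<rho> (?last z)}"
    have Z: "Z \<subseteq> alphabet T" unfolding Z_def using next_in_in_set[of T] by auto
    then have "finite Z" by (rule finite_subset) (simp add: alphabet_def)
    have "descents D1 \<rho>' \<subseteq> ?last' ` Z"
    proof
      fix x assume "x \<in> descents D1 \<rho>'"
      then obtain y where y: "next_in D1 x y" "\<rho>' y \<le> \<rho>' x" unfolding descents_def by blast
      have "\<not> (x = q \<and> y = p)" using y(2) e(1) by (auto simp: \<rho>'_local)
      then obtain z z' where z: "next_in T z z'" "x = ?last' z" "y = ?hd' z'"
        using y inner_ascent unfolding next_in_after by fastforce
      then have "z \<in> Z"
        using ascent[of z z'] y(2) next_in_in_set[OF z(1)] unfolding Z_def by force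
      then show "x \<in> ?last' ` Z" using z(2) by blast
    qed
    then have "card (descents D1 \<rho>') \<le> card Z"
      using \<open>finite Z\<close> by (meson card_image_le card_mono finite_imageI le_trans)
    also have "\<dots> = card (?last ` Z)"
      by (rule card_image[symmetric], rule inj_on_subset[OF inj_last_before Z])
    also have "\<dots> \<le> card (descents D0 \<rho>)"
    proof (rule card_mono)
      have "descents D0 \<rho> \<subseteq> passages D0"
        unfolding descents_def passages_def using next_in_in_set[of D0] by (auto simp: alphabet_def)
      then show "finite (descents D0 \<rho>)" using \<open>finite ?P\<close> by (rule finite_subset)
      show "?last ` Z \<subseteq> descents D0 \<rho>"
        unfolding Z_def descents_def next_in_before by blast
    qed
    finally show "card (descents D1 \<rho>') \<le> card (descents D0 \<rho>)" .
  next
    fix x y assume "late_over D1 \<rho>' x y"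
    then have xy: "next_in D1 x y" "level x \<noteq> Over" "level y = Over" "\<rho>' x < \<rho>' y"
      unfolding late_over_def by auto
    \<comment> \<open>Arc 1 carries a single level, arc 2 has no over-passage and \<open>p\<close>
      is none. So a late over-passage ranked before \<open>q\<close> follows along an outer edge,
      and undoing the shifts exhibits one in \<open>D0\<close>, against
      \<open>first\<close>.\<close>
    show "\<rho> q \<le> \<rho>' y"
    proof (rule ccontr)
      assume "\<not> \<rho> q \<le> \<rho>' y"
      then have y: "\<rho>' y < \<rho> q" by simp
      have "\<not> (lin_next (ord3 (lead p) B (mate p) C) x y \<or> lin_next (ord3 (lead q) (mate B) (mate q) (mate C)) x y)"
        using xy(2,3) level levels by (auto simp: ord3_def split: if_splits)
      then obtain z z' where z: "next_in T z z'" "x = ?last' z" "y = ?hd' z'"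
        using xy level unfolding next_in_after by blast
      have "z \<in> alphabet T" "z' \<in> alphabet T" using next_in_in_set[OF z(1)] by auto
      have "\<rho> (?last z) \<le> \<rho>' x \<and> level (?last z) \<noteq> Over"
        using \<open>z \<in> alphabet T\<close> xy y e(1) e_pq level levels unfolding z(2)
        by (cases rule: alphabet_cases) (auto simp: arcs' \<rho>'_local \<rho>'_X ord3_def split: if_splits)
      moreover have "\<rho>' y \<le> \<rho> (?hd z') \<and> \<rho> (?hd z') < \<rho> q \<and> level (?hd z') = Over"
        using \<open>z' \<in> alphabet T\<close> xy y e(1) e_pq level levels pq P_p unfolding z(3)
        by (cases rule: alphabet_cases) (auto simp: arcs' \<rho>'_local \<rho>'_X ord3_def split: if_splits)
      moreover have "next_in D0 (?last z) (?hd z')"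
        unfolding next_in_before using z(1) by blast
      ultimately have "late_over D0 \<rho> (?last z) (?hd z')"
        using xy(4) unfolding late_over_def by auto
      from first[OF this] show False
        using \<open>\<rho>' y \<le> \<rho> (?hd z') \<and> \<rho> (?hd z') < \<rho> q \<and> level (?hd z') = Over\<close> by simp
    qed
  next
    \<comment> \<open>Among the new passages only \<open>B\<close> and \<open>C\<close> can be
      overcrossings. In that case \<open>mate p\<close> lies over \<open>p\<close>, so their ranks
      are below that of \<open>p\<close> and hence of \<open>q\<close>.\<close>
    have "x \<in> overs_from D1 \<rho>' (\<rho> q) \<longleftrightarrow> x \<in> overs_from D0 \<rho> (\<rho> q)" for x
    proof -
      consider "x \<in> X" | "x \<in> old \<union> new" | "x \<notin> X \<union> (old \<union> new)" by blast
      then show ?thesis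
      proof cases
        case 2
        have *: "B \<notin> ?P" "C \<notin> ?P" "mate B \<notin> ?P" "mate C \<notin> ?P"
          unfolding passages_before using X_local unfolding old_def new_def by (auto simp: all_neqs)
        have "x \<in> passages D1" using 2 by (simp add: passages_after)
        from 2 this show ?thesis
          using * level levels in_P e(1) e_pq e_P unfolding overs_from_def
          by (cases rule: local_cases) (auto simp: \<rho>'_local)
      qed (auto simp: overs_from_def passages_before passages_after \<rho>'_X)
    qed
    then show "overs_from D1 \<rho>' (\<rho> q) = overs_from D0 \<rho> (\<rho> q)" by blast
  next
    let ?W = "others_upto D0 \<rho> (\<rho> q)" and ?W' = "others_upto D1 \<rho>' (\<rho> q)"
    have fin: "finite ?W" unfolding others_upto_def using \<open>finite ?P\<close> by simp
    have p: "p \<in> ?W" "p \<notin> ?W'"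
      unfolding others_upto_def using in_P level pq e(1) by (auto simp: \<rho>'_local)
    have B: "mate B \<notin> ?W'" "mate C \<notin> ?W'"
      unfolding others_upto_def using e(1) e_pq by (auto simp: \<rho>'_local)
    \<comment> \<open>\<open>B\<close> and \<open>C\<close> count here only if \<open>p\<close> is
      virtual; being within \<open>e\<close> of \<open>mate p\<close>, they then witness that
      \<open>mate p\<close> was already in \<open>?W\<close>.\<close>
    have sub: "x \<in> ?W \<or> (x = B \<or> x = C) \<and> mate p \<in> ?W" if "x \<in> ?W'" for x
    proof -
      have x: "x \<in> X \<union> (old \<union> new)" "level x \<noteq> Over" "\<rho>' x \<le> \<rho> q"
        using that unfolding others_upto_def passages_after by auto
      from x(1) show ?thesis
      proof
        assume "x \<in> X"
        then show ?thesis using x by (simp add: others_upto_def passages_before \<rho>'_X)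
      next
        have *: "\<rho> (mate p) \<le> \<rho> q" if "\<rho> (mate p) - e \<le> \<rho> q"
          using that e(2)[of q "mate p"] in_P e(1) by force
        assume "x \<in> old \<union> new"
        then show ?thesis
          using x(2,3) in_P * level levels e(1) e_pq p that B unfolding others_upto_def
          by (cases rule: local_cases) (auto simp: \<rho>'_local split: if_splits)
      qed
    qed
    show "weight ?W' < weight ?W"
    proof (cases "mate p \<in> ?W")
      case True
      have "?W' \<subseteq> ?W - {p} \<union> {B, C}" using sub p by blast
      then show ?thesis using weight_exchange[OF fin p(1) True _ B] by blast
    next
      case False
      then have "?W' \<subset> ?W" using sub p by blast
      then show ?thesis using weight_mono_strict[OF fin] by blast
    qed
  qed
qed

end

section \<open>Removing all late over-passages\<close>

lemma late_over_reduce: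
  assumes D: "diagram D" "ranked D \<rho>" and pq: "late_over D \<rho> p q"
    and first: "\<forall>x y. late_over D \<rho> x y \<longrightarrow> \<rho> q \<le> \<rho> y"
  obtains D' \<rho>' where "diagram_move\<^sup>*\<^sup>* D D'" "diagram D'" "ranked D' \<rho>'" "\<rho>' q = \<rho> q"
    "num_descents D' \<rho>' \<le> num_descents D \<rho>"
    "\<And>x y. late_over D' \<rho>' x y \<Longrightarrow> \<rho> q \<le> \<rho>' y"
    "overs_from D' \<rho>' (\<rho> q) = overs_from D \<rho> (\<rho> q)"
    "weight (others_upto D' \<rho>' (\<rho> q)) < weight (others_upto D \<rho> (\<rho> q))"
proof -
  have pq': "next_in D p q" "level p \<noteq> Over" "level q = Over" "\<rho> p < \<rho> q"
    using pq unfolding late_over_def by auto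
  have in_D: "p \<in> passages D" "q \<in> passages D"
    using next_in_in_set[OF pq'(1)] unfolding alphabet_def passages_def by auto
  \<comment> \<open>A kink is never late: if \<open>p\<close> were the mate of the over-passage
    \<open>q\<close>, it would be ranked after \<open>q\<close>.\<close>
  have "crossing p \<noteq> crossing q"
  proof
    assume "crossing p = crossing q"
    then have "p = q \<or> p = mate q"
      using D(1) in_D unfolding diagram_def valid_code_def by auto
    then have "p = mate q" using pq'(4) by auto
    then have "\<rho> q < \<rho> p" using D(2) in_D pq'(3) unfolding ranked_def by auto
    then show False using pq'(4) by simp
  qed
  from exchange_exists[OF D(1) pq'(1) this] obtain T X B C where ex: "exchange T X p q B C"
    and moves: "diagram_move\<^sup>*\<^sup>* D (expand (hole_word (exchange.before p q)) T)"
    and D0: "diagram (expand (hole_word (exchange.before p q)) T)"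
      "next_in (expand (hole_word (exchange.before p q)) T) = next_in D"
      "passages (expand (hole_word (exchange.before p q)) T) = passages D"
      "count_list T [] = count_list D []"
    and BC: "level B = level (mate p)" "level C = level (mate p)" .
  interpret exchange T X p q B C by (rule ex)
  have rho: "ranked D0 \<rho>" "late_over D0 \<rho> = late_over D \<rho>" "descents D0 \<rho> = descents D \<rho>"
    "overs_from D0 \<rho> = overs_from D \<rho>" "others_upto D0 \<rho> = others_upto D \<rho>"
    using D(2) D0(2,3)
    by (auto simp: ranked_def late_over_def fun_eq_iff descents_def overs_from_def others_upto_def)
  obtain \<rho>' where \<rho>': "ranked D1 \<rho>'" "\<rho>' q = \<rho> q" "card (descents D1 \<rho>') \<le> card (descents D \<rho>)"
    "\<And>x y. late_over D1 \<rho>' x y \<Longrightarrow> \<rho> q \<le> \<rho>' y"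
    "overs_from D1 \<rho>' (\<rho> q) = overs_from D \<rho> (\<rho> q)"
    "weight (others_upto D1 \<rho>' (\<rho> q)) < weight (others_upto D \<rho> (\<rho> q))"
    using exchange_ranks[OF pq'(2,3) BC rho(1) pq'(4)] first unfolding rho by blast
  have "level p = Under \<and> level q = Over \<and> level B = Over \<and> level C = Over \<or>
      level p = Virtual \<and> level B = Virtual \<and> level C = Virtual"
    using pq'(2,3) BC by (cases "level p") auto
  from exchange_reachable[OF _ this]
  have D1: "diagram_move\<^sup>*\<^sup>* D0 D1" "diagram D1"
    using D0(1) unfolding diagram_def by auto
  have "count_list D1 [] = count_list D []"
    unfolding D0(4)[symmetric] by (rule count_list_expand_Nil) (auto simp: letters arcs')
  then have "num_descents D1 \<rho>' \<le> num_descents D \<rho>"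
    using \<rho>'(3) unfolding num_descents_def by simp
  moreover have "diagram_move\<^sup>*\<^sup>* D D1" using moves D1(1) by (rule rtranclp_trans)
  ultimately show ?thesis using that D1(2) \<rho>' by blast
qed

text \<open>
  An exchange at the first late over-passage, of rank \<open>r\<close>, keeps the set of over-passages of rank at
  least \<open>r\<close> and lowers the weight of the other passages of rank at most \<open>r\<close>.
\<close>

lemma late_overs_removable:
  assumes "diagram D" "ranked D \<rho>"
  shows "\<exists>D' \<rho>'. diagram_move\<^sup>*\<^sup>* D D' \<and> diagram D' \<and> ranked D' \<rho>' \<and>
    num_descents D' \<rho>' \<le> num_descents D \<rho> \<and> (\<forall>x y. \<not> late_over D' \<rho>' x y)"
proof -
  have late: "\<exists>p q. late_over D \<rho> p q \<and> (\<forall>x y. late_over D \<rho> x y \<longrightarrow> \<rho> q \<le> \<rho> y)"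
    if "late_over D \<rho> x y" for D \<rho> x y
  proof -
    let ?S = "{q. \<exists>p. late_over D \<rho> p q}"
    have "?S \<subseteq> passages D"
      unfolding late_over_def passages_def using next_in_in_set[of D] by (auto simp: alphabet_def)
    then have "finite ?S" by (rule finite_subset) (simp add: passages_def)
    moreover have "?S \<noteq> {}" using that by blast
    ultimately obtain q where "q \<in> ?S" "\<forall>y\<in>?S. \<rho> q \<le> \<rho> y"
      using arg_min_if_finite(1)[of ?S \<rho>] arg_min_least[of ?S _ \<rho>] by metis
    then show ?thesis by blast
  qed
  have "\<exists>D' \<rho>'. diagram_move\<^sup>*\<^sup>* D D' \<and> diagram D' \<and> ranked D' \<rho>' \<and>
    num_descents D' \<rho>' \<le> num_descents D \<rho> \<and> (\<forall>x y. \<not> late_over D' \<rho>' x y)"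
    if "diagram D" "ranked D \<rho>" "late_over D \<rho> p q" "\<forall>x y. late_over D \<rho> x y \<longrightarrow> \<rho> q \<le> \<rho> y"
      "card (overs_from D \<rho> (\<rho> q)) = n" "weight (others_upto D \<rho> (\<rho> q)) = m"
    for D \<rho> p q n m
    using that
  proof (induction n arbitrary: m D \<rho> p q rule: less_induct)
    case (less n)
    note outer = less.IH
    from less.prems show ?case
    proof (induction m arbitrary: D \<rho> p q rule: less_induct)
      case (less m)
      obtain D' \<rho>' where D': "diagram_move\<^sup>*\<^sup>* D D'" "diagram D'" "ranked D' \<rho>'"
        "\<rho>' q = \<rho> q"
        "num_descents D' \<rho>' \<le> num_descents D \<rho>"
        "\<And>x y. late_over D' \<rho>' x y \<Longrightarrow> \<rho> q \<le> \<rho>' y"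
        "overs_from D' \<rho>' (\<rho> q) = overs_from D \<rho> (\<rho> q)"
        "weight (others_upto D' \<rho>' (\<rho> q)) < weight (others_upto D \<rho> (\<rho> q))"
        using late_over_reduce[OF less.prems(1-4)] by blast
      show ?case
      proof (cases "\<exists>x y. late_over D' \<rho>' x y")
        case False
        then show ?thesis using D' by blast
      next
        case True
        then obtain p' q' where late': "late_over D' \<rho>' p' q'"
          and first': "\<forall>x y. late_over D' \<rho>' x y \<longrightarrow> \<rho>' q' \<le> \<rho>' y"
          using late by blast
        have "\<exists>D'' \<rho>''. diagram_move\<^sup>*\<^sup>* D' D'' \<and> diagram D'' \<and> ranked D'' \<rho>'' \<and>
          num_descents D'' \<rho>'' \<le> num_descents D' \<rho>' \<and> (\<forall>x y. \<not> late_over D'' \<rho>'' x y)"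
        proof (cases "\<rho>' q' = \<rho> q")
          case True
          show ?thesis
            by (rule less.IH[OF _ D'(2,3) late' first' _ refl])
              (use D'(7,8) less.prems(5,6) True in auto)
        next
          \<comment> \<open>The first late rank has risen past \<open>q\<close>, so \<open>q\<close>
            leaves the set of over-passages and the outer measure drops, whatever happens to the
            weight.\<close>
          case False
          then have less_q: "\<rho> q < \<rho>' q'" using D'(6)[OF late'] by simp
          have "q \<in> overs_from D' \<rho>' (\<rho> q)"
            unfolding D'(7) using less.prems(3) next_in_in_set[of D p q]
            by (auto simp: overs_from_def late_over_def passages_def alphabet_def)
          moreover have "q \<notin> overs_from D' \<rho>' (\<rho>' q')"
            using less_q D'(4) by (simp add: overs_from_def)
          moreover have "overs_from D' \<rho>' (\<rho>' q') \<subseteq> overs_from D' \<rho>' (\<rho> q)"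
            using less_q unfolding overs_from_def by auto
          ultimately have "overs_from D' \<rho>' (\<rho>' q') \<subset> overs_from D' \<rho>' (\<rho> q)" by blast
          moreover have "finite (overs_from D' \<rho>' (\<rho> q))"
            by (simp add: overs_from_def passages_def)
          ultimately have "card (overs_from D' \<rho>' (\<rho>' q')) < card (overs_from D' \<rho>' (\<rho> q))"
            by (rule psubset_card_mono[rotated])
          then show ?thesis
            by (intro outer[OF _ D'(2,3) late' first' refl refl]) (use D'(7) less.prems(5) in auto)
        qed
        then show ?thesis using D'(1,5) by (meson le_trans rtranclp_trans)
      qed
    qed
  qed
  note main = this
  show ?thesis
  proof (cases "\<exists>x y. late_over D \<rho> x y")
    case True
    then obtain p q where "late_over D \<rho> p q" "\<forall>x y. late_over D \<rho> x y \<longrightarrow> \<rho> q \<le> \<rho> y"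
      using late by blast
    from main[OF assms this refl refl] show ?thesis .
  next
    case False
    then show ?thesis using assms by blast
  qed
qed

section \<open>Edges and strands\<close>

lemma nth_nth_inj:
  assumes "distinct (concat D)" "i < length D" "j < length (D ! i)" "i' < length D" "j' < length (D ! i')"
    and "D ! i ! j = D ! i' ! j'"
  shows "i = i' \<and> j = j'"
  using assms
proof (induction D arbitrary: i i')
  case (Cons w D)
  have disj: "set w \<inter> set (D ! k) = {}" if "k < length D" for k
    using Cons.prems(1) nth_mem[OF that] by (auto simp: disjoint_iff)
  show ?case
  proof (cases i; cases i')
    fix k k' assume "i = Suc k" "i' = Suc k'"
    then show ?thesis using Cons by auto
  next
    fix k assume "i = Suc k" "i' = 0"
    then show ?thesis using Cons.prems disj[of k] nth_mem by (metis disjoint_iff length_Cons nth_Cons_0 nth_Cons_Suc Suc_less_eq)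
  next
    fix k assume "i = 0" "i' = Suc k"
    then show ?thesis using Cons.prems disj[of k] nth_mem by (metis disjoint_iff length_Cons nth_Cons_0 nth_Cons_Suc Suc_less_eq)
  next
    assume "i = 0" "i' = 0"
    then show ?thesis using Cons.prems by (simp add: nth_eq_iff_index_eq)
  qed
qed simp

lemma passages_nth: "x \<in> passages D \<longleftrightarrow> (\<exists>i<length D. \<exists>j<length (D ! i). x = D ! i ! j)"
  unfolding passages_def set_concat UN_iff by (metis in_set_conv_nth)

lemma leaves_passage: "leaves D x e \<Longrightarrow> x \<in> passages D \<and> e \<in> edges D"
  unfolding leaves_def passages_nth edges_def by auto

lemma next_in_edge: "next_in D x y \<longleftrightarrow> (\<exists>e. leaves D x e \<and> enters D y e)"
proof
  assume "next_in D x y"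
  then obtain w j where w: "w \<in> set D" "j < length w" "x = w ! j" "y = w ! (Suc j mod length w)"
    unfolding follows_eq[symmetric] follows_def by blast
  then obtain i where "i < length D" "w = D ! i" by (metis in_set_conv_nth)
  with w have "leaves D x (i, j)" "enters D y (i, j)" by (simp_all add: leaves_def enters_def)
  then show "\<exists>e. leaves D x e \<and> enters D y e" by blast
next
  assume "\<exists>e. leaves D x e \<and> enters D y e"
  then obtain i j where "leaves D x (i, j)" "enters D y (i, j)" by auto
  then have "i < length D" "j < length (D ! i)" "x = D ! i ! j" "y = D ! i ! (Suc j mod length (D ! i))"
    by (simp_all add: leaves_def enters_def)
  then show "next_in D x y"
    unfolding follows_eq[symmetric] follows_def using nth_mem by blast
qed

lemma ex_leaves: "x \<in> passages D \<Longrightarrow> \<exists>e. leaves D x e"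
  unfolding passages_nth leaves_def by auto

lemma ex_enters:
  assumes "x \<in> passages D"
  shows "\<exists>e. enters D x e"
proof -
  obtain i j where ij: "i < length D" "j < length (D ! i)" "x = D ! i ! j"
    using assms unfolding passages_nth by blast
  define k where "k = (if j = 0 then length (D ! i) - 1 else j - 1)"
  have "Suc k mod length (D ! i) = j" "k < length (D ! i)"
    using ij unfolding k_def by auto
  then have "enters D x (i, k)" using ij unfolding enters_def by simp
  then show ?thesis ..
qed

lemma enters_leaves: "enters D x e \<Longrightarrow> \<exists>w. leaves D w e"
  unfolding enters_def leaves_def by auto

lemma leaves_unique_passage: "leaves D x e \<Longrightarrow> leaves D y e \<Longrightarrow> x = y"
  unfolding leaves_def by (auto split: prod.splits)

lemma leaves_unique_edge: "distinct (concat D) \<Longrightarrow> leaves D x e \<Longrightarrow> leaves D x e' \<Longrightarrow> e = e'"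
  using nth_nth_inj[of D "fst e" "snd e" "fst e'" "snd e'"]
  unfolding leaves_def by (simp add: split_beta prod_eq_iff)

lemma enters_unique_edge:
  assumes "distinct (concat D)" "enters D x e" "enters D x e'"
  shows "e = e'"
proof -
  obtain i j i' j' where e: "e = (i, j)" "e' = (i', j')" by (cases e, cases e')
  have *: "i < length D" "j < length (D ! i)" "D ! i ! (Suc j mod length (D ! i)) = x"
    "i' < length D" "j' < length (D ! i')" "D ! i' ! (Suc j' mod length (D ! i')) = x"
    using assms(2,3) unfolding e enters_def by auto
  then have "i = i' \<and> Suc j mod length (D ! i) = Suc j' mod length (D ! i')"
    by (intro nth_nth_inj[OF assms(1)]) (auto intro!: mod_less_divisor)
  then show ?thesis
    using * unfolding e by (auto simp: mod_Suc split: if_splits)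
qed

definition joined :: "code \<Rightarrow> edge \<Rightarrow> edge \<Rightarrow> bool" where
  "joined D e e' \<longleftrightarrow> (\<exists>x. level x \<noteq> Under \<and> enters D x e \<and> leaves D x e')"

definition strand :: "code \<Rightarrow> edge \<Rightarrow> edge set" where
  "strand D e = {e' \<in> edges D. equivclp (joined D) e e'}"

lemma strands_eq: "strands D = strand D ` edges D"
proof -
  have "{(a, b). a \<in> edges D \<and> b \<in> edges D \<and> equivclp (joined D) a b} `` {e} = strand D e"
    if "e \<in> edges D" for e
    using that by (simp add: strand_def Image_singleton)
  moreover have "joined D = (\<lambda>e e'. \<exists>x. level x \<noteq> Under \<and> enters D x e \<and> leaves D x e')"
    by (intro ext) (simp add: joined_def)
  ultimately show ?thesis
    unfolding strands_def classes_def quotient_def by (auto simp: UNION_singleton_eq_range)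
qed

lemma strand_eq_iff:
  assumes "e \<in> edges D" "e' \<in> edges D"
  shows "strand D e = strand D e' \<longleftrightarrow> equivclp (joined D) e e'"
proof
  assume "strand D e = strand D e'"
  moreover have "e' \<in> strand D e'" using assms(2) by (simp add: strand_def)
  ultimately have "e' \<in> strand D e" by simp
  then show "equivclp (joined D) e e'" by (simp add: strand_def)
next
  assume "equivclp (joined D) e e'"
  then have "equivclp (joined D) e = equivclp (joined D) e'" by (rule iffD2[OF equivclp_eq_iff])
  then show "strand D e = strand D e'" by (simp only: strand_def)
qed

lemma strand_self: "e \<in> edges D \<Longrightarrow> e \<in> strand D e"
  by (simp add: strand_def)

lemma strands_memD:
  assumes "s \<in> strands D" "e \<in> s"
  shows "e \<in> edges D" "s = strand D e"
proof -
  obtain e' where e': "e' \<in> edges D" "s = strand D e'" using assms(1) unfolding strands_eq by blast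
  with assms(2) show "e \<in> edges D" by (simp add: strand_def)
  with e' assms(2) show "s = strand D e" by (simp add: strand_eq_iff) (simp add: strand_def)
qed

lemma finite_edges: "finite (edges D)"
proof -
  have "edges D = (SIGMA i:{..<length D}. {..<max 1 (length (D ! i))})"
    by (auto simp: edges_def)
  then show ?thesis by simp
qed

lemma finite_strands: "finite (strands D)"
  unfolding strands_eq using finite_edges by simp

lemma strand_join:
  assumes "level x \<noteq> Under" "enters D x e" "leaves D x e'"
  shows "strand D e = strand D e'"
proof -
  have "e \<in> edges D" "e' \<in> edges D"
    using enters_leaves[OF assms(2)] assms(3) leaves_passage by blast+
  moreover have "joined D e e'" using assms unfolding joined_def by blast
  ultimately show ?thesis by (simp add: strand_eq_iff r_into_equivclp)
qed

lemma joined_component: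
  assumes "distinct (concat D)" "equivclp (joined D) e e'"
  shows "fst e = fst e'"
proof -
  have step: "fst e = fst e'" if j: "joined D e e'" for e e'
  proof -
    obtain x where x: "enters D x e" "leaves D x e'" using j unfolding joined_def by blast
    obtain i j where e: "e = (i, j)" by (cases e)
    have "leaves D x (i, Suc j mod length (D ! i))"
      using x(1) unfolding e enters_def leaves_def by (auto intro!: mod_less_divisor)
    from leaves_unique_edge[OF assms(1) this x(2)] show ?thesis using e by auto
  qed
  show ?thesis
    using assms(2)
  proof (induction rule: equivclp_induct)
    case (step y z)
    then show ?case using \<open>\<And>e e'. joined D e e' \<Longrightarrow> fst e = fst e'\<close> by metis
  qed simp
qed

section \<open>Edges without ascent\<close>

text \<open>The condition is vacuous on the edge of a crossing-free circle, which therefore is a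
  start edge. This matches the extra term of \<open>num_descents\<close>.\<close>

definition start_edges :: "code \<Rightarrow> (passage \<Rightarrow> real) \<Rightarrow> edge set" where
  "start_edges D \<rho> = {e \<in> edges D. \<forall>x y. leaves D x e \<and> enters D y e \<longrightarrow> \<rho> y \<le> \<rho> x}"

lemma start_edges_subset: "start_edges D \<rho> \<subseteq> edges D"
  unfolding start_edges_def by blast

lemma enters_unique_passage: "enters D x e \<Longrightarrow> enters D y e \<Longrightarrow> x = y"
  unfolding enters_def by (auto split: prod.splits)

lemma leaves_enters: "leaves D x e \<Longrightarrow> \<exists>y. enters D y e"
  unfolding enters_def leaves_def by auto

lemma card_start_edges:
  assumes "distinct (concat D)"
  shows "card (start_edges D \<rho>) = num_descents D \<rho>"
proof -
  let ?E = "{e \<in> edges D. \<exists>x\<in>descents D \<rho>. leaves D x e}"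
  let ?N = "{(i, j). i < length D \<and> D ! i = [] \<and> j = (0 :: nat)}"
  have desc: "leaves D x e \<Longrightarrow> enters D y e \<Longrightarrow> \<rho> y \<le> \<rho> x" if d: "x \<in> descents D \<rho>" for x y e
  proof -
    assume *: "leaves D x e" "enters D y e"
    obtain y' e' where "leaves D x e'" "enters D y' e'" "\<rho> y' \<le> \<rho> x"
      using d unfolding descents_def next_in_edge by blast
    then show "\<rho> y \<le> \<rho> x"
      using * leaves_unique_edge[OF assms] enters_unique_passage by metis
  qed
  have "start_edges D \<rho> = ?E \<union> ?N"
  proof (intro equalityI subsetI)
    fix e assume e: "e \<in> start_edges D \<rho>"
    show "e \<in> ?E \<union> ?N"
    proof (cases "\<exists>x. leaves D x e")
      case True
      then obtain x y where "leaves D x e" "enters D y e" using leaves_enters by blast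
      moreover from this have "x \<in> descents D \<rho>"
        using e unfolding start_edges_def descents_def next_in_edge by blast
      ultimately show ?thesis using e start_edges_subset by blast
    next
      case False
      then show ?thesis
        using e unfolding start_edges_def edges_def leaves_def by (cases e) (auto simp: max_def Suc_le_eq split: if_splits)
    qed
  next
    fix e assume "e \<in> ?E \<union> ?N"
    then show "e \<in> start_edges D \<rho>"
    proof
      assume "e \<in> ?E"
      then obtain x where x: "e \<in> edges D" "x \<in> descents D \<rho>" "leaves D x e" by blast
      have "\<rho> y \<le> \<rho> x'" if "leaves D x' e" "enters D y e" for x' y
        using desc[OF x(2,3) that(2)] leaves_unique_passage[OF x(3) that(1)] by simp
      then show ?thesis using x(1) unfolding start_edges_def by blast
    next
      assume "e \<in> ?N"
      then show ?thesis unfolding start_edges_def edges_def leaves_def by auto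
    qed
  qed
  moreover have "?E \<inter> ?N = {}" by (auto simp: leaves_def)
  moreover have "finite ?E" using finite_edges by simp
  moreover have N: "?N = (\<lambda>i. (i, 0)) ` {i. i < length D \<and> D ! i = []}" by auto
  moreover have "finite ?N" unfolding N by simp
  ultimately have "card (start_edges D \<rho>) = card ?E + card ?N"
    by (simp add: card_Un_disjoint)
  moreover have "card ?N = count_list D []"
  proof -
    have "card ?N = card {i. i < length D \<and> D ! i = []}"
      unfolding N by (rule card_image) (auto simp: inj_on_def)
    also have "\<dots> = length (filter (\<lambda>w. w = []) D)"
      by (simp add: length_filter_conv_card)
    also have "\<dots> = count_list D []" by (induction D) auto
    finally show ?thesis .
  qed
  moreover have "card ?E = card (descents D \<rho>)"
  proof -
    have "bij_betw (\<lambda>e. THE x. leaves D x e) ?E (descents D \<rho>)"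
    proof (rule bij_betw_imageI)
      have the: "(THE x. leaves D x e) = x" if "leaves D x e" for x e
        using that leaves_unique_passage by blast
      show "inj_on (\<lambda>e. THE x. leaves D x e) ?E"
        by (rule inj_onI) (use the leaves_unique_edge[OF assms] in auto)
      have "descents D \<rho> \<subseteq> passages D"
        unfolding descents_def next_in_edge using leaves_passage by blast
      then show "(\<lambda>e. THE x. leaves D x e) ` ?E = descents D \<rho>"
        using the ex_leaves leaves_passage by (auto simp: image_iff) (metis subsetD)
    qed
    then show ?thesis by (rule bij_betw_same_card)
  qed
  ultimately show ?thesis unfolding num_descents_def by simp
qed

lemma not_start_edge:
  assumes "leaves D x e" "enters D y e" "e \<notin> start_edges D \<rho>"
  shows "\<rho> x < \<rho> y"
proof (rule ccontr)
  assume "\<not> \<rho> x < \<rho> y"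
  then have "e \<in> start_edges D \<rho>"
    using assms(1,2) leaves_passage leaves_unique_passage enters_unique_passage
    unfolding start_edges_def by (auto; metis not_less)
  with assms(3) show False by blast
qed

lemma no_passage_start_edge:
  assumes "e \<in> edges D" "\<nexists>x. leaves D x e"
  shows "e \<in> start_edges D \<rho>"
  using assms unfolding start_edges_def by blast

text \<open>Real ranks are not well-ordered, but a code has finitely many passages, so the number of
  passages of smaller rank serves as the measure.\<close>

lemma rank_induct [consumes 1, case_names less]:
  assumes "x \<in> passages D"
    and "\<And>x. x \<in> passages D \<Longrightarrow> (\<And>y. y \<in> passages D \<Longrightarrow> (\<rho> y :: real) < \<rho> x \<Longrightarrow> Q y) \<Longrightarrow> Q x"
  shows "Q x"
  using assms(1)
proof (induction "card {y \<in> passages D. \<rho> y < \<rho> x}" arbitrary: x rule: less_induct)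
  case less
  show ?case
  proof (rule assms(2)[OF less.prems])
    fix y assume y: "y \<in> passages D" "\<rho> y < \<rho> x"
    then have "{w \<in> passages D. \<rho> w < \<rho> y} \<subset> {w \<in> passages D. \<rho> w < \<rho> x}" by auto
    then have "card {w \<in> passages D. \<rho> w < \<rho> y} < card {w \<in> passages D. \<rho> w < \<rho> x}"
      by (intro psubset_card_mono) (auto simp: passages_def)
    then show "Q y" using less.hyps y(1) by blast
  qed
qed

section \<open>From ranks to bridges and colorings\<close>

text \<open>Walk backwards along a bridge from an over-passage. While the rank decreases, the
  absence of late passages keeps the walk on over-passages, hence on the strand; it must stop, and
  it stops at a start edge.\<close>

lemma bridge_number_le:
  assumes valid: "valid_code D" and no_late: "\<And>x y. \<not> late_over D \<rho> x y"
  shows "bridge_number D \<le> num_descents D \<rho>"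
proof -
  have dist: "distinct (concat D)" using valid by (simp add: valid_code_def)
  define C where "C = {i. i < length D \<and> (\<forall>x\<in>set (D ! i). level x \<noteq> Over)}"
  have bridge: "\<exists>e'\<in>start_edges D \<rho>. e' \<in> strand D e"
    if "z \<in> passages D" "level z = Over" "leaves D z e" for z e
    using that
  proof (induction arbitrary: e rule: rank_induct[where \<rho> = \<rho>])
    case (less z)
    obtain e0 where e0: "enters D z e0" using ex_enters[OF less.hyps] by blast
    then obtain x where x: "leaves D x e0" using enters_leaves by blast
    have same: "strand D e0 = strand D e"
      using strand_join[OF _ e0 less.prems(2)] less.prems(1) by simp
    have "e0 \<in> edges D" "x \<in> passages D" using leaves_passage[OF x] by auto
    show ?case
    proof (cases "e0 \<in> start_edges D \<rho>")
      case True
      then show ?thesis using strand_self[OF \<open>e0 \<in> edges D\<close>] same by blast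
    next
      case False
      then have "\<rho> x < \<rho> z" using not_start_edge[OF x e0] by blast
      moreover have "next_in D x z" using x e0 next_in_edge by blast
      ultimately have "level x = Over"
        using no_late[of x z] less.prems(1) unfolding late_over_def by blast
      from less.IH[OF \<open>x \<in> passages D\<close> \<open>\<rho> x < \<rho> z\<close> this x] show ?thesis by (simp add: same)
    qed
  qed
  have "\<exists>e\<in>start_edges D \<rho>. e \<in> s" if s: "s \<in> over_bridges D" for s
  proof -
    obtain x e where x: "s \<in> strands D" "e \<in> s" "level x = Over" "leaves D x e"
      using s unfolding over_bridges_def by blast
    then show ?thesis
      using bridge[OF _ x(3,4)] leaves_passage[OF x(4)] strands_memD(2)[OF x(1,2)] by blast
  qed
  then obtain f where f: "\<And>s. s \<in> over_bridges D \<Longrightarrow> f s \<in> start_edges D \<rho> \<and> f s \<in> s" by metis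
  have "\<exists>e\<in>start_edges D \<rho>. fst e = i" if "i \<in> C" for i
  proof (cases "D ! i = []")
    case True
    then have "(i, 0) \<in> start_edges D \<rho>"
      using that unfolding C_def by (intro no_passage_start_edge) (auto simp: edges_def leaves_def)
    then show ?thesis by force
  next
    case False
    \<comment> \<open>The edge after a passage of maximal rank on the component cannot
      ascend.\<close>
    define j where "j = arg_min_on (\<lambda>j. - \<rho> (D ! i ! j)) {..<length (D ! i)}"
    have j: "j < length (D ! i)" "\<And>k. k < length (D ! i) \<Longrightarrow> \<rho> (D ! i ! k) \<le> \<rho> (D ! i ! j)"
      using arg_min_if_finite(1)[of "{..<length (D ! i)}" "\<lambda>j. - \<rho> (D ! i ! j)"]
        arg_min_least[of "{..<length (D ! i)}" _ "\<lambda>j. - \<rho> (D ! i ! j)"] False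
      unfolding j_def by (auto simp: lessThan_empty_iff)
    then have "(i, j) \<in> start_edges D \<rho>"
      using that False unfolding C_def start_edges_def edges_def leaves_def enters_def by auto
    then show ?thesis by force
  qed
  then have "\<forall>i\<in>C. \<exists>e. e \<in> start_edges D \<rho> \<and> fst e = i" by blast
  from bchoice[OF this] obtain g
    where g: "\<And>i. i \<in> C \<Longrightarrow> g i \<in> start_edges D \<rho> \<and> fst (g i) = i" by blast
  have "inj_on f (over_bridges D)"
  proof (rule inj_onI)
    fix s s' assume *: "s \<in> over_bridges D" "s' \<in> over_bridges D" "f s = f s'"
    then have "s = strand D (f s)" "s' = strand D (f s')"
      using f strands_memD(2) unfolding over_bridges_def by blast+
    with *(3) show "s = s'" by metis
  qed
  moreover have "inj_on g C" using g by (metis inj_onI)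
  \<comment> \<open>A strand stays in one component, and the component of a bridge has an
    overcrossing.\<close>
  moreover have "f s \<noteq> g i" if s: "s \<in> over_bridges D" "i \<in> C" for s i
  proof
    assume eq: "f s = g i"
    obtain x e where x: "s \<in> strands D" "e \<in> s" "level x = Over" "leaves D x e"
      using s(1) unfolding over_bridges_def by blast
    have "f s \<in> strand D e" using f[OF s(1)] strands_memD(2)[OF x(1,2)] by blast
    then have "fst e = i"
      using joined_component[OF dist, of e "f s"] g[OF s(2)] eq unfolding strand_def by auto
    then have "x \<in> set (D ! i)" using x(4) unfolding leaves_def by (auto split: prod.splits)
    then show False using s(2) x(3) unfolding C_def by blast
  qed
  then have "f ` over_bridges D \<inter> g ` C = {}" by blast
  moreover have "finite (over_bridges D)"
    using finite_strands unfolding over_bridges_def by simp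
  moreover have "finite C" unfolding C_def by simp
  ultimately have "bridge_number D = card (f ` over_bridges D \<union> g ` C)"
    unfolding bridge_number_def C_def[symmetric] by (subst card_Un_disjoint) (simp_all add: card_image)
  also have "\<dots> \<le> card (start_edges D \<rho>)"
    using f g by (intro card_mono finite_subset[OF start_edges_subset finite_edges]) auto
  finally show ?thesis by (simp only: card_start_edges[OF dist])
qed

text \<open>Seed the strands of the start edges and take a reachable coloring with the largest
  domain. By induction on rank it colors the strand after every passage. Only an inequality for
  \<open>k\<close> results because one strand may contain several start edges.\<close>

lemma fully_colorable_ranked:
  assumes valid: "valid_code D" and ranked: "ranked D \<rho>"
  obtains k where "k \<le> num_descents D \<rho>" "fully_colorable D k"
proof -
  have dist: "distinct (concat D)" using valid by (simp add: valid_code_def)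
  define A where "A = strand D ` start_edges D \<rho>"
  define k where "k = card A"
  have A: "A \<subseteq> strands D" unfolding A_def strands_eq using start_edges_subset by blast
  then have finA: "finite A" using finite_strands by (rule finite_subset)
  obtain h where h: "bij_betw h A {1..k}"
    using ex_bij_betw_nat_finite_1[OF finA] bij_betw_inv unfolding k_def by blast
  define f0 where "f0 s = (if s \<in> A then Some (h s) else None)" for s
  have dom0: "dom f0 = A" unfolding f0_def by (auto split: if_splits)
  have "bij_betw (Some \<circ> h) A (Some ` {1..k})"
    using h by (intro bij_betw_trans[OF h]) (auto simp: bij_betw_def)
  then have "bij_betw f0 A (Some ` {1..k})"
    by (rule bij_betw_cong[THEN iffD1, rotated]) (simp add: f0_def)
  moreover have "partial_coloring D k f0"
    using A h unfolding partial_coloring_def dom0 ran_def f0_def bij_betw_def by (auto split: if_splits)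
  ultimately have seeds: "seeds D k f0" unfolding seeds_def dom0 by blast
  let ?R = "{f. (coloring_move D k)\<^sup>*\<^sup>* f0 f}"
  have inv: "partial_coloring D k f \<and> A \<subseteq> dom f" if "f \<in> ?R" for f
  proof -
    have "(coloring_move D k)\<^sup>*\<^sup>* f0 f" using that by simp
    then show ?thesis
    proof (induction rule: rtranclp_induct)
      case base
      then show ?case using seeds dom0 unfolding seeds_def by auto
    next
      case (step f f')
      then show ?case unfolding coloring_move_def by blast
    qed
  qed
  have bound: "card (dom f) \<le> card (strands D)" if "f \<in> ?R" for f
    using inv[OF that] finite_strands unfolding partial_coloring_def by (blast intro: card_mono)
  obtain f where f: "f \<in> ?R" "\<And>f'. f' \<in> ?R \<Longrightarrow> card (dom f') \<le> card (dom f)"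
  proof -
    have "\<exists>f. f \<in> ?R \<and> (\<forall>f'. f' \<in> ?R \<longrightarrow> card (dom f') \<le> card (dom f))"
      by (rule ex_has_greatest_nat[where k = f0 and b = "Suc (card (strands D))"])
        (use bound in \<open>auto simp: less_Suc_eq_le\<close>)
    then show ?thesis using that by blast
  qed
  have fin: "finite (dom f)"
    using inv[OF f(1)] finite_strands finite_subset unfolding partial_coloring_def by blast
  have start: "strand D e \<in> dom f" if "e \<in> start_edges D \<rho>" for e
    using that inv[OF f(1)] unfolding A_def by blast
  have colored: "strand D e \<in> dom f" if "x \<in> passages D" "leaves D x e" for x e
    using that
  proof (induction arbitrary: e rule: rank_induct[where \<rho> = \<rho>])
    case (less x)
    obtain e0 where e0: "enters D x e0" using ex_enters[OF less.hyps] by blast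
    then obtain w where w: "leaves D w e0" using enters_leaves by blast
    have edges: "e0 \<in> edges D" "w \<in> passages D" "e \<in> edges D"
      using leaves_passage[OF w] leaves_passage[OF less.prems] by auto
    have e0_colored: "strand D e0 \<in> dom f"
      using start not_start_edge[OF w e0] less.IH[OF edges(2) _ w] by blast
    show ?case
    proof (cases "level x = Under")
      case False
      then show ?thesis using strand_join[OF False e0 less.prems] e0_colored by simp
    next
      \<comment> \<open>The strand arriving at \<open>x\<close> is colored, and so is the
        over-strand since \<open>mate x\<close> has smaller rank. If the strand after
        \<open>x\<close> were not, a coloring move would enlarge the maximal domain.\<close>
      case under: True
      have mate: "mate x \<in> passages D" "level (mate x) = Over"
        using valid less.hyps under unfolding valid_code_def by auto
      then have "\<rho> (mate x) < \<rho> x" using ranked unfolding ranked_def by force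
      obtain e1 where e1: "leaves D (mate x) e1" using ex_leaves[OF mate(1)] by blast
      have e1_colored: "strand D e1 \<in> dom f"
        using less.IH[OF mate(1) \<open>\<rho> (mate x) < \<rho> x\<close> e1] .
      have e1_edge: "e1 \<in> edges D" using leaves_passage[OF e1] by blast
      show ?thesis
      proof (rule ccontr)
        assume uncolored: "strand D e \<notin> dom f"
        obtain c where c: "f (strand D e0) = Some c" using e0_colored by blast
        define f' where "f' = f(strand D e \<mapsto> c)"
        have strands: "strand D e \<in> strands D" "strand D e0 \<in> strands D" "strand D e1 \<in> strands D"
          using edges e1_edge unfolding strands_eq by auto
        have "partial_coloring D k f'"
          using inv[OF f(1)] strands(1) c uncolored
          unfolding partial_coloring_def f'_def by (auto simp: ran_def split: if_splits)
        moreover have "adjacent D x (strand D e) (strand D e0)"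
          unfolding adjacent_def using strands under strand_self edges e0 less.prems by blast
        moreover have "over_strand D (mate x) (strand D e1)"
          unfolding over_strand_def using strands mate(2) e1 strand_self[OF e1_edge] by blast
        moreover have "dom f \<subset> dom f'" "dom f' - dom f = {strand D e}" "f' |` dom f = f"
          using uncolored unfolding f'_def by (auto simp: restrict_map_def fun_eq_iff)
        ultimately have "coloring_move D k f f'"
          using inv[OF f(1)] e0_colored e1_colored c
          unfolding coloring_move_def by (metis f'_def fun_upd_same)
        then have "f' \<in> ?R" using f(1) by auto
        moreover have "card (dom f') = Suc (card (dom f))"
          using fin uncolored unfolding f'_def by simp
        ultimately show False using f(2)[of f'] by simp
      qed
    qed
  qed
  have "dom f = strands D"
  proof
    show "dom f \<subseteq> strands D" using inv[OF f(1)] unfolding partial_coloring_def by blast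
    show "strands D \<subseteq> dom f"
      unfolding strands_eq
    proof
      fix s assume "s \<in> strand D ` edges D"
      then obtain e where e: "e \<in> edges D" "s = strand D e" by blast
      show "s \<in> dom f"
      proof (cases "\<exists>x. leaves D x e")
        case True
        then show ?thesis using colored leaves_passage e(2) by blast
      next
        case False
        then show ?thesis using start[OF no_passage_start_edge[OF e(1)]] e(2) by blast
      qed
    qed
  qed
  then have "fully_colorable D k" unfolding fully_colorable_def using seeds f(1) by blast
  moreover have "k \<le> num_descents D \<rho>"
    unfolding k_def A_def card_start_edges[OF dist, symmetric]
    by (rule card_image_le) (rule finite_subset[OF start_edges_subset finite_edges])
  ultimately show ?thesis using that by blast
qed

section \<open>Dances\<close>

definition arrivals :: "code \<Rightarrow> point set \<Rightarrow> point \<Rightarrow> real set" where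
  "arrivals D P a = {y. snd a < y \<and>
     (\<exists>x'. (fst a, x') \<in> P \<and> (y = x' \<or> y = x' + circumference D (fst a)))}"

lemma circumference_ge: "1 \<le> circumference D i" "real (length (D ! i)) \<le> circumference D i"
  by (simp_all add: circumference_def)

lemma circumference_nonempty: "D ! i \<noteq> [] \<Longrightarrow> circumference D i = real (length (D ! i))"
  by (cases "D ! i") (simp_all add: circumference_def)

lemma destination_arrivals:
  assumes "finite P" "a \<in> P"
  shows "destination D P a \<in> arrivals D P a" "\<And>y. y \<in> arrivals D P a \<Longrightarrow> destination D P a \<le> y"
    "destination D P a \<le> snd a + circumference D (fst a)" "snd a < destination D P a"
proof -
  have dest: "destination D P a = Min (arrivals D P a)"
    by (simp add: destination_def arrivals_def)
  have "arrivals D P a \<subseteq> (snd ` P) \<union> (\<lambda>(i, x). x + circumference D i) ` P"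
    unfolding arrivals_def by force
  then have fin: "finite (arrivals D P a)" by (rule finite_subset) (simp add: assms(1))
  have "snd a + circumference D (fst a) \<in> arrivals D P a"
    using assms(2) circumference_ge(1)[of D "fst a"] unfolding arrivals_def by force
  with fin show "destination D P a \<in> arrivals D P a" "destination D P a \<le> snd a + circumference D (fst a)"
    unfolding dest using Min_in by auto
  then show "snd a < destination D P a" unfolding arrivals_def by blast
  show "\<And>y. y \<in> arrivals D P a \<Longrightarrow> destination D P a \<le> y" unfolding dest using fin by simp
qed

lemma noncrossingD:
  assumes "P \<subseteq> noncrossing_points D" "(i, x) \<in> P"
  shows "i < length D" "0 \<le> x" "x < circumference D i" "\<And>j. j < length (D ! i) \<Longrightarrow> x \<noteq> real j"
  using assms unfolding noncrossing_points_def by auto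

text \<open>If two dancers met \<open>z\<close> at the same coordinate, the later starting point
  would have stopped the other one before. If they met it one turn apart, the starting point of the
  first, lifted by one turn, would have stopped the second.\<close>

lemma meets_unique:
  assumes dist: "distinct (concat D)" and P: "finite P" "P \<subseteq> noncrossing_points D"
    and ab: "a \<in> P" "b \<in> P" "meets D P a z p" "meets D P b z q"
  shows "a = b \<and> p = q"
proof -
  have lt: "a = b \<and> p = q" if ab: "a \<in> P" "b \<in> P" "meets D P a z p" "meets D P b z q" "p \<le> q" for a b p q
  proof -
    obtain i x i' y where eq: "a = (i, x)" "b = (i', y)" by (cases a, cases b)
    obtain j where j: "j < length (D ! i)" "D ! i ! j = z" "p = real j \<or> p = real j + circumference D i"
      using ab(3) unfolding meets_def eq by auto
    obtain j' where j': "j' < length (D ! i')" "D ! i' ! j' = z" "q = real j' \<or> q = real j' + circumference D i'"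
      using ab(4) unfolding meets_def eq by auto
    note x = noncrossingD[OF P(2) ab(1)[unfolded eq]] and y = noncrossingD[OF P(2) ab(2)[unfolded eq]]
    have "i = i'" "j = j'"
      using nth_nth_inj[OF dist x(1) j(1) y(1) j'(1)] j(2) j'(2) by auto
    note j' = j'[folded \<open>i = i'\<close> \<open>j = j'\<close>] and y = y[folded \<open>i = i'\<close>]
    have c: "1 \<le> circumference D i" by (rule circumference_ge)
    have bounds: "x < p" "p < destination D P a" "y < q" "q < destination D P b"
      using ab(3,4) unfolding meets_def eq by auto
    have arr: "destination D P a \<le> v" if "(i, x') \<in> P" "x < v" "v = x' \<or> v = x' + circumference D i" for v x'
      using that ab(1) by (intro destination_arrivals(2)[OF P(1)]) (auto simp: eq arrivals_def)
    have arr': "destination D P b \<le> v" if "(i, x') \<in> P" "y < v" "v = x' \<or> v = x' + circumference D i" for v x'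
      using that ab(2) \<open>i = i'\<close> by (intro destination_arrivals(2)[OF P(1)]) (auto simp: eq arrivals_def)
    have mem: "(i, x) \<in> P" "(i, y) \<in> P" using ab(1,2) \<open>i = i'\<close> by (auto simp: eq)
    have "p = q"
    proof (rule ccontr)
      assume "p \<noteq> q"
      then have "p = real j" "q = real j + circumference D i" using j(3) j'(3) ab(5) c by auto
      moreover have "y < x + circumference D i" using x(2) y(3) by simp
      ultimately show False using arr'[OF mem(1), of "x + circumference D i"] bounds by auto
    qed
    moreover have "x = y"
      using arr[OF mem(2), of y] arr'[OF mem(1), of x] bounds \<open>p = q\<close> by (cases x y rule: linorder_cases) auto
    ultimately show ?thesis using \<open>i = i'\<close> by (simp add: eq)
  qed
  show ?thesis
    using lt[OF ab] lt[OF ab(2,1,4,3)] by (cases "p \<le> q") auto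
qed

text \<open>The passage is met by the dancer from the nearest initial point behind it. If no initial
  point has a smaller coordinate, this is the last one on the component, whose dancer arrives after
  crossing the base point.\<close>

lemma ex_meets:
  assumes P: "finite P" "P \<subseteq> noncrossing_points D" and i: "i < length D" "j < length (D ! i)" "(i, x0) \<in> P"
  shows "\<exists>x p. (i, x) \<in> P \<and> meets D P (i, x) (D ! i ! j) p"
proof -
  let ?Q = "{x. (i, x) \<in> P}"
  have "?Q = snd ` (P \<inter> ({i} \<times> UNIV))" by force
  then have fin: "finite ?Q" using P(1) by simp
  have c: "real j < circumference D i" using i(2) circumference_ge(2)[of D i] by linarith
  show ?thesis
  proof (cases "\<exists>x\<in>?Q. x < real j")
    case True
    let ?L = "{x \<in> ?Q. x < real j}"
    define x where "x = Max ?L"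
    have x: "(i, x) \<in> P" "x < real j"
      using Max_in[of ?L] fin True unfolding x_def by auto
    have max: "x' \<le> x" if "(i, x') \<in> P" "x' < real j" for x'
      unfolding x_def using that fin by (intro Max_ge) auto
    have "real j < destination D P (i, x)"
    proof -
      obtain x' where x': "(i, x') \<in> P" "x < destination D P (i, x)"
          "destination D P (i, x) = x' \<or> destination D P (i, x) = x' + circumference D i"
        using destination_arrivals(1)[OF P(1) x(1), of D] unfolding arrivals_def by auto
      note n = noncrossingD[OF P(2) x'(1)]
      show ?thesis using x' max[OF x'(1)] n(2) n(4)[OF i(2)] c by linarith
    qed
    then have "meets D P (i, x) (D ! i ! j) (real j)"
      using x(2) i(2) unfolding meets_def by auto
    then show ?thesis using x(1) by blast
  next
    case False
    define x where "x = Max ?Q"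
    have x: "(i, x) \<in> P" using Max_in[of ?Q] fin i(3) unfolding x_def by auto
    have max: "x' \<le> x" if "(i, x') \<in> P" for x'
      unfolding x_def using that fin by (intro Max_ge) auto
    have "real j + circumference D i < destination D P (i, x)"
    proof -
      obtain x' where x': "(i, x') \<in> P" "x < destination D P (i, x)"
          "destination D P (i, x) = x' \<or> destination D P (i, x) = x' + circumference D i"
        using destination_arrivals(1)[OF P(1) x(1), of D] unfolding arrivals_def by auto
      have "real j < x'" using False x'(1) noncrossingD(4)[OF P(2) x'(1) i(2)] by force
      then show ?thesis using x' max[OF x'(1)] by linarith
    qed
    moreover have "x < real j + circumference D i" using noncrossingD(3)[OF P(2) x] by linarith
    ultimately have "meets D P (i, x) (D ! i ! j) (real j + circumference D i)"
      using i(2) unfolding meets_def by auto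
    then show ?thesis using x by blast
  qed
qed

section \<open>A rank from a dance\<close>

lemma dance_ranked:
  assumes valid: "valid_code D" and dance: "dance_configuration D n P"
  obtains \<rho> where "ranked D \<rho>" "num_descents D \<rho> \<le> n"
proof -
  have dist: "distinct (concat D)" using valid by (simp add: valid_code_def)
  have P: "finite P" "P \<subseteq> noncrossing_points D" "card P = n" "\<And>i. i < length D \<Longrightarrow> \<exists>x. (i, x) \<in> P"
    using dance unfolding dance_configuration_def by auto
  obtain \<gamma> where \<gamma>: "motion D P \<gamma>" "over_first D P \<gamma>"
    using dance unfolding dance_configuration_def by auto
  have mono: "\<gamma> a t \<le> \<gamma> a t'" if "a \<in> P" "t \<in> {0..1}" "t' \<in> {0..1}" "t \<le> t'" for a t t'
    using \<gamma>(1) that unfolding motion_def mono_on_def by blast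
  have unique: "a = b \<and> p = q" if "a \<in> P" "b \<in> P" "meets D P a z p" "meets D P b z q" for a b z p q
    using meets_unique[OF dist P(1,2) that] .
  \<comment> \<open>A dancer may rest at a passage, so the time need not be unique;
    \<open>\<rho>\<close> will select one such time for each passage.\<close>
  have time: "\<exists>t\<in>{0..1}. \<gamma> a t = p" if a: "a \<in> P" "meets D P a z p" for a z p
  proof -
    have "continuous_on {0..1} (\<gamma> a)" "\<gamma> a 0 \<le> p" "p \<le> \<gamma> a 1"
      using \<gamma>(1) a unfolding motion_def meets_def by auto
    then show ?thesis using IVT'[of "\<gamma> a" 0 p 1] by auto
  qed
  define dances_at where "dances_at z t \<longleftrightarrow> (\<exists>a\<in>P. \<exists>p. meets D P a z p \<and> t \<in> {0..1} \<and> \<gamma> a t = p)" for z t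
  define \<rho> where "\<rho> z = (SOME t. dances_at z t)" for z
  have \<rho>: "\<rho> z \<in> {0..1} \<and> \<gamma> a (\<rho> z) = p" if a: "a \<in> P" "meets D P a z p" for a z p
  proof -
    have "\<exists>t. dances_at z t" using time[OF a] a unfolding dances_at_def by blast
    then have "dances_at z (\<rho> z)" unfolding \<rho>_def by (rule someI_ex)
    then show ?thesis using unique[OF a(1) _ a(2)] unfolding dances_at_def by blast
  qed
  have ex_meet: "\<exists>a\<in>P. \<exists>p. meets D P a z p \<and> fst a = i"
    if "i < length D" "j < length (D ! i)" "z = D ! i ! j" for z i j
    using ex_meets[OF P(1,2) that(1,2)] P(4)[OF that(1)] that(3) by fastforce
  have "ranked D \<rho>"
    unfolding ranked_def
  proof (intro ballI impI)
    fix z assume z: "z \<in> passages D" "level z = Over"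
    then have "mate z \<in> passages D" using valid unfolding valid_code_def by blast
    then obtain b q where b: "b \<in> P" "meets D P b (mate z) q"
      using ex_meet unfolding passages_nth by metis
    obtain a p where a: "a \<in> P" "meets D P a z p"
      using ex_meet z(1) unfolding passages_nth by metis
    \<comment> \<open>When the under-dancer is at the crossing, the over-dancer is strictly beyond
      it. By monotonicity every time at which the latter is at the crossing is strictly
      earlier.\<close>
    have "p < \<gamma> a (\<rho> (mate z))"
      using \<gamma>(2) a b z(2) \<rho>[OF b] unfolding over_first_def by blast
    then show "\<rho> z < \<rho> (mate z)"
      using \<rho>[OF a] \<rho>[OF b] mono[OF a(1), of "\<rho> (mate z)" "\<rho> z"] by force
  qed
  \<comment> \<open>Without an initial point on the edge, a single dancer meets both its passages,
    at \<open>p\<close> and \<open>p + 1\<close>, and monotonicity makes the rank ascend. So each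
    start edge \<open>(i, j)\<close> contains an initial point, which determines it through the
    floor of the coordinate.\<close>
  moreover have "start_edges D \<rho> \<subseteq> (\<lambda>(i, x). (i, nat \<lfloor>x\<rfloor>)) ` P"
  proof
    fix e assume e: "e \<in> start_edges D \<rho>"
    obtain i j where ij: "e = (i, j)" by (cases e)
    have i: "i < length D" "j < max 1 (length (D ! i))"
      using e start_edges_subset unfolding ij edges_def by auto
    have "\<exists>x'. (i, x') \<in> P \<and> real j \<le> x' \<and> x' < real j + 1"
    proof (cases "D ! i = []")
      case True
      obtain x' where x': "(i, x') \<in> P" using P(4)[OF i(1)] by blast
      then show ?thesis
        using noncrossingD(2,3)[OF P(2) x'] True i(2) by (intro exI[of _ x']) (simp add: circumference_def)
    next
      case False
      let ?c = "circumference D i"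
      have c: "?c = real (length (D ! i))" by (rule circumference_nonempty[OF False])
      have j: "j < length (D ! i)" using i(2) False by (cases "D ! i") auto
      let ?x = "D ! i ! j" and ?y = "D ! i ! (Suc j mod length (D ! i))"
      have "leaves D ?x e" "enters D ?y e" using i(1) j by (simp_all add: ij leaves_def enters_def)
      then have descent: "\<rho> ?y \<le> \<rho> ?x" using e unfolding start_edges_def by blast
      obtain a p where a: "a \<in> P" "meets D P a ?x p" "fst a = i"
        using ex_meet[OF i(1) j] by blast
      obtain x where ax: "a = (i, x)" using a(3) by (cases a) auto
      note x = noncrossingD[OF P(2) a(1)[unfolded ax]]
      obtain j' where "j' < length (D ! i)" "D ! i ! j' = ?x" "p = real j' \<or> p = real j' + ?c"
        using a(2) unfolding meets_def ax by auto
      then have p: "p = real j \<or> p = real j + ?c"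
        using nth_nth_inj[OF dist i(1) _ i(1) j] by blast
      have bounds: "x < p" "p < destination D P a" using a(2) unfolding meets_def ax by auto
      have dest_le: "destination D P a \<le> x + ?c"
        using destination_arrivals(3)[OF P(1) a(1), of D] by (simp add: ax)
      obtain x' where x': "(i, x') \<in> P" "destination D P a = x' \<or> destination D P a = x' + ?c"
        using destination_arrivals(1)[OF P(1) a(1), of D] unfolding arrivals_def ax by auto
      note nx' = noncrossingD[OF P(2) x'(1)]
      show ?thesis
      proof (rule ccontr)
        assume none: "\<not> ?thesis"
        have j1: "real j + 1 \<le> ?c" using j c by simp
        \<comment> \<open>At \<open>real j + 1\<close> there is the next passage or, on the last
          edge, the circumference, which is outside the range of coordinates.\<close>
        have not_j1: "x' \<noteq> real j + 1"
        proof
          assume "x' = real j + 1"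
          moreover from this have "Suc j < length (D ! i)" using nx'(3) c by simp
          ultimately show False using nx'(4)[of "Suc j"] by simp
        qed
        have x'_pos: "x' \<noteq> 0" using nx'(4)[of 0] False by (cases "D ! i") auto
        have "x' < real j \<or> real j + 1 < x'" using none x'(1) not_j1 by (metis linorder_less_linear not_less)
        then have next_pos: "p + 1 < destination D P a"
          using p bounds x'(2) nx'(2,3) x'_pos j1 by linarith
        have "meets D P a ?y (p + 1)"
        proof (cases "Suc j < length (D ! i)")
          case True
          then show ?thesis
            using next_pos bounds p unfolding meets_def ax by (auto intro!: exI[of _ "Suc j"])
        next
          \<comment> \<open>The next passage is the one at coordinate 0, a turn later. The lift
            \<open>real j + circumference D i\<close> of \<open>p\<close> is excluded since no
            dancer goes further than one turn.\<close>
          case last: False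
          then have "Suc j = length (D ! i)" using j by simp
          then have "real j + 1 = ?c" using c by simp
          then have "p = real j" using p next_pos dest_le x(3) by linarith
          then have "p + 1 = real 0 + ?c" using \<open>real j + 1 = ?c\<close> by simp
          moreover have "Suc j mod length (D ! i) = 0" using \<open>Suc j = length (D ! i)\<close> by simp
          ultimately show ?thesis
            using next_pos bounds False unfolding meets_def ax by (auto intro!: exI[of _ 0])
        qed
        from \<rho>[OF a(1) this] \<rho>[OF a(1,2)] show False
          using mono[OF a(1) _ _ descent] by auto
      qed
    qed
    then obtain x' where "(i, x') \<in> P" "real j \<le> x'" "x' < real j + 1" by blast
    moreover from this have "nat \<lfloor>x'\<rfloor> = j" by linarith
    ultimately show "e \<in> (\<lambda>(i, x). (i, nat \<lfloor>x\<rfloor>)) ` P" unfolding ij by force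
  qed
  then have "card (start_edges D \<rho>) \<le> n"
    using P(1,3) by (meson card_image_le card_mono finite_imageI le_trans)
  ultimately show ?thesis using that card_start_edges[OF dist] by metis
qed

section \<open>A dance from the bridges\<close>

text \<open>The edge after an under-passage has no predecessor under \<open>joined\<close>, and
  predecessors are unique. So a zigzag starting at \<open>e\<close> straightens to a forward path,
  which cannot end in a second such edge.\<close>

lemma under_start_unique:
  assumes dist: "distinct (concat D)" and "equivclp (joined D) e e'"
    and e: "leaves D x e" "level x = Under" and e': "leaves D y e'" "level y = Under"
  shows "e = e'"
proof -
  have no_pred: "\<not> joined D e0 e1" if "leaves D w e1" "level w = Under" for e0 e1 w
    using that leaves_unique_passage unfolding joined_def by blast
  have inj: "e0 = e1" if "joined D e0 e2" "joined D e1 e2" for e0 e1 e2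
    using that leaves_unique_passage enters_unique_edge[OF dist] unfolding joined_def by metis
  have "(joined D)\<^sup>*\<^sup>* e e'"
    using assms(2)
  proof (induction rule: equivclp_induct)
    case (step u v)
    from step(2) show ?case
    proof
      assume "joined D u v"
      then show ?thesis using step(3) by simp
    next
      assume vu: "joined D v u"
      from step(3) show ?thesis
      proof (cases rule: rtranclp.cases)
        case rtrancl_refl
        then show ?thesis using vu no_pred[OF e] by blast
      next
        case (rtrancl_into_rtrancl u')
        then show ?thesis using vu inj by blast
      qed
    qed
  qed simp
  then show ?thesis
    using no_pred[OF e'] by (cases rule: rtranclp.cases) auto
qed

lemma bridge_dance:
  assumes valid: "valid_code D"
  obtains P where "dance_configuration D (bridge_number D) P"
proof -
  have dist: "distinct (concat D)" using valid by (simp add: valid_code_def)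
  define C where "C = {i. i < length D \<and> (\<forall>x\<in>set (D ! i). level x \<noteq> Over)}"
  define under where "under e \<longleftrightarrow> (\<exists>x. level x = Under \<and> leaves D x e)" for e
  \<comment> \<open>The first edge of a strand is the one that leaves an under-passage. A closed
    strand has none, and then any edge serves.\<close>
  define st where "st s = (SOME e. e \<in> s \<and> ((\<exists>e'\<in>s. under e') \<longrightarrow> under e))" for s
  have st: "st s \<in> s \<and> ((\<exists>e'\<in>s. under e') \<longrightarrow> under (st s))" if "s \<in> strands D" for s
  proof -
    have "\<exists>e. e \<in> s" using that strand_self unfolding strands_eq by blast
    then have "\<exists>e. e \<in> s \<and> ((\<exists>e'\<in>s. under e') \<longrightarrow> under e)" by blast
    then show ?thesis unfolding st_def by (rule someI_ex)
  qed
  have st_eq: "st s = e" if s: "s \<in> strands D" "e \<in> s" "under e" for s e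
  proof -
    have "under (st s)" "st s \<in> s" using st[OF s(1)] s(2,3) by blast+
    moreover have "equivclp (joined D) e (st s)"
      using strands_memD(2)[OF s(1,2)] \<open>st s \<in> s\<close> unfolding strand_def by blast
    ultimately show ?thesis
      using s(3) under_start_unique[OF dist] unfolding under_def by metis
  qed
  define E where "E = st ` over_bridges D \<union> (\<lambda>i. (i, 0)) ` C"
  have bridges: "s \<in> strands D" if "s \<in> over_bridges D" for s
    using that unfolding over_bridges_def by blast
  have component: "\<exists>x\<in>set (D ! fst e). level x = Over" if s: "s \<in> over_bridges D" "e \<in> s" for s e
  proof -
    obtain x e' where x: "e' \<in> s" "level x = Over" "leaves D x e'"
      using s(1) unfolding over_bridges_def by blast
    have "fst e' = fst e"
      using joined_component[OF dist] strands_memD(2)[OF bridges[OF s(1)] x(1)] s(2)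
      unfolding strand_def by blast
    then show ?thesis using x unfolding leaves_def by (auto split: prod.splits)
  qed
  have E_edges: "E \<subseteq> edges D"
    using st bridges strands_memD(1) unfolding E_def C_def by (fastforce simp: edges_def)
  have card_E: "card E = bridge_number D"
  proof -
    have "inj_on st (over_bridges D)"
      using st bridges strands_memD(2) by (metis inj_onI)
    moreover have "inj_on (\<lambda>i. (i, 0 :: nat)) C" by (rule inj_onI) simp
    moreover have "finite (over_bridges D)" using finite_strands unfolding over_bridges_def by simp
    moreover have "finite C" unfolding C_def by simp
    moreover have "st ` over_bridges D \<inter> (\<lambda>i. (i, 0)) ` C = {}"
    proof -
      have "st s \<noteq> (i, 0)" if s: "s \<in> over_bridges D" and i: "i \<in> C" for s i
      proof
        assume "st s = (i, 0)"
        then have "\<exists>x\<in>set (D ! i). level x = Over"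
          using component[OF s] st[OF bridges[OF s]] by (metis fst_conv)
        then show False using i unfolding C_def by blast
      qed
      then show ?thesis by blast
    qed
    ultimately show ?thesis
      unfolding E_def bridge_number_def C_def[symmetric] by (simp add: card_Un_disjoint card_image)
  qed
  \<comment> \<open>Dancers start at midpoints of edges. Initial points are thus half-integral and
    passages integral, which decides all comparisons below.\<close>
  define P where "P = (\<lambda>(i, j). (i, real j + 1 / 2)) ` E"
  have P_mem: "(i, real j + 1 / 2) \<in> P" if "(i, j) \<in> E" for i j
    using that unfolding P_def by force
  have P_D: "\<exists>j. x = real j + 1 / 2 \<and> (i, j) \<in> E" if "(i, x) \<in> P" for i x
    using that unfolding P_def by auto
  have "inj_on (\<lambda>(i, j). (i, real j + 1 / 2)) E" by (auto simp: inj_on_def)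
  then have card_P: "card P = bridge_number D"
    unfolding P_def card_E[symmetric] by (rule card_image)
  have fin: "finite P"
    unfolding P_def using finite_subset[OF E_edges finite_edges] by simp
  have P_noncrossing: "P \<subseteq> noncrossing_points D"
  proof
    fix a assume "a \<in> P"
    then obtain i j where a: "a = (i, real j + 1 / 2)" "(i, j) \<in> E" unfolding P_def by auto
    then have ij: "i < length D" "j < max 1 (length (D ! i))" using E_edges by (auto simp: edges_def)
    have "real j + 1 / 2 \<noteq> real k" for k
    proof
      assume "real j + 1 / 2 = real k"
      then have "real (2 * j + 1) = real (2 * k)" by simp
      then have "2 * j + 1 = 2 * k" by (simp only: of_nat_eq_iff)
      then show False by presburger
    qed
    moreover have "real j + 1 \<le> circumference D i"
      using ij(2) unfolding circumference_def by (auto simp: max_def split: if_splits)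
    ultimately show "a \<in> noncrossing_points D"
      using ij(1) unfolding a(1) noncrossing_points_def by simp
  qed
  have P_all: "\<exists>x. (i, x) \<in> P" if i: "i < length D" for i
  proof (cases "i \<in> C")
    case True
    then show ?thesis using P_mem[of i 0] unfolding E_def by blast
  next
    case False
    then obtain j where j: "j < length (D ! i)" "level (D ! i ! j) = Over"
      using i unfolding C_def by (auto simp: in_set_conv_nth)
    define s where "s = strand D (i, j)"
    have ij: "leaves D (D ! i ! j) (i, j)" "(i, j) \<in> edges D"
      using i j by (auto simp: leaves_def edges_def)
    then have s: "s \<in> strands D" "(i, j) \<in> s"
      unfolding s_def strands_eq using strand_self by blast+
    then have "s \<in> over_bridges D" using ij(1) j(2) unfolding over_bridges_def by blast
    moreover have "fst (st s) = i"
      using joined_component[OF dist, of "(i, j)" "st s"] st[OF s(1)] unfolding s_def strand_def by auto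
    ultimately have "(i, snd (st s)) \<in> E" unfolding E_def by (metis UnI1 imageI prod.collapse)
    then show ?thesis using P_mem by blast
  qed

  \<comment> \<open>Suppose a dancer passes under and later over. The last under-passage
    \<open>m\<close> in between starts the strand of that over-passage. This strand is a bridge, so
    there is an initial point just after \<open>m\<close> that stops the dancer too early.\<close>
  have over_under: "p < q"
    if a: "a \<in> P" and z: "meets D P a z p" "level z = Over" and w: "meets D P a w q" "level w = Under"
    for a z p w q
  proof (rule ccontr)
    assume "\<not> p < q"
    obtain i x where ax: "a = (i, x)" by (cases a)
    let ?L = "length (D ! i)"
    \<comment> \<open>Passages are numbered over two turns, so that a path across the base point
      becomes an interval of naturals read modulo \<open>?L\<close>.\<close>
    have "\<exists>n. v = real n \<and> D ! i ! (n mod ?L) = y \<and> n < 2 * ?L \<and> 0 < ?L" if yv: "meets D P a y v" for y v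
    proof -
      obtain j where j: "j < ?L" "D ! i ! j = y" "v = real j \<or> v = real j + circumference D i"
        using yv unfolding meets_def ax by auto
      then have "circumference D i = real ?L" by (intro circumference_nonempty) auto
      then have "v = real j \<or> v = real (j + ?L)" using j(3) by simp
      then show ?thesis
      proof
        assume "v = real j"
        then show ?thesis using j by (intro exI[of _ j]) auto
      next
        assume "v = real (j + ?L)"
        then show ?thesis using j by (intro exI[of _ "j + ?L"]) auto
      qed
    qed
    from this[OF z(1)] this[OF w(1)] obtain n1 n0 where
      n1: "p = real n1" "D ! i ! (n1 mod ?L) = z" "n1 < 2 * ?L" "0 < ?L" and
      n0: "q = real n0" "D ! i ! (n0 mod ?L) = w" by blast
    have "n0 \<noteq> n1" using n1 n0 z(2) w(2) by auto
    then have "n0 < n1" using \<open>\<not> p < q\<close> n1(1) n0(1) by simp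
    have i: "i < length D" using noncrossingD(1)[OF P_noncrossing] a ax by blast
    let ?U = "{n. n0 \<le> n \<and> n < n1 \<and> level (D ! i ! (n mod ?L)) = Under}"
    define m where "m = Max ?U"
    have "finite ?U" by simp
    moreover have "n0 \<in> ?U" using \<open>n0 < n1\<close> n0 w(2) by simp
    ultimately have "m \<in> ?U" unfolding m_def by (metis (no_types, lifting) Max_in empty_iff)
    then have m: "n0 \<le> m" "m < n1" "level (D ! i ! (m mod ?L)) = Under" by simp_all
    have mod_less: "n mod ?L < ?L" for n using n1(4) by (rule mod_less_divisor)
    have not_under: "level (D ! i ! (n mod ?L)) \<noteq> Under" if "m < n" "n \<le> n1" for n
    proof
      assume "level (D ! i ! (n mod ?L)) = Under"
      moreover from this have "n \<noteq> n1" using n1(2) z(2) by auto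
      ultimately have "n \<in> ?U" using that m by simp
      then have "n \<le> m" unfolding m_def by (rule Max_ge[OF \<open>finite ?U\<close>])
      then show False using that(1) by simp
    qed
    have leaves: "leaves D (D ! i ! (n mod ?L)) (i, n mod ?L)" for n
      using i mod_less by (simp add: leaves_def)
    have enters: "enters D (D ! i ! (Suc n mod ?L)) (i, n mod ?L)" for n
      using i mod_less by (simp add: enters_def mod_Suc_eq)
    have same: "strand D (i, m mod ?L) = strand D (i, n mod ?L)" if "m \<le> n" "n \<le> n1" for n
      using that
    proof (induction rule: dec_induct)
      case (step n)
      have "strand D (i, n mod ?L) = strand D (i, Suc n mod ?L)"
        by (rule strand_join[OF not_under[of "Suc n"] enters leaves]) (use step in auto)
      with step show ?case by simp
    qed simp
    define s where "s = strand D (i, n1 mod ?L)"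
    have edges: "(i, n mod ?L) \<in> edges D" for n using leaves leaves_passage by blast
    then have s: "s \<in> strands D" unfolding s_def strands_eq by blast
    have "s \<in> over_bridges D"
      using s leaves[of n1] n1(2) z(2) strand_self[OF edges] unfolding over_bridges_def s_def by blast
    moreover have m_s: "(i, m mod ?L) \<in> s"
      using same[of n1] m strand_self[OF edges[of m]] unfolding s_def by simp
    moreover have "under (i, m mod ?L)"
      using leaves[of m] m unfolding under_def by blast
    ultimately have "(i, m mod ?L) \<in> E"
      using st_eq[OF s m_s] unfolding E_def by (metis UnI1 imageI)
    then have mem: "(i, real (m mod ?L) + 1 / 2) \<in> P" by (rule P_mem)
    have "m mod ?L = m \<or> m = m mod ?L + ?L"
    proof (cases "m < ?L")
      case False
      then have "m mod ?L = m - ?L" using m n1(3) by (simp add: mod_if)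
      then show ?thesis using False by simp
    qed simp
    then have "real m = real (m mod ?L) \<or> real m = real (m mod ?L) + real ?L"
      by (metis of_nat_add)
    moreover have "circumference D i = real ?L"
      using n1(4) by (intro circumference_nonempty) auto
    moreover have "x < q" using w(1) unfolding meets_def ax by simp
    then have "x < real m + 1 / 2" using m n0(1) by simp
    ultimately have "real m + 1 / 2 \<in> arrivals D P a"
      using mem unfolding arrivals_def ax by auto
    then have "destination D P a \<le> real m + 1 / 2"
      by (rule destination_arrivals(2)[OF fin a])
    moreover have "real m + 1 \<le> real n1" using m by simp
    moreover have "p < destination D P a" using z(1) unfolding meets_def by blast
    ultimately show False using n1(1) by simp
  qed

  have circumference_nat: "circumference D i = real (max 1 (length (D ! i)))" for i
    by (simp add: circumference_def)
  have int_pos: "\<exists>n < 2 * max 1 (length (D ! fst a)). p = real n" if z: "meets D P a z p" for a z p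
  proof -
    let ?c = "max 1 (length (D ! fst a))"
    obtain j where j: "j < length (D ! fst a)" "p = real j \<or> p = real j + circumference D (fst a)"
      using z unfolding meets_def by auto
    then have "p = real j \<or> p = real (j + ?c)"
      unfolding circumference_nat by (simp only: of_nat_add)
    moreover have "j < 2 * ?c" "j + ?c < 2 * ?c" using j(1) by auto
    ultimately show ?thesis by blast
  qed
  have half_pos: "\<exists>n. destination D P a = real n + 1 / 2" if a: "a \<in> P" for a
  proof -
    obtain x' where x': "(fst a, x') \<in> P"
        "destination D P a = x' \<or> destination D P a = x' + circumference D (fst a)"
      using destination_arrivals(1)[OF fin a, of D] unfolding arrivals_def by auto
    obtain j where "x' = real j + 1 / 2" using P_D[OF x'(1)] by blast
    then have "destination D P a = real j + 1 / 2 \<or>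
        destination D P a = real (j + max 1 (length (D ! fst a))) + 1 / 2"
      using x'(2) unfolding circumference_nat of_nat_add by argo
    then show ?thesis by blast
  qed
  \<comment> \<open>A resting place for each dancer, after all over-passages and before all
    under-passages: half a unit beyond the last over-passage, or the start if there is none.\<close>
  have "\<exists>m. snd a \<le> m \<and> m \<le> destination D P a \<and>
      (\<forall>z p. level z = Over \<and> meets D P a z p \<longrightarrow> p < m) \<and>
      (\<forall>w q. level w = Under \<and> meets D P a w q \<longrightarrow> m < q)" if a: "a \<in> P" for a
  proof -
    let ?O = "{p. \<exists>z. level z = Over \<and> meets D P a z p}"
    show ?thesis
    proof (cases "?O = {}")
      case True
      moreover have "snd a < q" if "meets D P a w q" for w q using that unfolding meets_def by blast
      ultimately show ?thesis
        using destination_arrivals(4)[OF fin a, of D] by (intro exI[of _ "snd a"]) auto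
    next
      case False
      have "?O \<subseteq> real ` {..<2 * max 1 (length (D ! fst a))}"
        using int_pos by blast
      then have finO: "finite ?O" by (rule finite_subset) simp
      define M where "M = Max ?O"
      have "M \<in> ?O" unfolding M_def using finO False by (rule Max_in)
      then obtain z where z: "level z = Over" "meets D P a z M" by blast
      obtain n k where nk: "M = real n" "destination D P a = real k + 1 / 2"
        using int_pos[OF z(2)] half_pos[OF a] by blast
      have M: "snd a < M" "M < destination D P a" using z(2) unfolding meets_def by auto
      have "M + 1 / 2 \<le> destination D P a"
      proof -
        have "real n < real (Suc k)" using M(2) nk by simp
        then have "n \<le> k" by (simp only: of_nat_less_iff less_Suc_eq_le)
        then show ?thesis using nk by simp
      qed
      moreover have "p < M + 1 / 2" if "level y = Over" "meets D P a y p" for y p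
      proof -
        have "p \<le> M" unfolding M_def using finO that by (intro Max_ge) auto
        then show ?thesis by simp
      qed
      moreover have "M + 1 / 2 < q" if q: "level w = Under" "meets D P a w q" for w q
      proof -
        obtain l where l: "q = real l" using int_pos[OF q(2)] by blast
        have "real n < real l" using over_under[OF a z(2,1) q(2,1)] nk l by simp
        then have "Suc n \<le> l" by simp
        then have "real (Suc n) \<le> real l" by (simp only: of_nat_le_iff)
        then show ?thesis using nk l by simp
      qed
      ultimately show ?thesis using M(1) by (intro exI[of _ "M + 1 / 2"]) auto
    qed
  qed
  then have "\<forall>a\<in>P. \<exists>m. snd a \<le> m \<and> m \<le> destination D P a \<and>
      (\<forall>z p. level z = Over \<and> meets D P a z p \<longrightarrow> p < m) \<and>
      (\<forall>w q. level w = Under \<and> meets D P a w q \<longrightarrow> m < q)" by blast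
  from bchoice[OF this] obtain m where m: "\<And>a. a \<in> P \<Longrightarrow> snd a \<le> m a \<and> m a \<le> destination D P a"
    and m_over: "\<And>a z p. a \<in> P \<Longrightarrow> level z = Over \<Longrightarrow> meets D P a z p \<Longrightarrow> p < m a"
    and m_under: "\<And>a w q. a \<in> P \<Longrightarrow> level w = Under \<Longrightarrow> meets D P a w q \<Longrightarrow> m a < q" by blast
  \<comment> \<open>Every dancer moves linearly to the resting place until time 1/2, and from there
    linearly to the destination.\<close>
  define \<gamma> where "\<gamma> a t = snd a + min 1 (2 * t) * (m a - snd a) +
    max 0 (2 * t - 1) * (destination D P a - m a)" for a t
  have "motion D P \<gamma>"
    unfolding motion_def
  proof (intro ballI conjI)
    fix a assume a: "a \<in> P"
    show "continuous_on {0..1} (\<gamma> a)"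
      unfolding \<gamma>_def by (intro continuous_intros)
    show "mono_on {0..1} (\<gamma> a)"
      unfolding \<gamma>_def using m[OF a]
      by (intro mono_onI add_mono mult_right_mono order_refl) auto
    show "\<gamma> a 0 = snd a" "\<gamma> a 1 = destination D P a"
      unfolding \<gamma>_def by simp_all
  qed
  moreover have "over_first D P \<gamma>"
    unfolding over_first_def
  proof (intro ballI allI impI, elim conjE)
    fix a b z p q t
    assume a: "a \<in> P" and b: "b \<in> P" and z: "level z = Over" "meets D P a z p" "meets D P b (mate z) q"
      and t: "t \<in> {0..1 :: real}" "q \<le> \<gamma> b t"
    have "m b < q" using m_under[OF b _ z(3)] z(1) by simp
    \<comment> \<open>An under-passage lies strictly beyond the resting place, so it is reached only
      in the second half of the time, when all dancers have finished their over-passages.\<close>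
    have "1 / 2 < t"
    proof (rule ccontr)
      assume "\<not> 1 / 2 < t"
      then have "\<gamma> b t = snd b + 2 * t * (m b - snd b)" unfolding \<gamma>_def by simp
      also have "\<dots> \<le> snd b + 1 * (m b - snd b)"
        using m[OF b] \<open>\<not> 1 / 2 < t\<close> by (intro add_left_mono mult_right_mono) auto
      finally show False using \<open>m b < q\<close> t(2) by simp
    qed
    then have "\<gamma> a t = m a + (2 * t - 1) * (destination D P a - m a)" unfolding \<gamma>_def by simp
    moreover have "0 \<le> (2 * t - 1) * (destination D P a - m a)"
      using \<open>1 / 2 < t\<close> m[OF a] by (intro mult_nonneg_nonneg) auto
    ultimately show "p < \<gamma> a t" using m_over[OF a z(1,2)] by simp
  qed
  ultimately have "dance_configuration D (bridge_number D) P"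
    unfolding dance_configuration_def using fin card_P P_noncrossing P_all by blast
  then show ?thesis using that by blast
qed

section \<open>From diagrams to links\<close>

lemma virtual_link_nonempty:
  assumes "virtual_link K"
  shows "K \<noteq> {}"
  using assms unfolding virtual_link_def classes_def quotient_def by auto

lemma virtual_link_diagram:
  assumes "virtual_link K" "D \<in> K"
  shows "diagram D"
  using assms unfolding virtual_link_def classes_def quotient_def by auto

lemma virtual_link_moves:
  assumes K: "virtual_link K" and D: "D \<in> K" "diagram_move\<^sup>*\<^sup>* D D'"
  shows "D' \<in> K"
  using D(2)
proof (induction rule: rtranclp_induct)
  case (step E F)
  obtain D0 where D0: "diagram D0" "K = {F. diagram F \<and> equivclp diagram_move D0 F}"
    using K unfolding virtual_link_def classes_def quotient_def by auto
  have "equivclp diagram_move D0 F"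
    using step D0(2) by (auto intro: equivclp_trans r_into_equivclp)
  then show ?case using step(2) D0(2) unfolding diagram_move_def by simp
qed (rule D(1))

lemma dance_number_le: "dance_configuration D n P \<Longrightarrow> dance_number D \<le> n"
  unfolding dance_number_def by (rule Least_le) blast

lemma dance_number_attained:
  assumes "valid_code D"
  obtains P where "dance_configuration D (dance_number D) P"
proof -
  have "\<exists>n P. dance_configuration D n P" using bridge_dance[OF assms] by blast
  then have "\<exists>P. dance_configuration D (dance_number D) P"
    unfolding dance_number_def by (rule LeastI_ex)
  then show ?thesis using that by blast
qed

theorem theorem5p10:
  fixes K :: "code set"
  assumes "virtual_link K"
  shows "dance_index K \<ge> wirtinger_index K \<and> dance_index K = bridge_index K"
proof -
  note K = virtual_link_nonempty[OF assms] virtual_link_diagram[OF assms] virtual_link_moves[OF assms]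
  have "dance_index K \<in> dance_number ` K"
    unfolding dance_index_def using K(1) by (intro Inf_nat_def1) simp
  then obtain D where D: "D \<in> K" "dance_index K = dance_number D" by blast
  have valid: "valid_code D" using K(2)[OF D(1)] by (simp add: diagram_def)
  obtain P where "dance_configuration D (dance_number D) P"
    using dance_number_attained[OF valid] .
  then obtain \<rho> where \<rho>: "ranked D \<rho>" "num_descents D \<rho> \<le> dance_number D"
    using dance_ranked[OF valid] by blast

  obtain k where k: "k \<le> num_descents D \<rho>" "fully_colorable D k"
    using fully_colorable_ranked[OF valid \<rho>(1)] .
  have "wirtinger_index K \<le> wirtinger_number D"
    unfolding wirtinger_index_def using D(1) by (intro cINF_lower) auto
  also have "\<dots> \<le> k" unfolding wirtinger_number_def using k(2) by (rule Least_le)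
  finally have "wirtinger_index K \<le> dance_index K" using k(1) \<rho>(2) D(2) by simp

  \<comment> \<open>The diagram that attains the danceability index may have too many bridges; the
    bound holds for another diagram of \<open>K\<close>, obtained by removing the late
    over-passages.\<close>
  moreover have "bridge_index K \<le> dance_index K"
  proof -
    obtain D' \<rho>' where D': "diagram_move\<^sup>*\<^sup>* D D'" "diagram D'"
      "num_descents D' \<rho>' \<le> num_descents D \<rho>" "\<And>x y. \<not> late_over D' \<rho>' x y"
      using late_overs_removable[OF K(2)[OF D(1)] \<rho>(1)] by blast
    have "bridge_index K \<le> bridge_number D'"
      unfolding bridge_index_def using K(3)[OF D(1) D'(1)] by (intro cINF_lower) auto
    also have "\<dots> \<le> num_descents D' \<rho>'"
      using D'(2) by (intro bridge_number_le D'(4)) (simp add: diagram_def)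
    finally show ?thesis using D'(3) \<rho>(2) D(2) by simp
  qed

  moreover have "dance_index K \<le> bridge_index K"
  proof -
    have "bridge_index K \<in> bridge_number ` K"
      unfolding bridge_index_def using K(1) by (intro Inf_nat_def1) simp
    then obtain D' where D': "D' \<in> K" "bridge_index K = bridge_number D'" by blast
    have "valid_code D'" using K(2)[OF D'(1)] by (simp add: diagram_def)
    then have "dance_number D' \<le> bridge_number D'"
      using bridge_dance dance_number_le by blast
    moreover have "dance_index K \<le> dance_number D'"
      unfolding dance_index_def using D'(1) by (intro cINF_lower) auto
    ultimately show ?thesis using D'(2) by simp
  qed
  ultimately show ?thesis by simp
qed

end
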